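(* Consider the weak-to-strong (W2S) setting described in the context, and assume: (A1) (realizability) there is a measurable map $\eta^*:\mathcal X\to\mathbb R^K$ with $P^*(\xi=z_k\mid x)=\operatorname{softmax}_k(\eta^*(x))$ for all $k\in[K]$, with $\eta^*(x)^\top\mathbf 1=0$ for all $x$, and $\mathbb E_x\|\eta^*(x)\|_2^4<\infty$; (A2) (cost) for every $k\in[K]$, $c(\cdot,z_k)$ is $\mu$-strongly convex and $L$-smooth, i.e. $\mu I\preceq\nabla_a^2c(a,z_k)\preceq LI$ for all $a\in\mathcal A$; and $\|\nabla_a c(a,z_k)\|_2\le G$ for all $k\in[K]$ and all $a\in\mathcal W:=\operatorname{conv}\{\tilde w(p):p\in\Delta(\Xi)\}$; (A3) $\|\widehat\Theta_{\mathrm{ls}}\|_F\le B$ almost surely; (A4) (subgaussian features) with $\phi(x)=[\phi_{\mathrm s}(x);\phi_{\mathrm w}(x)]\in\mathbb R^{2d_\phi}$ and $\Sigma_\phi$ its covariance matrix, there is a constant $\kappa>0$ such that $\mathbb E_x[\exp(u^\top\phi(x))]\le\exp(\tfrac12\kappa^2u^\top\Sigma_\phi u)$ for all $u\in\mathbb R^{2d_\phi}$. Then, whenever $N\gtrsim d_{\mathrm s}$, $$\begin{aligned} \mathbb E_{\tilde{\mathcal B},\mathcal B}\big[R(\widehat\pi_{\mathrm{w2s}})-R^*\big]\lesssim{}&\Big(\frac{L^2KG^2}{\mu^3}+\frac{LKG^2}{\mu^2}\Big)\Bigg(\mathbb E_{\tilde{\mathcal B}}\big[\rho_{\mathrm s\to\mathrm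 w}(\widehat\Theta_{\mathrm w})\big]+\frac{(B_\Theta^{\mathrm w})^2}{\sqrt N}\big(\mathbb E_x\|\phi_{\mathrm w}(x)\|_2^4\big)^{1/2}\\ &\quad+\frac{B^2}{\sqrt N}\big(\mathbb E_x\|\phi_{\mathrm s}(x)\|_2^4\big)^{1/2}+\frac{BB_\Theta^{\mathrm w}}{\sqrt N}\big(\mathbb E_x[\|\phi_{\mathrm s}(x)\|_2^2\|\phi_{\mathrm w}(x)\|_2^2]\big)^{1/2}\Bigg)\\ &+\frac{LKG^2}{\mu^2}\Bigg(\frac{1}{\sqrt N}\big(\mathbb E_x\|\eta^*(x)\|_2^4\big)^{1/2}+\frac{B\sqrt{\operatorname{tr}(\Sigma_{\mathrm s})}}{\sqrt N}+\frac{B}{\sqrt N}\big(\mathbb E_x\|\eta^*(x)\|_2^4\big)^{1/4}\big(\mathbb E_x\|\phi_{\mathrm s}(x)\|_2^4\big)^{1/4}\\ &\quad+\lambda_{\max}(\Lambda_{\mathrm w})\,\mathbb E_{\tilde{\mathcal B}}\big[\|\widehat\Theta_{\mathrm w}-\Theta_{\mathrm w}^*\|_F^2\big]\Big(d_{\mathrm s\wedge\mathrm w}+\frac1N d_{\mathrm s}(d_{\mathrm w}-d_{\mathrm s\wedge\mathrm w})\Big)+\rho_{\mathrm w}+\rho_{\mathrm s}\Bigg)+\frac{L\,C_{\mathrm{unif}}}{\mu}\frac1{\sqrt N}. \end{aligned}$$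
   Context: Notation: $\lesssim$ (and $\gtrsim$) denotes inequality up to a universal constant factor, independent of any problem parameters. $[K]=\{1,\dots,K\}$; $\operatorname{softmax}_k(\eta)=e^{\eta_k}/\sum_je^{\eta_j}$. Decision problem: $\Xi=\{z_1,\dots,z_K\}$ is finite, $\Delta(\Xi)$ is the set of probability distributions on $\Xi$, $\mathcal X\subseteq\mathbb R^{d_x}$, the action set is $\mathcal A=\mathbb R^d$, and $c:\mathcal A\times\Xi\to\mathbb R$ is a cost. $\mathcal D$ is the joint law of $(x,\xi)\in\mathcal X\times\Xi$, $\mathcal D_x$ its marginal on $x$ ($\mathbb E_x$ is expectation over $x\sim\mathcal D_x$), $P^*(x)=P^*(\cdot\mid x)$ the conditional law of $\xi$ given $x$. For $p\in\Delta(\Xi)$, $\tilde w(p)\in\arg\min_{w\in\mathcal A}\mathbb E_{\xi\sim p}[c(w,\xi)]$. For a policy $\pi:\mathcal X\to\mathcal A$, $R(\pi)=\mathbb E_{(x,\xi)\sim\mathcal D}[c(\pi(x),\xi)]$, and $R^*=\mathbb E_{(x,\xi)\sim\mathcal D}[c(\tilde w(P^*(x)),\xi)]$. Data: $\tilde{\mathcal B}=\{(\tilde x_i,\tilde\xi_i)\}_{i=1}^n$ i.i.d. from $\mathcal D$ (labeled), $\mathcal B=\{x_j\}_{j=1}^N$ i.i.d. from $\mathcal D_x$ (unlabeled), independent of each other. Features: $\phi_{\mathrm s},\phi_{\mathrm w}:\mathcal X\to\mathbb R^{d_\phi}$ (strong, weak). For $\Theta\in\mathbb R^{d_\phi\times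 K}$, $P_\Theta^{\mathrm s}(x)=\operatorname{softmax}(\Theta^\top\phi_{\mathrm s}(x))$, $P_\Theta^{\mathrm w}(x)=\operatorname{softmax}(\Theta^\top\phi_{\mathrm w}(x))$. $\Sigma_{\mathrm s}=\mathbb E_x[\phi_{\mathrm s}\phi_{\mathrm s}^\top]$, $\Sigma_{\mathrm w}=\mathbb E_x[\phi_{\mathrm w}\phi_{\mathrm w}^\top]$, of ranks $d_{\mathrm s},d_{\mathrm w}$, with reduced spectral decompositions $\Sigma_{\mathrm s}=V_{\mathrm s}\Lambda_{\mathrm s}V_{\mathrm s}^\top$, $\Sigma_{\mathrm w}=V_{\mathrm w}\Lambda_{\mathrm w}V_{\mathrm w}^\top$ ($\Lambda$'s diagonal, containing the positive eigenvalues; $V$'s with orthonormal columns), and $\Sigma^{-1/2}:=V\Lambda^{-1/2}V^\top$. Correlation dimension: $d_{\mathrm s\wedge\mathrm w}=\|\Sigma_{\mathrm s}^{-1/2}\mathbb E_x[\phi_{\mathrm s}(x)\phi_{\mathrm w}(x)^\top]\Sigma_{\mathrm w}^{-1/2}\|_F^2$. Approximation errors: $\rho_{\mathrm s}=\min_{\Theta\mathbf 1=0}\mathbb E_x\|\Theta^\top\phi_{\mathrm s}(x)-\eta^*(x)\|_2^2$ and $\rho_{\mathrm w}=\min_{\Theta\mathbf 1=0}\mathbb E_x\|\Theta^\top\phi_{\mathrm w}(x)-\eta^*(x)\|_2^2$ (minima over $\Theta\in\mathbb R^{d_\phi\times K}$), with minimizers $\Theta_{\mathrm s}^*,\Theta_{\mathrm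 w}^*$. Estimators: $\widehat\Theta_{\mathrm w}\in\mathbb R^{d_\phi\times K}$ is an estimator constructed solely from $\tilde{\mathcal B}$ (and the weak features); the symbol $B_\Theta^{\mathrm w}$ denotes an almost sure bound on $\|\widehat\Theta_{\mathrm w}\|_F$. For the constant $B>0$, $\mathcal H_B=\{\Theta\in\mathbb R^{d_\phi\times K}:\|\Theta\|_F\le B\}$. The W2S estimator is $\widehat\Theta_{\mathrm{w2s}}\in\arg\min_{\Theta\in\mathcal H_B}\frac1N\sum_{j=1}^N\mathbb E_{\xi\sim P^{\mathrm w}_{\widehat\Theta_{\mathrm w}}(\cdot\mid x_j)}[c(\tilde w(P_\Theta^{\mathrm s}(x_j)),\xi)]$, and $\widehat\pi_{\mathrm{w2s}}(x)=\tilde w(P^{\mathrm s}_{\widehat\Theta_{\mathrm{w2s}}}(x))$. The least-squares estimator is $\widehat\Theta_{\mathrm{ls}}\in\arg\min_{\Theta\in\mathbb R^{d_\phi\times K}}\frac1N\sum_{j=1}^N\|\Theta^\top\phi_{\mathrm s}(x_j)-\widehat\Theta_{\mathrm w}^\top\phi_{\mathrm w}(x_j)\|_2^2$. Also $\rho_{\mathrm s\to\mathrm w}(\widehat\Theta_{\mathrm w})=\inf_{\Theta\in\mathcal H_B}\mathbb E_x\|\Theta^\top\phi_{\mathrm s}(x)-\widehat\Theta_{\mathrm w}^\top\phi_{\mathrm w}(x)\|_2^2$ and $C_{\mathrm{unif}}=\max_{k\in[K]}|c(\tilde w(\operatorname{softmax}(0)),z_k)|$. *)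

theory Defs
  imports "HOL-Probability.Probability"
begin

text \<open>
  All dimensions are natural numbers that occur inside formulas rather than types, so that a
  constant can be quantified before them. A vector of \<open>\<real>\<^sup>m\<close> is a function on the naturals that
  vanishes from index \<open>m\<close> on, and similarly for matrices; indices are shifted to start from \<open>0\<close>.
  On these sets, the (product) topology and the Borel sets of the function types
  are the Euclidean ones.
\<close>

type_synonym rvec = "nat \<Rightarrow> real"
type_synonym rmat = "nat \<Rightarrow> nat \<Rightarrow> real"

definition Rvec :: "nat \<Rightarrow> rvec set" where
  "Rvec m = {v. \<forall>i\<ge>m. v i = 0}"

definition Rmat :: "nat \<Rightarrow> nat \<Rightarrow> rmat set" where
  "Rmat m n = {A. \<forall>i j. m \<le> i \<or> n \<le> j \<longrightarrow> A i j = 0}"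

definition dotp :: "nat \<Rightarrow> rvec \<Rightarrow> rvec \<Rightarrow> real" where
  "dotp m u v = (\<Sum>i<m. u i * v i)"

definition vnorm :: "nat \<Rightarrow> rvec \<Rightarrow> real" where
  "vnorm m v = L2_set v {..<m}"

definition vdiff :: "rvec \<Rightarrow> rvec \<Rightarrow> rvec" where
  "vdiff u v = (\<lambda>i. u i - v i)"

definition mdiff :: "rmat \<Rightarrow> rmat \<Rightarrow> rmat" where
  "mdiff A B = (\<lambda>i j. A i j - B i j)"

definition fnorm :: "nat \<Rightarrow> nat \<Rightarrow> rmat \<Rightarrow> real" where
  "fnorm m n A = sqrt (\<Sum>i<m. \<Sum>j<n. (A i j)\<^sup>2)"

text \<open>\<open>A\<^sup>T v\<close> for a matrix \<open>A\<close> with \<open>m\<close> rows, and \<open>A B\<close> with inner dimension \<open>m\<close>.\<close>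

definition tmulv :: "nat \<Rightarrow> rmat \<Rightarrow> rvec \<Rightarrow> rvec" where
  "tmulv m A v = (\<lambda>k. \<Sum>i<m. A i k * v i)"

definition mprod :: "nat \<Rightarrow> rmat \<Rightarrow> rmat \<Rightarrow> rmat" where
  "mprod m A B = (\<lambda>i j. \<Sum>l<m. A i l * B l j)"

definition mtrace :: "nat \<Rightarrow> rmat \<Rightarrow> real" where
  "mtrace m A = (\<Sum>i<m. A i i)"

definition conv_hull :: "rvec set \<Rightarrow> rvec set" where
  "conv_hull S = {(\<lambda>i. \<Sum>l<m. u l * s l i) | (m::nat) (u::nat \<Rightarrow> real) (s::nat \<Rightarrow> rvec).
      (\<forall>l<m. 0 \<le> u l \<and> s l \<in> S) \<and> (\<Sum>l<m. u l) = 1}"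

text \<open>\<open>g\<close> is the gradient at \<open>a\<close> of the function \<open>f\<close> on \<open>\<real>\<^sup>d\<close> (in the sense of Frechet).\<close>

definition has_grad :: "nat \<Rightarrow> (rvec \<Rightarrow> real) \<Rightarrow> rvec \<Rightarrow> rvec \<Rightarrow> bool" where
  "has_grad d f g a \<longleftrightarrow>
     ((\<lambda>y. (f y - f a - dotp d g (vdiff y a)) / vnorm d (vdiff y a)) \<longlongrightarrow> 0) (at a within Rvec d)"

text \<open>
  \<open>S = V \<Lambda> V\<^sup>T\<close> for an \<open>m \<times> r\<close> matrix \<open>V\<close> with orthonormal columns and \<open>\<Lambda> = diag(lam)\<close> positive;
  in particular \<open>r\<close> is the rank of \<open>S\<close>. \<open>inv_sqrt\<close> is \<open>V \<Lambda>\<^sup>-\<^sup>1\<^sup>/\<^sup>2 V\<^sup>T\<close>.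
\<close>

definition reduced_spectral :: "nat \<Rightarrow> nat \<Rightarrow> rmat \<Rightarrow> rvec \<Rightarrow> rmat \<Rightarrow> bool" where
  "reduced_spectral m r V lam S \<longleftrightarrow>
     (\<forall>l<r. 0 < lam l) \<and>
     (\<forall>l<r. \<forall>l'<r. (\<Sum>i<m. V i l * V i l') = (if l = l' then 1 else 0)) \<and>
     (\<forall>i<m. \<forall>j<m. S i j = (\<Sum>l<r. V i l * lam l * V j l))"

definition inv_sqrt :: "nat \<Rightarrow> rmat \<Rightarrow> rvec \<Rightarrow> rmat" where
  "inv_sqrt r V lam = (\<lambda>i j. \<Sum>l<r. V i l * (1 / sqrt (lam l)) * V j l)"

text \<open>
  The scenario set \<open>\<Xi> = {z\<^sub>1, \<dots>, z\<^sub>K}\<close> carries no structure and is identified with \<open>{..<K}\<close>,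
  so \<open>c a k\<close> is the cost of action \<open>a\<close> under the scenario with index \<open>k\<close>.
\<close>

definition prob_simplex :: "nat \<Rightarrow> rvec set" where
  "prob_simplex K = {p \<in> Rvec K. (\<forall>k<K. 0 \<le> p k) \<and> (\<Sum>k<K. p k) = 1}"

definition softmax :: "nat \<Rightarrow> rvec \<Rightarrow> rvec" where
  "softmax K \<eta> = (\<lambda>k. if k < K then exp (\<eta> k) / (\<Sum>j<K. exp (\<eta> j)) else 0)"

definition mean_cost :: "nat \<Rightarrow> (rvec \<Rightarrow> nat \<Rightarrow> real) \<Rightarrow> rvec \<Rightarrow> rvec \<Rightarrow> real" where
  "mean_cost K c p w = (\<Sum>k<K. p k * c w k)"

definition decision_rule ::
    "nat \<Rightarrow> nat \<Rightarrow> (rvec \<Rightarrow> nat \<Rightarrow> real) \<Rightarrow> (rvec \<Rightarrow> rvec) \<Rightarrow> bool" where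
  "decision_rule d K c wt \<longleftrightarrow>
     (\<forall>p\<in>prob_simplex K. is_arg_min (mean_cost K c p) (\<lambda>w. w \<in> Rvec d) (wt p))"

text \<open>\<open>gc a k\<close> and \<open>Hc a k\<close> are the gradient and the Hessian of \<open>c(\<cdot>, z\<^sub>k)\<close> at \<open>a\<close>.\<close>

definition cost_assumption ::
    "nat \<Rightarrow> nat \<Rightarrow> (rvec \<Rightarrow> nat \<Rightarrow> real) \<Rightarrow> (rvec \<Rightarrow> nat \<Rightarrow> rvec) \<Rightarrow> (rvec \<Rightarrow> nat \<Rightarrow> rmat) \<Rightarrow>
     (rvec \<Rightarrow> rvec) \<Rightarrow> real \<Rightarrow> real \<Rightarrow> real \<Rightarrow> bool" where
  "cost_assumption d K c gc Hc wt \<mu> L G \<longleftrightarrow>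
     0 < \<mu> \<and> 0 < L \<and>
     (\<forall>k<K. \<forall>a\<in>Rvec d.
        has_grad d (\<lambda>a. c a k) (gc a k) a \<and>
        (\<forall>i<d. has_grad d (\<lambda>a. gc a k i) (Hc a k i) a) \<and>
        (\<forall>v\<in>Rvec d.
           \<mu> * (vnorm d v)\<^sup>2 \<le> (\<Sum>i<d. \<Sum>j<d. v i * Hc a k i j * v j) \<and>
           (\<Sum>i<d. \<Sum>j<d. v i * Hc a k i j * v j) \<le> L * (vnorm d v)\<^sup>2)) \<and>
     (\<forall>k<K. \<forall>a\<in>conv_hull (wt ` prob_simplex K). vnorm d (gc a k) \<le> G)"

text \<open>\<open>D\<close> is a law on \<open>X \<times> \<Xi>\<close>, where \<open>X \<subseteq> \<real>\<^bsup>dx\<^esup>\<close> has its trace Borel sets.\<close>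

definition joint_law :: "nat \<Rightarrow> rvec set \<Rightarrow> nat \<Rightarrow> (rvec \<times> nat) measure \<Rightarrow> bool" where
  "joint_law dx X K D \<longleftrightarrow>
     X \<subseteq> Rvec dx \<and> prob_space D \<and>
     sets D = sets (restrict_space borel X \<Otimes>\<^sub>M count_space {..<K})"

definition marginal :: "rvec set \<Rightarrow> (rvec \<times> nat) measure \<Rightarrow> rvec measure" where
  "marginal X D = distr D (restrict_space borel X) fst"

text \<open>\<open>Pstar\<close> is a regular conditional law of the second component of \<open>D\<close> given the first.\<close>

definition conditional_law ::
    "rvec set \<Rightarrow> nat \<Rightarrow> (rvec \<times> nat) measure \<Rightarrow> (rvec \<Rightarrow> rvec) \<Rightarrow> bool" where
  "conditional_law X K D Pstar \<longleftrightarrow>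
     (\<forall>x\<in>X. Pstar x \<in> prob_simplex K) \<and>
     (\<forall>k<K. (\<lambda>x. Pstar x k) \<in> borel_measurable (restrict_space borel X)) \<and>
     (\<forall>A\<in>sets (restrict_space borel X). \<forall>k<K.
        measure D (A \<times> {k}) = (\<integral>x\<in>A. Pstar x k \<partial>marginal X D))"

definition risk :: "(rvec \<times> nat) measure \<Rightarrow> (rvec \<Rightarrow> nat \<Rightarrow> real) \<Rightarrow> (rvec \<Rightarrow> rvec) \<Rightarrow> real" where
  "risk D c \<pi> = (\<integral>z. c (\<pi> (fst z)) (snd z) \<partial>D)"

text \<open>The matrix \<open>E[f g\<^sup>T]\<close>.\<close>

definition cross_moment :: "rvec measure \<Rightarrow> (rvec \<Rightarrow> rvec) \<Rightarrow> (rvec \<Rightarrow> rvec) \<Rightarrow> rmat" where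
  "cross_moment M f g = (\<lambda>i j. \<integral>x. f x i * g x j \<partial>M)"

definition covariance :: "rvec measure \<Rightarrow> (rvec \<Rightarrow> rvec) \<Rightarrow> rmat" where
  "covariance M f =
     (\<lambda>i j. \<integral>x. (f x i - (\<integral>y. f y i \<partial>M)) * (f x j - (\<integral>y. f y j \<partial>M)) \<partial>M)"

definition stack :: "nat \<Rightarrow> rvec \<Rightarrow> rvec \<Rightarrow> rvec" where
  "stack m u v = (\<lambda>i. if i < m then u i else if i < 2 * m then v (i - m) else 0)"

text \<open>
  Integrability is required explicitly because the integral of a function that is not integrable
  is \<open>0\<close> by convention.
\<close>

definition subgaussian :: "rvec measure \<Rightarrow> nat \<Rightarrow> (rvec \<Rightarrow> rvec) \<Rightarrow> real \<Rightarrow> bool" where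
  "subgaussian M m f \<kappa> \<longleftrightarrow>
     (\<forall>u\<in>Rvec m.
        integrable M (\<lambda>x. exp (dotp m u (f x))) \<and>
        (\<integral>x. exp (dotp m u (f x)) \<partial>M)
          \<le> exp (1/2 * \<kappa>\<^sup>2 * (\<Sum>i<m. \<Sum>j<m. u i * covariance M f i j * u j)))"

definition corr_dim ::
    "nat \<Rightarrow> rvec measure \<Rightarrow> (rvec \<Rightarrow> rvec) \<Rightarrow> (rvec \<Rightarrow> rvec) \<Rightarrow>
     nat \<Rightarrow> rmat \<Rightarrow> rvec \<Rightarrow> nat \<Rightarrow> rmat \<Rightarrow> rvec \<Rightarrow> real" where
  "corr_dim m M \<phi>s \<phi>w ds Vs lams dw Vw lamw =
     (fnorm m m (mprod m (mprod m (inv_sqrt ds Vs lams) (cross_moment M \<phi>s \<phi>w))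
                         (inv_sqrt dw Vw lamw)))\<^sup>2"

definition centered_mats :: "nat \<Rightarrow> nat \<Rightarrow> rmat set" where
  "centered_mats m K = {\<Theta> \<in> Rmat m K. \<forall>i<m. (\<Sum>k<K. \<Theta> i k) = 0}"

definition fro_ball :: "nat \<Rightarrow> nat \<Rightarrow> real \<Rightarrow> rmat set" where
  "fro_ball m K B = {\<Theta> \<in> Rmat m K. fnorm m K \<Theta> \<le> B}"

definition fit_error ::
    "rvec measure \<Rightarrow> nat \<Rightarrow> nat \<Rightarrow> (rvec \<Rightarrow> rvec) \<Rightarrow> (rvec \<Rightarrow> rvec) \<Rightarrow> rmat \<Rightarrow> real" where
  "fit_error M m K \<phi> h \<Theta> = (\<integral>x. (vnorm K (vdiff (tmulv m \<Theta> (\<phi> x)) (h x)))\<^sup>2 \<partial>M)"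

definition approx_error ::
    "rvec measure \<Rightarrow> nat \<Rightarrow> nat \<Rightarrow> (rvec \<Rightarrow> rvec) \<Rightarrow> (rvec \<Rightarrow> rvec) \<Rightarrow> real" where
  "approx_error M m K \<phi> \<eta> = (INF \<Theta>\<in>centered_mats m K. fit_error M m K \<phi> \<eta> \<Theta>)"

definition rho_sw ::
    "rvec measure \<Rightarrow> nat \<Rightarrow> nat \<Rightarrow> real \<Rightarrow> (rvec \<Rightarrow> rvec) \<Rightarrow> (rvec \<Rightarrow> rvec) \<Rightarrow> rmat \<Rightarrow> real" where
  "rho_sw M m K B \<phi>s \<phi>w \<Theta>w =
     (INF \<Theta>\<in>fro_ball m K B. fit_error M m K \<phi>s (\<lambda>x. tmulv m \<Theta>w (\<phi>w x)) \<Theta>)"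

definition policy :: "nat \<Rightarrow> nat \<Rightarrow> (rvec \<Rightarrow> rvec) \<Rightarrow> (rvec \<Rightarrow> rvec) \<Rightarrow> rmat \<Rightarrow> rvec \<Rightarrow> rvec" where
  "policy m K wt \<phi> \<Theta> = (\<lambda>x. wt (softmax K (tmulv m \<Theta> (\<phi> x))))"

definition w2s_objective ::
    "nat \<Rightarrow> nat \<Rightarrow> (rvec \<Rightarrow> nat \<Rightarrow> real) \<Rightarrow> (rvec \<Rightarrow> rvec) \<Rightarrow> (rvec \<Rightarrow> rvec) \<Rightarrow> (rvec \<Rightarrow> rvec) \<Rightarrow>
     nat \<Rightarrow> (nat \<Rightarrow> rvec) \<Rightarrow> rmat \<Rightarrow> rmat \<Rightarrow> real" where
  "w2s_objective m K c wt \<phi>s \<phi>w N xs \<Theta>w \<Theta> =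
     (1 / real N) *
     (\<Sum>j<N. mean_cost K c (softmax K (tmulv m \<Theta>w (\<phi>w (xs j)))) (policy m K wt \<phi>s \<Theta> (xs j)))"

definition ls_objective ::
    "nat \<Rightarrow> nat \<Rightarrow> (rvec \<Rightarrow> rvec) \<Rightarrow> (rvec \<Rightarrow> rvec) \<Rightarrow> nat \<Rightarrow> (nat \<Rightarrow> rvec) \<Rightarrow> rmat \<Rightarrow> rmat \<Rightarrow> real" where
  "ls_objective m K \<phi>s \<phi>w N xs \<Theta>w \<Theta> =
     (1 / real N) *
     (\<Sum>j<N. (vnorm K (vdiff (tmulv m \<Theta> (\<phi>s (xs j))) (tmulv m \<Theta>w (\<phi>w (xs j)))))\<^sup>2)"

text \<open>
  The labeled and the unlabeled sample are distributed according to product measures, and the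
  full data set according to their product.
\<close>

definition labeled_data :: "nat \<Rightarrow> (rvec \<times> nat) measure \<Rightarrow> (nat \<Rightarrow> rvec \<times> nat) measure" where
  "labeled_data n D = PiM {..<n} (\<lambda>_. D)"

definition all_data ::
    "nat \<Rightarrow> nat \<Rightarrow> rvec set \<Rightarrow> (rvec \<times> nat) measure \<Rightarrow> ((nat \<Rightarrow> rvec \<times> nat) \<times> (nat \<Rightarrow> rvec)) measure" where
  "all_data n N X D = labeled_data n D \<Otimes>\<^sub>M PiM {..<N} (\<lambda>_. marginal X D)"

definition c_unif :: "nat \<Rightarrow> (rvec \<Rightarrow> nat \<Rightarrow> real) \<Rightarrow> (rvec \<Rightarrow> rvec) \<Rightarrow> real" where
  "c_unif K c wt = Max ((\<lambda>k. \<bar>c (wt (softmax K (\<lambda>_. 0))) k\<bar>) ` {..<K})"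

end

theory Submission
  imports Defs
begin

text \<open>
  The excess risk of a parameter splits into its deviation from the empirical excess risk and the
  empirical excess risk itself.

  The deviation is bounded uniformly over the Frobenius ball by symmetrization and
  contraction; the excess cost is \<open>O(G\<^sup>2/\<mu>)\<close>-Lipschitz in the logits, which produces the term
  with \<open>B sqrt(tr \<Sigma>\<^sub>s)\<close>.

  For the empirical part, smoothness, strong convexity and the minimality of the estimator compare
  the three decisions based on the estimator, on any competitor \<open>\<Theta>\<close> in the ball and on the pseudo
  labels. This leaves the distance of \<open>\<Theta>\<^sup>T\<phi>\<^sub>s\<close> to the weak logits, whose infimum is
  \<open>\<rho>\<^sub>s\<^sub>\<rightarrow>\<^sub>w\<close>, and the distance of the weak logits to \<open>\<eta>\<^sup>*\<close>. The latter is not bounded by the full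
  weak estimation error: since the weak logits are \<open>\<rho>\<^sub>s\<^sub>\<rightarrow>\<^sub>w\<close>-close to the span of the strong
  features, only the component of that error in this span counts, and it carries the factor
  \<open>d\<^sub>s\<^sub>\<and>\<^sub>w\<close>. For \<open>N \<ge> 2 d\<^sub>s\<close> this factor is at most
  \<open>2 (d\<^sub>s\<^sub>\<and>\<^sub>w + d\<^sub>s (d\<^sub>w - d\<^sub>s\<^sub>\<and>\<^sub>w) / N)\<close>.
\<close>

subsection \<open>Decisions and their dependence on the logits\<close>

text \<open>The order of choices shapes the argument. Given the labeled sample, the weak parameter
  is a constant matrix, and the competitor from the ball is fixed before the unlabeled sample is
  drawn. The sample averages in the comparison therefore have exact expectations, namely values of
  \<open>fit_error\<close>; only the data-dependent estimator calls for uniform control. The infimum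
  over competitors is taken after integrating over the unlabeled sample, and the labeled sample is
  integrated last. A cost itself has no bound in terms of \<open>G\<close> and \<open>\<mu>\<close>,
  since constants may be added to it, but the difference of the costs of two decisions has one;
  hence everything is phrased with regrets. A supremum over the ball is uncountable, so the
  deviation is bounded on finite nets, where it is an integrable maximum, and the mesh tends to zero
  afterwards. The contraction for vector-valued logits is paid for by a factor \<open>K\<close>.
  Origin of the constants: \<open>8\<close> is the Lipschitz constant of softmax from the maximum
  norm to the \<open>l1\<close> norm, \<open>64 = 8 * 8\<close>, \<open>15\<close> comes from
  absorbing cross terms, and \<open>960 = 64 * 15\<close>.\<close>

lemma vnorm_nonneg [simp]: "0 \<le> vnorm m v"
  by (simp add: vnorm_def)

lemma vnorm_sq: "(vnorm m v)\<^sup>2 = (\<Sum>i<m. (v i)\<^sup>2)"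
  by (simp add: vnorm_def L2_set_def sum_nonneg)

lemma abs_nth_le_vnorm: "i < m \<Longrightarrow> \<bar>v i\<bar> \<le> vnorm m v"
  unfolding vnorm_def L2_set_def
  by (rule real_le_rsqrt) (auto intro: member_le_sum[where f="\<lambda>i. (v i)\<^sup>2"])

lemma vnorm_minus: "vnorm d (vdiff a b) = vnorm d (vdiff b a)"
  by (simp add: vnorm_def vdiff_def L2_set_def power2_commute)

lemma vnorm_pos:
  assumes "v \<in> Rvec d" "v \<noteq> (\<lambda>_. 0)"
  shows "0 < vnorm d v"
proof -
  obtain i where "v i \<noteq> 0" using assms(2) by auto
  moreover from this have "i < d" using assms(1) by (metis (mono_tags, lifting) Rvec_def mem_Collect_eq not_less)
  ultimately show ?thesis
    using abs_nth_le_vnorm[of i d v] by linarith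
qed

lemma dotp_le: "dotp d u v \<le> vnorm d u * vnorm d v"
proof -
  have "dotp d u v \<le> (\<Sum>i<d. \<bar>u i\<bar> * \<bar>v i\<bar>)"
    unfolding dotp_def by (intro sum_mono) (metis abs_ge_self abs_mult)
  also have "\<dots> \<le> vnorm d u * vnorm d v"
    unfolding vnorm_def by (rule L2_set_mult_ineq)
  finally show ?thesis .
qed

lemma vnorm_sq_triangle:
  "(vnorm d (vdiff a c))\<^sup>2 \<le> 2 * (vnorm d (vdiff a b))\<^sup>2 + 2 * (vnorm d (vdiff b c))\<^sup>2"
proof -
  have "(a i - c i)\<^sup>2 \<le> 2 * (a i - b i)\<^sup>2 + 2 * (b i - c i)\<^sup>2" for i
    using zero_le_power2[of "(a i - b i) - (b i - c i)"] by (simp add: power2_eq_square algebra_simps)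
  then show ?thesis
    unfolding vnorm_sq vdiff_def sum_distrib_left sum.distrib[symmetric] by (intro sum_mono)
qed

text \<open>Composing the punctured limit in \<open>has_grad\<close> with a line yields the
  one-dimensional difference quotient, up to the factor \<open>vnorm d v\<close>. All later calculus
  is thereby about real functions of one variable.\<close>

lemma has_grad_line:
  assumes f: "has_grad d f g (\<lambda>i. a i + t * v i)" and a: "a \<in> Rvec d" and v: "v \<in> Rvec d"
  shows "((\<lambda>s. f (\<lambda>i. a i + s * v i)) has_real_derivative dotp d g v) (at t)"
proof (cases "v = (\<lambda>_. 0)")
  case True
  then show ?thesis by (simp add: dotp_def)
next
  case False
  define \<gamma> where "\<gamma> s = (\<lambda>i. a i + s * v i)" for s
  let ?r = "\<lambda>y. (f y - f (\<gamma> t) - dotp d g (vdiff y (\<gamma> t))) / vnorm d (vdiff y (\<gamma> t))"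
  have pos: "0 < vnorm d v" using vnorm_pos[OF v False] .
  obtain j where j: "v j \<noteq> 0" using False by auto
  have "(\<gamma> \<longlongrightarrow> \<gamma> t) (at t)"
    unfolding \<gamma>_def
    by (intro isContD continuous_on_interior[where S=UNIV] continuous_on_coordinatewise_then_product)
      (auto intro!: continuous_intros)
  \<comment> \<open>The limit in \<open>has_grad\<close> excludes the base point, so the curve must
    avoid it; this is why the zero direction is split off.\<close>
  moreover have "\<gamma> s \<noteq> \<gamma> t" if "s \<noteq> t" for s
    using j that by (auto simp: \<gamma>_def fun_eq_iff)
  moreover have "\<gamma> s \<in> Rvec d" for s
    using a v by (auto simp: \<gamma>_def Rvec_def)
  ultimately have "filterlim \<gamma> (at (\<gamma> t) within Rvec d) (at t)"
    by (auto simp: filterlim_at eventually_at_filter)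
  then have "((\<lambda>s. ?r (\<gamma> s)) \<longlongrightarrow> 0) (at t)"
    using f unfolding has_grad_def \<gamma>_def[symmetric] by (rule filterlim_compose[rotated])
  then have "((\<lambda>s. \<bar>?r (\<gamma> s)\<bar> * vnorm d v) \<longlongrightarrow> 0) (at t)"
    using tendsto_mult_right[of _ 0 _ "vnorm d v"] tendsto_rabs by fastforce
  moreover have "\<bar>?r (\<gamma> s)\<bar> * vnorm d v = \<bar>(f (\<gamma> s) - f (\<gamma> t)) / (s - t) - dotp d g v\<bar>"
    if "s \<noteq> t" for s
  proof -
    have diff: "vdiff (\<gamma> s) (\<gamma> t) = (\<lambda>i. (s - t) * v i)"
      by (auto simp: vdiff_def \<gamma>_def algebra_simps)
    have "dotp d g (vdiff (\<gamma> s) (\<gamma> t)) = (s - t) * dotp d g v"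
      unfolding diff by (simp add: dotp_def sum_distrib_left algebra_simps)
    moreover have "vnorm d (vdiff (\<gamma> s) (\<gamma> t)) = \<bar>s - t\<bar> * vnorm d v"
      unfolding diff by (simp add: vnorm_def L2_set_def power_mult_distrib real_sqrt_mult
          flip: sum_distrib_left)
    moreover have "(f (\<gamma> s) - f (\<gamma> t)) / (s - t) - dotp d g v
        = (f (\<gamma> s) - f (\<gamma> t) - (s - t) * dotp d g v) / (s - t)"
      using that by (simp add: field_simps)
    ultimately show ?thesis
      using pos that by (simp add: abs_divide abs_mult)
  qed
  ultimately have "((\<lambda>s. \<bar>(f (\<gamma> s) - f (\<gamma> t)) / (s - t) - dotp d g v\<bar>) \<longlongrightarrow> 0) (at t)"
    by (elim Lim_transform_eventually) (auto simp: eventually_at_filter)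
  then have "((\<lambda>s. (f (\<gamma> s) - f (\<gamma> t)) / (s - t)) \<longlongrightarrow> dotp d g v) (at t)"
    using tendsto_rabs_zero_iff Lim_null by blast
  then show ?thesis
    by (simp add: has_field_derivative_iff \<gamma>_def)
qed

section \<open>Softmax and its Lipschitz constant\<close>

lemma softmax_in_simplex:
  assumes "1 \<le> K"
  shows "softmax K \<eta> \<in> prob_simplex K"
proof -
  have pos: "0 < (\<Sum>j<K. exp (\<eta> j))"
    using assms by (intro sum_pos) (auto simp: lessThan_empty_iff)
  then have "(\<Sum>k<K. softmax K \<eta> k) = 1"
    by (simp add: softmax_def flip: sum_divide_distrib)
  then show ?thesis
    using pos by (auto simp: prob_simplex_def Rvec_def softmax_def)
qed

lemma simplex_l1_le: 
  assumes "p \<in> prob_simplex K" "q \<in> prob_simplex K"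
  shows "(\<Sum>k<K. \<bar>p k - q k\<bar>) \<le> 2"
proof -
  have "(\<Sum>k<K. \<bar>p k - q k\<bar>) \<le> (\<Sum>k<K. p k + q k)"
    using assms by (intro sum_mono) (auto simp: prob_simplex_def abs_le_iff)
  also have "\<dots> = 2" using assms by (simp add: sum.distrib prob_simplex_def)
  finally show ?thesis .
qed

text \<open>The numerator and the normalizer each change by at most the factor
  \<open>exp M\<close>.\<close>

lemma softmax_ratio_le:
  assumes K: "1 \<le> K" and M: "\<And>k. k < K \<Longrightarrow> \<bar>\<eta> k - \<eta>' k\<bar> \<le> M" and k: "k < K"
  shows "softmax K \<eta> k \<le> exp (2 * M) * softmax K \<eta>' k"
proof -
  let ?S = "\<lambda>\<eta>. \<Sum>j<K. exp (\<eta> j)"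
  have pos: "0 < ?S \<eta>" for \<eta> :: rvec
    using K by (intro sum_pos) (auto simp: lessThan_empty_iff)
  have "exp (\<eta> k) \<le> exp (\<eta>' k + M)"
    using M[OF k] by (simp add: abs_le_iff)
  moreover have "?S \<eta>' \<le> exp M * ?S \<eta>"
    unfolding sum_distrib_left exp_add[symmetric] using M by (intro sum_mono) (force simp: abs_le_iff)
  ultimately have "exp (\<eta> k) * ?S \<eta>' \<le> exp (\<eta>' k + M) * (exp M * ?S \<eta>)"
    using pos[of \<eta>'] by (intro mult_mono) (auto intro: less_imp_le)
  also have "\<dots> = exp (2 * M) * exp (\<eta>' k) * ?S \<eta>"
    by (simp add: mult_ac flip: exp_add)
  finally show ?thesis
    using k pos[of \<eta>] pos[of \<eta>'] by (simp add: softmax_def field_simps)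
qed

lemma exp_minus_one_le:
  fixes x :: real
  assumes "0 \<le> x" "x \<le> 1"
  shows "exp x - 1 \<le> 2 * x"
proof -
  have "x\<^sup>2 \<le> x" using assms by (simp add: power2_eq_square mult_left_le)
  then show ?thesis using exp_bound[OF assms] by simp
qed

text \<open>For small \<open>M\<close> the ratio bound linearizes to a change of entry
  \<open>k\<close> by at most \<open>4 * M\<close> times the sum of both entries, and the two
  distributions have total mass \<open>2\<close>. For large \<open>M\<close> the trivial distance
  \<open>2\<close> between distributions is already below \<open>8 * M\<close>.\<close>

lemma softmax_l1_lipschitz:
  assumes K: "1 \<le> K" and M: "\<And>k. k < K \<Longrightarrow> \<bar>\<eta> k - \<eta>' k\<bar> \<le> M"
  shows "(\<Sum>k<K. \<bar>softmax K \<eta> k - softmax K \<eta>' k\<bar>) \<le> 8 * M"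
proof (cases "2 * M \<le> 1")
  case True
  let ?p = "softmax K \<eta>" and ?q = "softmax K \<eta>'"
  have simplex: "?p \<in> prob_simplex K" "?q \<in> prob_simplex K"
    by (auto intro: softmax_in_simplex[OF K])
  have "0 \<le> M" using M[of 0] K by force
  then have e: "exp (2 * M) \<le> 1 + 4 * M" using exp_minus_one_le[of "2 * M"] True by simp
  have M': "\<bar>\<eta>' k - \<eta> k\<bar> \<le> M" if "k < K" for k
    using M[OF that] by (simp add: abs_minus_commute)
  have "\<bar>?p k - ?q k\<bar> \<le> 4 * M * (?p k + ?q k)" if k: "k < K" for k
  proof -
    have nn: "0 \<le> ?p k" "0 \<le> ?q k" using simplex k by (auto simp: prob_simplex_def)
    have "?p k \<le> (1 + 4 * M) * ?q k"
      using softmax_ratio_le[where \<eta>=\<eta> and \<eta>'=\<eta>', OF K M k] mult_right_mono[OF e nn(2)] by linarith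
    moreover have "?q k \<le> (1 + 4 * M) * ?p k"
      using softmax_ratio_le[where \<eta>=\<eta>' and \<eta>'=\<eta>, OF K M' k] mult_right_mono[OF e nn(1)] by linarith
    moreover have "0 \<le> M * ?p k" "0 \<le> M * ?q k" using nn \<open>0 \<le> M\<close> by auto
    ultimately show ?thesis by (auto simp: algebra_simps abs_le_iff)
  qed
  then have "(\<Sum>k<K. \<bar>?p k - ?q k\<bar>) \<le> (\<Sum>k<K. 4 * M * (?p k + ?q k))"
    by (intro sum_mono) auto
  also have "\<dots> = 8 * M"
    using simplex by (simp add: sum.distrib prob_simplex_def flip: sum_distrib_left)
  finally show ?thesis .
next
  case False
  then show ?thesis
    using simplex_l1_le[OF softmax_in_simplex[OF K, of \<eta>] softmax_in_simplex[OF K, of \<eta>']] by linarith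
qed

section \<open>Decisions as minimizers of strongly convex mean costs\<close>

locale decision_problem =
  fixes d K :: nat and c gc Hc wt and \<mu> L G :: real
  assumes d: "1 \<le> d" and K: "1 \<le> K"
    and rule: "decision_rule d K c wt"
    and cost: "cost_assumption d K c gc Hc wt \<mu> L G"
begin

lemma mu_pos: "0 < \<mu>" and L_pos: "0 < L"
  using cost by (auto simp: cost_assumption_def)

text \<open>The Hessian bounds are compared on a unit vector, which exists because
  \<open>1 \<le> d\<close>. The inequality later turns the factor \<open>G\<^sup>2 / \<mu>\<close>
  of the deviation term into \<open>L * G\<^sup>2 / \<mu>\<^sup>2\<close>.\<close>

lemma mu_le_L: "\<mu> \<le> L"
proof -
  define v where "v = (\<lambda>i::nat. if i = 0 then 1 else (0::real))"
  have v: "v \<in> Rvec d" "(\<lambda>_. 0) \<in> Rvec d" using d by (auto simp: v_def Rvec_def)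
  have "(vnorm d v)\<^sup>2 = 1"
    unfolding vnorm_sq v_def using d by (simp add: if_distrib[of "\<lambda>x. x\<^sup>2"] sum.delta cong: if_cong)
  moreover have "\<mu> * (vnorm d v)\<^sup>2 \<le> L * (vnorm d v)\<^sup>2"
  proof -
    have "0 < K" using K by simp
    then have "\<mu> * (vnorm d v)\<^sup>2 \<le> (\<Sum>i<d. \<Sum>j<d. v i * Hc (\<lambda>_. 0) 0 i j * v j) \<and>
        (\<Sum>i<d. \<Sum>j<d. v i * Hc (\<lambda>_. 0) 0 i j * v j) \<le> L * (vnorm d v)\<^sup>2"
      using cost v unfolding cost_assumption_def by blast
    then show ?thesis by linarith
  qed
  ultimately show ?thesis by simp
qed

text \<open>Second-order Taylor expansion along the segment from \<open>a\<close> to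
  \<open>b\<close>; the Hessian bounds control the Lagrange remainder.\<close>

lemma cost_taylor:
  assumes k: "k < K" and a: "a \<in> Rvec d" and b: "b \<in> Rvec d"
  shows "c a k + dotp d (gc a k) (vdiff b a) + \<mu> / 2 * (vnorm d (vdiff b a))\<^sup>2 \<le> c b k" (is ?lower)
    and "c b k \<le> c a k + dotp d (gc a k) (vdiff b a) + L / 2 * (vnorm d (vdiff b a))\<^sup>2" (is ?upper)
proof -
  define v where "v = vdiff b a"
  define \<gamma> where "\<gamma> t = (\<lambda>i. a i + t * v i)" for t
  \<comment> \<open>The cost along the segment and its first two derivatives, packed into one family
    as \<open>Taylor_up\<close> expects.\<close>
  define D where "D n t = (if n = 0 then c (\<gamma> t) k else if n = 1 then dotp d (gc (\<gamma> t) k) v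
      else (\<Sum>i<d. \<Sum>j<d. v i * Hc (\<gamma> t) k i j * v j))" for n :: nat and t
  have v: "v \<in> Rvec d" using a b by (auto simp: v_def vdiff_def Rvec_def)
  have \<gamma>: "\<gamma> t \<in> Rvec d" for t using a v by (auto simp: \<gamma>_def Rvec_def)
  have grad: "has_grad d (\<lambda>a. c a k) (gc (\<gamma> t) k) (\<gamma> t)"
    "i < d \<Longrightarrow> has_grad d (\<lambda>a. gc a k i) (Hc (\<gamma> t) k i) (\<gamma> t)" for t i
    using cost k \<gamma>[of t] unfolding cost_assumption_def by blast+
  have "D 0 = (\<lambda>t. c (\<gamma> t) k)" by (auto simp: D_def)
  then have "(D 0 has_real_derivative D 1 t) (at t)" for t
    using has_grad_line[OF grad(1)[unfolded \<gamma>_def] a v] by (simp add: D_def[of "Suc 0"] \<gamma>_def)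
  moreover have "(D 1 has_real_derivative D (Suc 1) t) (at t)" for t
  proof -
    have "((\<lambda>t. \<Sum>i<d. gc (\<gamma> t) k i * v i) has_real_derivative
        (\<Sum>i<d. dotp d (Hc (\<gamma> t) k i) v * v i)) (at t)"
      using has_grad_line[OF grad(2)[unfolded \<gamma>_def] a v]
      by (intro DERIV_sum DERIV_cmult_right) (auto simp: \<gamma>_def)
    moreover have "(\<Sum>i<d. dotp d (Hc (\<gamma> t) k i) v * v i) = D (Suc 1) t"
      by (simp add: D_def dotp_def sum_distrib_left sum_distrib_right mult_ac)
    moreover have "D 1 = (\<lambda>t. \<Sum>i<d. gc (\<gamma> t) k i * v i)" by (auto simp: D_def dotp_def)
    ultimately show ?thesis by simp
  qed
  ultimately have "\<forall>n t. n < 2 \<and> 0 \<le> t \<and> t \<le> 1 \<longrightarrow> (D n has_real_derivative D (Suc n) t) (at t)"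
    by (auto simp: less_2_cases_iff)
  from Taylor_up[OF _ refl this, of 0] obtain t
    where t: "D 0 1 = D 0 0 + D 1 0 + D 2 t / 2"
    by (auto simp: numeral_2_eq_2)
  have "\<mu> * (vnorm d v)\<^sup>2 \<le> (\<Sum>i<d. \<Sum>j<d. v i * Hc (\<gamma> t) k i j * v j) \<and>
        (\<Sum>i<d. \<Sum>j<d. v i * Hc (\<gamma> t) k i j * v j) \<le> L * (vnorm d v)\<^sup>2"
    using cost k \<gamma>[of t] v unfolding cost_assumption_def by blast
  then have "\<mu> * (vnorm d v)\<^sup>2 \<le> D 2 t" "D 2 t \<le> L * (vnorm d v)\<^sup>2"
    by (simp_all add: D_def)
  moreover have "\<gamma> 1 = b" "\<gamma> 0 = a" by (auto simp: \<gamma>_def v_def vdiff_def)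
  ultimately show ?lower ?upper
    using t by (auto simp: D_def v_def)
qed

lemma wt_Rvec: "p \<in> prob_simplex K \<Longrightarrow> wt p \<in> Rvec d"
  and wt_min: "p \<in> prob_simplex K \<Longrightarrow> b \<in> Rvec d \<Longrightarrow> mean_cost K c p (wt p) \<le> mean_cost K c p b"
  using rule by (auto simp: decision_rule_def is_arg_min_def not_less)

text \<open>First-order condition: the minimum is over the whole space, so the mean cost has a local
  minimum at \<open>0\<close> along every line through \<open>wt p\<close>.\<close>

lemma mean_grad_zero:
  assumes p: "p \<in> prob_simplex K" and v: "v \<in> Rvec d"
  shows "(\<Sum>k<K. p k * dotp d (gc (wt p) k) v) = 0"
proof -
  define F where "F t = mean_cost K c p (\<lambda>i. wt p i + t * v i)" for t
  have "has_grad d (\<lambda>a. c a k) (gc (wt p) k) (\<lambda>i. wt p i + 0 * v i)" if "k < K" for k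
    using cost that wt_Rvec[OF p] unfolding cost_assumption_def by simp
  then have "(F has_real_derivative (\<Sum>k<K. p k * dotp d (gc (wt p) k) v)) (at 0)"
    unfolding F_def[abs_def] mean_cost_def
    by (intro DERIV_sum DERIV_cmult has_grad_line wt_Rvec p v) auto
  moreover have "F 0 \<le> F t" for t
    using wt_min[OF p, of "\<lambda>i. wt p i + t * v i"] wt_Rvec[OF p] v by (auto simp: F_def Rvec_def)
  ultimately show ?thesis
    by (intro DERIV_local_min[where f=F and d=1]) auto
qed

text \<open>Averaging the Taylor bounds with the weights \<open>p\<close> removes their linear terms
  by the first-order condition, and only the quadratic terms remain.\<close>

lemma mean_cost_growth:
  assumes p: "p \<in> prob_simplex K" and b: "b \<in> Rvec d"
  shows "mean_cost K c p (wt p) + \<mu> / 2 * (vnorm d (vdiff b (wt p)))\<^sup>2 \<le> mean_cost K c p b" (is ?lower)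
    and "mean_cost K c p b \<le> mean_cost K c p (wt p) + L / 2 * (vnorm d (vdiff b (wt p)))\<^sup>2" (is ?upper)
proof -
  let ?v = "vdiff b (wt p)"
  have v: "?v \<in> Rvec d" using b wt_Rvec[OF p] by (auto simp: Rvec_def vdiff_def)
  have nn: "0 \<le> p k" if "k < K" for k using p that by (auto simp: prob_simplex_def)
  have sum1: "(\<Sum>k<K. p k) = 1" using p by (simp add: prob_simplex_def)
  have split: "(\<Sum>k<K. p k * (c (wt p) k + dotp d (gc (wt p) k) ?v + x)) = mean_cost K c p (wt p) + x" for x
  proof -
    have "(\<Sum>k<K. p k * (c (wt p) k + dotp d (gc (wt p) k) ?v + x)) = 
      mean_cost K c p (wt p) + (\<Sum>k<K. p k * dotp d (gc (wt p) k) ?v) + (\<Sum>k<K. p k) * x"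
      by (simp add: mean_cost_def distrib_left sum.distrib flip: sum_distrib_right)
    then show ?thesis using mean_grad_zero[OF p v] sum1 by simp
  qed
  show ?lower
    unfolding split[symmetric] mean_cost_def[of K c p b] 
    by (intro sum_mono mult_left_mono cost_taylor(1) wt_Rvec p b nn) auto
  show ?upper
    unfolding split[symmetric] mean_cost_def[of K c p b] 
    by (intro sum_mono mult_left_mono cost_taylor(2) wt_Rvec p b nn) auto
qed

lemma grad_le:
  assumes "p \<in> prob_simplex K" "k < K"
  shows "vnorm d (gc (wt p) k) \<le> G"
proof -
  have "wt p \<in> conv_hull (wt ` prob_simplex K)"
    unfolding conv_hull_def using assms
    by (intro CollectI exI[of _ "1::nat"] exI[of _ "\<lambda>_. 1::real"] exI[of _ "\<lambda>_. wt p"]) auto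
  then show ?thesis using cost assms by (auto simp: cost_assumption_def)
qed

lemma G_nonneg: "0 \<le> G"
  using grad_le[OF softmax_in_simplex[OF K], of 0 "\<lambda>_. 0"] K vnorm_nonneg order_trans
  by (metis less_eq_Suc_le One_nat_def)

text \<open>By convexity the decrease from one decision to the other is at most the gradient at the
  first one times the distance. Gradients are thus evaluated only at decisions, where
  \<open>G\<close> bounds them; exchanging \<open>p\<close> and \<open>q\<close> gives the absolute
  value.\<close>

lemma cost_lipschitz:
  assumes p: "p \<in> prob_simplex K" and q: "q \<in> prob_simplex K" and k: "k < K"
  shows "\<bar>c (wt p) k - c (wt q) k\<bar> \<le> G * vnorm d (vdiff (wt p) (wt q))"
proof -
  have "c (wt p) k - c (wt q) k \<le> G * vnorm d (vdiff (wt p) (wt q))"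
    if p: "p \<in> prob_simplex K" and q: "q \<in> prob_simplex K" for p q
  proof -
    let ?v = "vdiff (wt q) (wt p)"
    have "0 \<le> \<mu> / 2 * (vnorm d ?v)\<^sup>2" using mu_pos by simp
    then have "c (wt p) k - c (wt q) k \<le> - dotp d (gc (wt p) k) ?v"
      using cost_taylor(1)[OF k wt_Rvec[OF p] wt_Rvec[OF q]] by linarith
    also have "\<dots> = dotp d (gc (wt p) k) (vdiff (wt p) (wt q))"
      by (simp add: dotp_def vdiff_def algebra_simps flip: sum_negf)
    also have "\<dots> \<le> vnorm d (gc (wt p) k) * vnorm d (vdiff (wt p) (wt q))"
      by (rule dotp_le)
    also have "\<dots> \<le> G * vnorm d (vdiff (wt p) (wt q))"
      by (intro mult_right_mono grad_le p k) simp
    finally show ?thesis .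
  qed
  from this[OF p q] this[OF q p] show ?thesis
    by (simp add: abs_le_iff vnorm_minus[of d "wt q"])
qed

text \<open>Adding the growth inequalities for \<open>p\<close> at \<open>wt q\<close> and for
  \<open>q\<close> at \<open>wt p\<close> leaves the pairing of \<open>p - q\<close> with a
  difference of costs. That difference is itself at most \<open>G * \<delta>\<close>, so one power
  of the distance \<open>\<delta>\<close> cancels.\<close>

lemma wt_lipschitz:
  assumes p: "p \<in> prob_simplex K" and q: "q \<in> prob_simplex K"
  shows "vnorm d (vdiff (wt p) (wt q)) \<le> G / \<mu> * (\<Sum>k<K. \<bar>p k - q k\<bar>)"
proof -
  define \<delta> where "\<delta> = vnorm d (vdiff (wt p) (wt q))"
  have "\<mu> * \<delta>\<^sup>2 \<le> (mean_cost K c p (wt q) - mean_cost K c p (wt p))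
      + (mean_cost K c q (wt p) - mean_cost K c q (wt q))"
    using mean_cost_growth(1)[OF p wt_Rvec[OF q]] mean_cost_growth(1)[OF q wt_Rvec[OF p]]
    by (simp add: \<delta>_def vnorm_minus[of d "wt q"])
  also have "\<dots> = (\<Sum>k<K. (p k - q k) * (c (wt q) k - c (wt p) k))"
    by (simp add: mean_cost_def algebra_simps flip: sum_subtractf sum.distrib)
  also have "\<dots> \<le> (\<Sum>k<K. \<bar>p k - q k\<bar> * (G * \<delta>))"
  proof (intro sum_mono)
    fix k assume "k \<in> {..<K}"
    then have "\<bar>c (wt q) k - c (wt p) k\<bar> \<le> G * \<delta>"
      using cost_lipschitz[OF p q, of k] by (simp add: \<delta>_def abs_minus_commute)
    then have "\<bar>p k - q k\<bar> * \<bar>c (wt q) k - c (wt p) k\<bar> \<le> \<bar>p k - q k\<bar> * (G * \<delta>)"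
      by (intro mult_left_mono) auto
    then show "(p k - q k) * (c (wt q) k - c (wt p) k) \<le> \<bar>p k - q k\<bar> * (G * \<delta>)"
      by (simp add: abs_le_iff flip: abs_mult)
  qed
  finally have "\<delta> * (\<mu> * \<delta>) \<le> \<delta> * (G * (\<Sum>k<K. \<bar>p k - q k\<bar>))"
    by (simp add: power2_eq_square sum_distrib_left mult_ac)
  then have "\<mu> * \<delta> \<le> G * (\<Sum>k<K. \<bar>p k - q k\<bar>)"
    using G_nonneg by (cases "\<delta> = 0") (auto simp: \<delta>_def less_le intro!: mult_nonneg_nonneg sum_nonneg)
  then show ?thesis
    using mu_pos by (simp add: \<delta>_def field_simps)
qed

lemma cost_l1_lipschitz:
  assumes p: "p \<in> prob_simplex K" and q: "q \<in> prob_simplex K" and k: "k < K"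
  shows "\<bar>c (wt p) k - c (wt q) k\<bar> \<le> G\<^sup>2 / \<mu> * (\<Sum>k<K. \<bar>p k - q k\<bar>)"
proof -
  have "\<bar>c (wt p) k - c (wt q) k\<bar> \<le> G * (G / \<mu> * (\<Sum>k<K. \<bar>p k - q k\<bar>))"
    using cost_lipschitz[OF p q k] mult_left_mono[OF wt_lipschitz[OF p q] G_nonneg] by linarith
  then show ?thesis by (simp add: power2_eq_square)
qed

lemma cost_softmax_lipschitz:
  assumes "k < K" and "\<And>k. k < K \<Longrightarrow> \<bar>\<eta> k - \<eta>' k\<bar> \<le> M"
  shows "\<bar>c (wt (softmax K \<eta>)) k - c (wt (softmax K \<eta>')) k\<bar> \<le> 8 * G\<^sup>2 / \<mu> * M"
proof -
  have "0 \<le> G\<^sup>2 / \<mu>" using mu_pos by simp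
  from mult_left_mono[OF softmax_l1_lipschitz[where \<eta>=\<eta> and \<eta>'=\<eta>', OF K assms(2)] this] show ?thesis
    using cost_l1_lipschitz[OF softmax_in_simplex[OF K] softmax_in_simplex[OF K] assms(1), of \<eta> \<eta>']
    by (simp add: mult_ac)
qed

text \<open>The maximum norm in \<open>softmax_l1_lipschitz\<close> is bounded by the Euclidean
  norm; the square of its constant is \<open>64\<close>.\<close>

lemma wt_softmax_lipschitz:
  "(vnorm d (vdiff (wt (softmax K \<eta>)) (wt (softmax K \<eta>'))))\<^sup>2
    \<le> 64 * G\<^sup>2 / \<mu>\<^sup>2 * (vnorm K (vdiff \<eta> \<eta>'))\<^sup>2"
proof -
  let ?M = "vnorm K (vdiff \<eta> \<eta>')"
  have "(\<Sum>k<K. \<bar>softmax K \<eta> k - softmax K \<eta>' k\<bar>) \<le> 8 * ?M"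
    using abs_nth_le_vnorm[of _ K "vdiff \<eta> \<eta>'"]
    by (intro softmax_l1_lipschitz[OF K]) (auto simp: vdiff_def)
  then have "vnorm d (vdiff (wt (softmax K \<eta>)) (wt (softmax K \<eta>'))) \<le> G / \<mu> * (8 * ?M)"
    using wt_lipschitz[OF softmax_in_simplex[OF K] softmax_in_simplex[OF K], of \<eta> \<eta>'] 
      G_nonneg mu_pos by (meson divide_nonneg_pos mult_left_mono order_trans)
  from power_mono[OF this vnorm_nonneg, of 2] show ?thesis
    by (simp add: power_mult_distrib power_divide mult_ac)
qed

text \<open>Needed for measurability. Logits carry the product topology on all sequences, but only
  the coordinates below \<open>K\<close> enter the Lipschitz bound, and these are
  continuous.\<close>

lemma cost_softmax_continuous:
  assumes "k < K"
  shows "continuous_on UNIV (\<lambda>\<eta>. c (wt (softmax K \<eta>)) k)"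
  unfolding continuous_on_def
proof (intro ballI)
  fix \<eta> :: rvec
  have "((\<lambda>\<eta>'. \<Sum>k<K. \<bar>\<eta>' k - \<eta> k\<bar>) \<longlongrightarrow> (\<Sum>k<K. \<bar>\<eta> k - \<eta> k\<bar>)) (at \<eta>)"
    by (intro tendsto_intros) 
      (use continuous_on_product_coordinates[where 'a=nat and 'b=real] in \<open>simp add: continuous_on_def\<close>)
  then have lim: "((\<lambda>\<eta>'. 8 * G\<^sup>2 / \<mu> * (\<Sum>k<K. \<bar>\<eta>' k - \<eta> k\<bar>)) \<longlongrightarrow> 0) (at \<eta>)"
    by (intro tendsto_mult_right_zero) simp
  have "norm (c (wt (softmax K \<eta>')) k - c (wt (softmax K \<eta>)) k)
      \<le> 8 * G\<^sup>2 / \<mu> * (\<Sum>k<K. \<bar>\<eta>' k - \<eta> k\<bar>)" for \<eta>'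
    unfolding real_norm_def
    by (intro cost_softmax_lipschitz assms member_le_sum[where f="\<lambda>k. \<bar>\<eta>' k - \<eta> k\<bar>"]) auto
  then have "((\<lambda>\<eta>'. c (wt (softmax K \<eta>')) k - c (wt (softmax K \<eta>)) k) \<longlongrightarrow> 0) (at \<eta>)"
    by (intro Lim_null_comparison[OF always_eventually lim] allI)
  then show "((\<lambda>\<eta>. c (wt (softmax K \<eta>)) k) \<longlongrightarrow> c (wt (softmax K \<eta>)) k) (at \<eta> within UNIV)"
    by (rule LIM_zero_cancel)
qed

end

subsection \<open>Uniform deviation over the Frobenius ball\<close>

lemma integrable_Max:
  fixes f :: "'i \<Rightarrow> 'a \<Rightarrow> real"
  assumes "finite F" "F \<noteq> {}" "\<And>i. i \<in> F \<Longrightarrow> integrable M (f i)"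
  shows "integrable M (\<lambda>x. MAX i\<in>F. f i x)"
  using assms by (induction rule: finite_ne_induct) auto

lemma integrable_pair_snd:
  fixes f :: "'b \<Rightarrow> real"
  assumes "prob_space P" "prob_space M" and f: "integrable M f"
  shows "integrable (P \<Otimes>\<^sub>M M) (\<lambda>z. f (snd z))"
proof -
  interpret p1: prob_space P by fact
  interpret p2: prob_space M by fact
  interpret pair_prob_space P M ..
  have [measurable]: "f \<in> borel_measurable M" using f by auto
  have "integrable (P \<Otimes>\<^sub>M M) (\<lambda>(x, y). f y)"
    by (rule Fubini_integrable) (use f in \<open>auto simp: p1.prob_space\<close>)
  then show ?thesis by (simp add: case_prod_beta')
qed

lemma integral_PiM_component:
  fixes f :: "'a \<Rightarrow> real"
  assumes M: "prob_space M" and j: "j \<in> I" and f: "integrable M f"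
  shows "integrable (PiM I (\<lambda>_. M)) (\<lambda>xs. f (xs j))"
    and "(\<integral>xs. f (xs j) \<partial>PiM I (\<lambda>_. M)) = (\<integral>x. f x \<partial>M)"
proof -
  have distr: "distr (PiM I (\<lambda>_. M)) M (\<lambda>xs. xs j) = M"
    using distr_PiM_component[of I "\<lambda>_. M" j] M j by simp
  have meas: "(\<lambda>xs. xs j) \<in> PiM I (\<lambda>_. M) \<rightarrow>\<^sub>M M"
    using j by (rule measurable_component_singleton)
  show "integrable (PiM I (\<lambda>_. M)) (\<lambda>xs. f (xs j))"
    using integrable_distr[OF meas] f distr by metis
  show "(\<integral>xs. f (xs j) \<partial>PiM I (\<lambda>_. M)) = (\<integral>x. f x \<partial>M)"
    using integral_distr[OF meas, of f] f distr by simp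
qed

text \<open>
  The vectors \<open>\<plusminus>K e\<^sub>k\<close>, drawn uniformly, play the role of Rademacher vectors: their inner product
  with \<open>v\<close> has mean absolute value \<open>\<parallel>v\<parallel>\<^sub>1\<close>, so the contraction step needs no Khintchine inequality.
\<close>

definition symmetrized_max ::
    "'i set \<Rightarrow> nat \<Rightarrow> real \<Rightarrow> ('i \<Rightarrow> real) \<Rightarrow> ('i \<Rightarrow> nat \<Rightarrow> real) \<Rightarrow> real" where
  "symmetrized_max F K \<Lambda> a e = (\<Sum>k<K. (MAX i\<in>F. a i + 2 * \<Lambda> * real K * e i k)
      + (MAX i\<in>F. a i - 2 * \<Lambda> * real K * e i k)) / (2 * real K)"

text \<open>For each \<open>k\<close>, one of \<open>i\<close>, \<open>j\<close> is inserted into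
  the maximum with the plus sign and the other into the one with the minus sign, according to which
  entry is larger. This produces the absolute difference with factor
  \<open>2 * \<Lambda> * K\<close>, and the division by \<open>2 * K\<close> leaves
  \<open>\<Lambda>\<close>.\<close>

lemma symmetrized_max_ge:
  assumes F: "finite F" and K: "0 < K" and \<Lambda>: "0 \<le> \<Lambda>" and ij: "i \<in> F" "j \<in> F"
  shows "(a i + a j) / 2 + \<Lambda> * (\<Sum>k<K. \<bar>e i k - e j k\<bar>) \<le> symmetrized_max F K \<Lambda> a e"
proof -
  let ?c = "2 * \<Lambda> * real K"
  have "a i + a j + ?c * \<bar>e i k - e j k\<bar>
      \<le> (MAX i\<in>F. a i + ?c * e i k) + (MAX i\<in>F. a i - ?c * e i k)" for k
  proof -
    have up: "a l + ?c * e l k \<le> (MAX i\<in>F. a i + ?c * e i k)" if "l \<in> F" for l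
      using F that by (intro Max_ge) auto
    have lo: "a l - ?c * e l k \<le> (MAX i\<in>F. a i - ?c * e i k)" if "l \<in> F" for l
      using F that by (intro Max_ge) auto
    show ?thesis
      using up[OF ij(1)] up[OF ij(2)] lo[OF ij(1)] lo[OF ij(2)]
      by (cases "e i k \<ge> e j k") (simp_all add: right_diff_distrib abs_if)
  qed
  then have "(\<Sum>k<K. a i + a j + ?c * \<bar>e i k - e j k\<bar>)
      \<le> (\<Sum>k<K. (MAX i\<in>F. a i + ?c * e i k) + (MAX i\<in>F. a i - ?c * e i k))"
    by (intro sum_mono)
  also have "(\<Sum>k<K. a i + a j + ?c * \<bar>e i k - e j k\<bar>)
      = ((a i + a j) / 2 + \<Lambda> * (\<Sum>k<K. \<bar>e i k - e j k\<bar>)) * (2 * real K)"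
    by (simp add: sum.distrib algebra_simps flip: sum_distrib_left)
  finally show ?thesis
    using K by (simp add: symmetrized_max_def le_divide_eq)
qed

text \<open>With \<open>i\<close> and \<open>j\<close> maximizing the two sides, the terms regroup
  into a share that involves only \<open>h\<close>, \<open>e\<close> and a share that involves only
  \<open>h'\<close>, \<open>e'\<close>. Each share is a Lipschitz difference, so symmetrization and
  contraction happen in a single step.\<close>

lemma symmetrization_pointwise:
  fixes a :: "'i \<Rightarrow> real"
  assumes F: "finite F" "F \<noteq> {}" and K: "0 < K" and \<Lambda>: "0 \<le> \<Lambda>"
    and lip: "\<And>i j. i \<in> F \<Longrightarrow> j \<in> F \<Longrightarrow> \<bar>h i - h j\<bar> \<le> \<Lambda> * (\<Sum>k<K. \<bar>e i k - e j k\<bar>)"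
    and lip': "\<And>i j. i \<in> F \<Longrightarrow> j \<in> F \<Longrightarrow> \<bar>h' i - h' j\<bar> \<le> \<Lambda> * (\<Sum>k<K. \<bar>e' i k - e' j k\<bar>)"
  shows "(MAX i\<in>F. a i + h' i - h i) + (MAX i\<in>F. a i + h i - h' i)
    \<le> symmetrized_max F K \<Lambda> a e + symmetrized_max F K \<Lambda> a e'"
proof -
  have attained: "\<exists>i\<in>F. (MAX i\<in>F. f i) = f i" for f :: "'i \<Rightarrow> real"
    using Max_in[of "f ` F"] F by blast
  obtain i where i: "i \<in> F" "(MAX i\<in>F. a i + h' i - h i) = a i + h' i - h i"
    using attained by blast
  obtain j where j: "j \<in> F" "(MAX i\<in>F. a i + h i - h' i) = a j + h j - h' j"
    using attained by blast
  have "(a i + h' i - h i) + (a j + h j - h' j)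
      = (a i + a j) / 2 + (a i + a j) / 2 - (h i - h j) + (h' i - h' j)"
    by simp
  also have "\<dots> \<le> ((a i + a j) / 2 + \<Lambda> * (\<Sum>k<K. \<bar>e i k - e j k\<bar>))
      + ((a i + a j) / 2 + \<Lambda> * (\<Sum>k<K. \<bar>e' i k - e' j k\<bar>))"
    using lip[OF i(1) j(1)] lip'[OF i(1) j(1)] by linarith
  also have "\<dots> \<le> symmetrized_max F K \<Lambda> a e + symmetrized_max F K \<Lambda> a e'"
    by (intro add_mono symmetrized_max_ge F K \<Lambda> i j)
  finally show ?thesis unfolding i(2) j(2) .
qed

text \<open>An independent copy \<open>y\<close> of \<open>x\<close> replaces the mean. Both orders
  of the pair are then averaged, which is the situation of the pointwise lemma.\<close>

lemma (in prob_space) symmetrization_step: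
  fixes a :: "'i \<Rightarrow> real" and h :: "'i \<Rightarrow> 'a \<Rightarrow> real" and e :: "'i \<Rightarrow> 'a \<Rightarrow> nat \<Rightarrow> real"
  assumes F: "finite F" "F \<noteq> {}" and K: "0 < K" and \<Lambda>: "0 \<le> \<Lambda>"
    and h: "\<And>i. i \<in> F \<Longrightarrow> h i \<in> borel_measurable M"
    and bound: "\<And>i x. i \<in> F \<Longrightarrow> x \<in> space M \<Longrightarrow> \<bar>h i x\<bar> \<le> b"
    and lip: "\<And>i j x. i \<in> F \<Longrightarrow> j \<in> F \<Longrightarrow> x \<in> space M \<Longrightarrow>
      \<bar>h i x - h j x\<bar> \<le> \<Lambda> * (\<Sum>k<K. \<bar>e i x k - e j x k\<bar>)"
    and e: "\<And>i k. i \<in> F \<Longrightarrow> k < K \<Longrightarrow> integrable M (\<lambda>x. e i x k)"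
  shows "(\<integral>x. (MAX i\<in>F. a i + (\<integral>y. h i y \<partial>M) - h i x) \<partial>M)
    \<le> (\<integral>x. symmetrized_max F K \<Lambda> a (\<lambda>i. e i x) \<partial>M)"
proof -
  interpret P: pair_prob_space M M ..
  define A where "A x y = (MAX i\<in>F. a i + h i y - h i x)" for x y
  define S where "S x = symmetrized_max F K \<Lambda> a (\<lambda>i. e i x)" for x
  have int_h: "integrable M (h i)" if "i \<in> F" for i
    using bound h that by (intro integrable_const_bound[of _ b]) auto
  have int_h': "integrable (M \<Otimes>\<^sub>M M) (\<lambda>z. h i (fst z))" "integrable (M \<Otimes>\<^sub>M M) (\<lambda>z. h i (snd z))"
    if "i \<in> F" for i
    using bound h that
    by (auto intro!: P.integrable_const_bound[of _ b] simp: space_pair_measure)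
  have int_A: "integrable (M \<Otimes>\<^sub>M M) (\<lambda>(x, y). A x y)" "integrable (M \<Otimes>\<^sub>M M) (\<lambda>(x, y). A y x)"
    unfolding A_def case_prod_beta using F int_h' by (intro integrable_Max; auto)+
  have int_Ax: "integrable M (A x)" for x
    unfolding A_def using F int_h by (intro integrable_Max) auto
  have int_Ay: "integrable M (\<lambda>x. A x y)" for y
    unfolding A_def using F int_h by (intro integrable_Max) auto
  have "integrable M (\<lambda>x. MAX i\<in>F. a i + r * e i x k)" if "k < K" for k r
    using F e that by (intro integrable_Max) auto
  from this[of _ "2 * \<Lambda> * real K"] this[of _ "- (2 * \<Lambda> * real K)"] have int_S: "integrable M S"
    unfolding S_def symmetrized_max_def by (intro integrable_divide integrable_sum integrable_add) auto
  have "(\<integral>x. (MAX i\<in>F. a i + (\<integral>y. h i y \<partial>M) - h i x) \<partial>M) \<le> (\<integral>x. (\<integral>y. A x y \<partial>M) \<partial>M)"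
  proof (rule integral_mono)
    show "integrable M (\<lambda>x. MAX i\<in>F. a i + (\<integral>y. h i y \<partial>M) - h i x)"
      using F int_h by (intro integrable_Max) auto
    show "integrable M (\<lambda>x. \<integral>y. A x y \<partial>M)"
      using P.integrable_fst'[OF int_A(1)] by simp
    fix x
    \<comment> \<open>Jensen's inequality for the maximum: each competitor's mean is below the mean
      of the maximum.\<close>
    have "a i + (\<integral>y. h i y \<partial>M) - h i x \<le> (\<integral>y. A x y \<partial>M)" if i: "i \<in> F" for i
    proof -
      have "a i + (\<integral>y. h i y \<partial>M) - h i x = (\<integral>y. a i + h i y - h i x \<partial>M)"
        using int_h[OF i] by (simp add: prob_space)
      also have "\<dots> \<le> (\<integral>y. A x y \<partial>M)"
        using int_h[OF i] int_Ax[unfolded A_def] i F by (intro integral_mono) (auto simp: A_def intro!: Max_ge)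
      finally show ?thesis .
    qed
    then show "(MAX i\<in>F. a i + (\<integral>y. h i y \<partial>M) - h i x) \<le> (\<integral>y. A x y \<partial>M)"
      using F by auto
  qed
  moreover have "2 * (\<integral>x. (\<integral>y. A x y \<partial>M) \<partial>M) \<le> 2 * (\<integral>x. S x \<partial>M)"
  proof -
    \<comment> \<open>By Fubini \<open>x\<close> and \<open>y\<close> may be exchanged, so twice the
      integral contains both \<open>A x y\<close> and \<open>A y x\<close>.\<close>
    have "2 * (\<integral>x. (\<integral>y. A x y \<partial>M) \<partial>M) = (\<integral>x. (\<integral>y. A x y \<partial>M) \<partial>M) + (\<integral>x. (\<integral>y. A y x \<partial>M) \<partial>M)"
      using P.Fubini_integral[OF int_A(1)] by simp
    also have "\<dots> = (\<integral>x. (\<integral>y. A x y + A y x \<partial>M) \<partial>M)"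
      using P.integrable_fst'[OF int_A(1)] P.integrable_fst'[OF int_A(2)] int_Ax int_Ay by simp
    also have "\<dots> \<le> (\<integral>x. (\<integral>y. S x + S y \<partial>M) \<partial>M)"
    proof (rule integral_mono)
      show "integrable M (\<lambda>x. \<integral>y. A x y + A y x \<partial>M)"
        using P.integrable_fst'[OF int_A(1)] P.integrable_fst'[OF int_A(2)] int_Ax int_Ay by simp
      show "integrable M (\<lambda>x. \<integral>y. S x + S y \<partial>M)"
        using int_S by simp
      fix x assume x: "x \<in> space M"
      show "(\<integral>y. A x y + A y x \<partial>M) \<le> (\<integral>y. S x + S y \<partial>M)"
        using int_Ax int_Ay int_S unfolding A_def S_def
        by (intro integral_mono symmetrization_pointwise F K \<Lambda> lip x) auto
    qed
    also have "\<dots> = 2 * (\<integral>x. S x \<partial>M)" using int_S by (simp add: prob_space)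
    finally show ?thesis .
  qed
  ultimately show ?thesis by (simp add: S_def)
qed

section \<open>Deviation over a finite set of matrices, by induction on the sample size\<close>

definition mat_inner :: "nat \<Rightarrow> nat \<Rightarrow> rmat \<Rightarrow> rmat \<Rightarrow> real" where
  "mat_inner m K A B = (\<Sum>i<m. \<Sum>k<K. A i k * B i k)"

lemma fnorm_nonneg [simp]: "0 \<le> fnorm m K A"
  by (simp add: fnorm_def sum_nonneg)

lemma fnorm_sq: "(fnorm m K A)\<^sup>2 = mat_inner m K A A"
  by (simp add: fnorm_def mat_inner_def sum_nonneg power2_eq_square)

text \<open>Cauchy-Schwarz in its arithmetic-geometric form with weights \<open>s / B\<close> and
  \<open>B / s\<close>. The square root of the squared norm of \<open>Z\<close> is avoided, so that
  expectations can be taken exactly.\<close>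

lemma mat_inner_le:
  assumes A: "fnorm m K A \<le> B" and B: "0 < B" and s: "0 < s"
  shows "2 * mat_inner m K A Z \<le> B * (mat_inner m K Z Z / s + s)"
proof -
  have "2 * (A i k * Z i k) \<le> s / B * (A i k * A i k) + B / s * (Z i k * Z i k)" for i k
  proof -
    have "0 \<le> (s * A i k - B * Z i k)\<^sup>2 / (s * B)" using B s by simp
    also have "\<dots> = s / B * (A i k * A i k) + B / s * (Z i k * Z i k) - 2 * (A i k * Z i k)"
      using B s by (simp add: power2_eq_square field_simps)
    finally show ?thesis by simp
  qed
  then have "2 * mat_inner m K A Z \<le> s / B * mat_inner m K A A + B / s * mat_inner m K Z Z"
    unfolding mat_inner_def sum_distrib_left sum.distrib[symmetric] by (intro sum_mono)
  moreover have "mat_inner m K A A \<le> B\<^sup>2"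
    unfolding fnorm_sq[symmetric] using A by (intro power_mono) auto
  then have "s / B * mat_inner m K A A \<le> s / B * B\<^sup>2" using B s by (intro mult_left_mono) auto
  ultimately show ?thesis using B by (simp add: power2_eq_square algebra_simps)
qed

text \<open>The rank-one update of \<open>Z\<close> by \<open>t\<close> times the product of the
  column \<open>v\<close> with the \<open>k\<close>-th unit row. Pairing it with \<open>A\<close>
  adds \<open>t\<close> times logit \<open>k\<close> of \<open>A\<close> at
  \<open>v\<close>.\<close>

definition add_col :: "nat \<Rightarrow> rmat \<Rightarrow> real \<Rightarrow> rvec \<Rightarrow> rmat" where
  "add_col k Z t v = (\<lambda>i l. Z i l + (if l = k then t * v i else 0))"

lemma mat_inner_add_col:
  assumes "k < K"
  shows "mat_inner m K A (add_col k Z t v) = mat_inner m K A Z + t * tmulv m A v k"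
    and "mat_inner m K (add_col k Z t v) (add_col k Z t v)
      = mat_inner m K Z Z + 2 * t * (\<Sum>i<m. Z i k * v i) + t\<^sup>2 * (\<Sum>i<m. (v i)\<^sup>2)"
proof -
  have delta: "(\<Sum>l<K. f l * (if l = k then x else 0)) = f k * x" for f :: "nat \<Rightarrow> real" and x
    using assms by (simp add: if_distrib sum.delta cong: if_cong)
  show "mat_inner m K A (add_col k Z t v) = mat_inner m K A Z + t * tmulv m A v k"
    by (simp add: mat_inner_def add_col_def tmulv_def distrib_left sum.distrib delta sum_distrib_left mult_ac)
  have "(\<Sum>l<K. add_col k Z t v i l * add_col k Z t v i l)
      = (\<Sum>l<K. Z i l * Z i l) + 2 * t * (Z i k * v i) + t\<^sup>2 * (v i)\<^sup>2" for i
  proof -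
    have "(\<Sum>l<K. add_col k Z t v i l * add_col k Z t v i l)
      = (\<Sum>l<K. Z i l * Z i l + (2 * Z i l + t * v i) * (if l = k then t * v i else 0))"
      by (intro sum.cong) (auto simp: add_col_def algebra_simps)
    then show ?thesis unfolding sum.distrib delta by (simp add: power2_eq_square algebra_simps)
  qed
  then show "mat_inner m K (add_col k Z t v) (add_col k Z t v)
      = mat_inner m K Z Z + 2 * t * (\<Sum>i<m. Z i k * v i) + t\<^sup>2 * (\<Sum>i<m. (v i)\<^sup>2)"
    by (simp add: mat_inner_def sum.distrib sum_distrib_left)
qed

text \<open>
  Revealing one sample point moves its contribution into \<open>Z\<close>. The bound is affine in \<open>\<parallel>Z\<parallel>\<^sup>2\<close> (with
  \<open>s\<close> to be optimized afterwards), so it can be averaged over that point exactly.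
\<close>

lemma (in prob_space) deviation_potential:
  fixes F :: "rmat set" and h :: "rmat \<Rightarrow> 'a \<Rightarrow> real" and \<phi> :: "'a \<Rightarrow> rvec"
  assumes F: "finite F" "F \<noteq> {}" "\<And>\<Theta>. \<Theta> \<in> F \<Longrightarrow> fnorm m K \<Theta> \<le> B"
    and pos: "0 < K" "0 < B" "0 \<le> \<Lambda>" "0 < s"
    and h: "\<And>\<Theta>. \<Theta> \<in> F \<Longrightarrow> h \<Theta> \<in> borel_measurable M"
    and bound: "\<And>\<Theta> x. \<Theta> \<in> F \<Longrightarrow> x \<in> space M \<Longrightarrow> \<bar>h \<Theta> x\<bar> \<le> b"
    and lip: "\<And>\<Theta> \<Theta>' x. \<Theta> \<in> F \<Longrightarrow> \<Theta>' \<in> F \<Longrightarrow> x \<in> space M \<Longrightarrow>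
      \<bar>h \<Theta> x - h \<Theta>' x\<bar> \<le> \<Lambda> * (\<Sum>k<K. \<bar>tmulv m \<Theta> (\<phi> x) k - tmulv m \<Theta>' (\<phi> x) k\<bar>)"
    and \<phi>: "\<And>i. i < m \<Longrightarrow> integrable M (\<lambda>x. \<phi> x i)" "\<And>i. i < m \<Longrightarrow> integrable M (\<lambda>x. (\<phi> x i)\<^sup>2)"
  defines "T \<equiv> (\<integral>x. (\<Sum>i<m. (\<phi> x i)\<^sup>2) \<partial>M)"
  shows "(\<integral>xs. (MAX \<Theta>\<in>F. 2 * \<Lambda> * mat_inner m K \<Theta> Z + (\<Sum>j<N. (\<integral>y. h \<Theta> y \<partial>M) - h \<Theta> (xs j)))
       \<partial>PiM {..<N} (\<lambda>_. M))
    \<le> \<Lambda> * B * ((mat_inner m K Z Z + real N * (real K)\<^sup>2 * T) / s + s)"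
proof (induction N arbitrary: Z)
  case 0
  have "2 * \<Lambda> * mat_inner m K \<Theta> Z \<le> \<Lambda> * B * (mat_inner m K Z Z / s + s)" if "\<Theta> \<in> F" for \<Theta>
    using mult_left_mono[OF mat_inner_le[OF F(3)[OF that] pos(2,4), of Z] pos(3)] by (simp add: mult_ac)
  then show ?case using F
    by (simp add: prob_space.prob_space[OF prob_space_PiM] prob_space_axioms)
next
  case (Suc N)
  let ?P = "PiM {..<N} (\<lambda>_. M)"
  interpret PS: product_prob_space "\<lambda>_::nat. M" "{..<N}" ..
  interpret PS: prob_space ?P by (intro prob_space_PiM prob_space_axioms)
  interpret PM: pair_prob_space ?P M ..
  define E where "E \<Theta> = (\<integral>y. h \<Theta> y \<partial>M)" for \<Theta>
  define a where "a Z xs \<Theta> = 2 * \<Lambda> * mat_inner m K \<Theta> Z + (\<Sum>j<N. E \<Theta> - h \<Theta> (xs j))" for Z xs \<Theta>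
  define g where "g Z xs = (MAX \<Theta>\<in>F. a Z xs \<Theta>)" for Z xs
  define t where "t = real K"
  define f where "f xs = (MAX \<Theta>\<in>F. 2 * \<Lambda> * mat_inner m K \<Theta> Z + (\<Sum>j<Suc N. E \<Theta> - h \<Theta> (xs j)))" for xs
  have int_h: "integrable M (h \<Theta>)" if "\<Theta> \<in> F" for \<Theta>
    using bound h that by (intro integrable_const_bound[of _ b]) auto
  have int_comp: "integrable (PiM {..<n} (\<lambda>_. M)) (\<lambda>xs. h \<Theta> (xs j))"
    if "\<Theta> \<in> F" "j < n" for \<Theta> j and n :: nat
    using int_h[OF that(1)] that(2) by (intro integral_PiM_component prob_space_axioms) auto
  have int_snd: "integrable (?P \<Otimes>\<^sub>M M) (\<lambda>z. u (snd z))" if "integrable M u" for u :: "'a \<Rightarrow> real"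
    using that by (intro integrable_pair_snd PS.prob_space_axioms prob_space_axioms)
  have int_fst: "integrable (?P \<Otimes>\<^sub>M M) (\<lambda>z. h \<Theta> (fst z j))" if "\<Theta> \<in> F" "j < N" for \<Theta> j
  proof (rule PM.integrable_const_bound[of _ b])
    have "(\<lambda>xs. h \<Theta> (xs j)) \<in> borel_measurable ?P"
      using int_comp[OF that] by auto
    then show "(\<lambda>z. h \<Theta> (fst z j)) \<in> borel_measurable (?P \<Otimes>\<^sub>M M)"
      by (rule measurable_compose[OF measurable_fst])
    show "AE z in ?P \<Otimes>\<^sub>M M. norm (h \<Theta> (fst z j)) \<le> b"
      using bound that by (intro AE_I2) (auto simp: space_pair_measure space_PiM PiE_iff)
  qed
  have int_e: "integrable M (\<lambda>x. tmulv m \<Theta> (\<phi> x) k)" for \<Theta> k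
    unfolding tmulv_def using \<phi>(1) by auto
  have int_g: "integrable (?P \<Otimes>\<^sub>M M) (\<lambda>(xs, y). g (add_col k Z \<sigma> (\<phi> y)) xs)" if "k < K" for k \<sigma>
    unfolding g_def a_def case_prod_beta mat_inner_add_col[OF that]
    by (intro integrable_Max F Bochner_Integration.integrable_add Bochner_Integration.integrable_sum
        Bochner_Integration.integrable_diff integrable_mult_right int_fst int_snd int_e) auto
  have int_gx: "integrable M (\<lambda>y. g (add_col k Z \<sigma> (\<phi> y)) xs)" if "k < K" for k \<sigma> xs
    unfolding g_def a_def mat_inner_add_col[OF that] using int_e F by (intro integrable_Max) auto
  have int_f: "integrable (PiM (insert N {..<N}) (\<lambda>_. M)) f"
  proof -
    interpret PS': prob_space "PiM {..<Suc N} (\<lambda>_. M)" by (intro prob_space_PiM prob_space_axioms)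
    show ?thesis
      unfolding f_def lessThan_Suc[symmetric]
      by (intro integrable_Max F Bochner_Integration.integrable_add Bochner_Integration.integrable_sum
          Bochner_Integration.integrable_diff int_comp) auto
  qed
  have f_upd: "f (xs(N := y)) = (MAX \<Theta>\<in>F. a Z xs \<Theta> + E \<Theta> - h \<Theta> y)" for xs y
    unfolding f_def a_def by (intro arg_cong[where f=Max] image_cong refl) simp
  \<comment> \<open>The symmetrized maximum averages \<open>2 * K\<close> shifted maxima, and a
    shift in coordinate \<open>k\<close> is absorbed into the matrix. The same family
    \<open>g\<close> reappears with one sample point fewer, which closes the induction.\<close>
  have sym: "symmetrized_max F K \<Lambda> (a Z xs) (\<lambda>\<Theta>. tmulv m \<Theta> (\<phi> y))
      = (\<Sum>k<K. g (add_col k Z t (\<phi> y)) xs + g (add_col k Z (- t) (\<phi> y)) xs) / (2 * t)" for xs y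
  proof -
    have "(MAX \<Theta>\<in>F. a Z xs \<Theta> + \<sigma> * tmulv m \<Theta> (\<phi> y) k * (2 * \<Lambda>)) = g (add_col k Z \<sigma> (\<phi> y)) xs"
      if "k < K" for k \<sigma>
      unfolding g_def a_def mat_inner_add_col[OF that]
      by (intro arg_cong[where f=Max] image_cong) (auto simp: algebra_simps)
    from this[of _ t] this[of _ "- t"] show ?thesis
      unfolding symmetrized_max_def t_def by (simp add: mult_ac)
  qed
  \<comment> \<open>The order of integration is exchanged so that the induction hypothesis applies,
    for each fixed \<open>y\<close>, at the shifted matrix; its bound is then averaged over
    \<open>y\<close>.\<close>
  have g_le: "(\<integral>xs. (\<integral>y. g (add_col k Z \<sigma> (\<phi> y)) xs \<partial>M) \<partial>?P)
      \<le> \<Lambda> * B * ((mat_inner m K Z Z + 2 * \<sigma> * (\<integral>y. (\<Sum>i<m. Z i k * \<phi> y i) \<partial>M)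
          + \<sigma>\<^sup>2 * T + real N * (real K)\<^sup>2 * T) / s + s)" if k: "k < K" for k \<sigma>
  proof -
    have int_lin: "integrable M (\<lambda>y. \<Sum>i<m. Z i k * \<phi> y i)"
      and int_sq: "integrable M (\<lambda>y. \<Sum>i<m. (\<phi> y i)\<^sup>2)"
      using \<phi> by auto
    define V where "V y = mat_inner m K Z Z + 2 * \<sigma> * (\<Sum>i<m. Z i k * \<phi> y i)
          + \<sigma>\<^sup>2 * (\<Sum>i<m. (\<phi> y i)\<^sup>2) + real N * (real K)\<^sup>2 * T" for y
    have int_V: "integrable M V" 
      unfolding V_def using int_lin int_sq by simp
    have "(\<integral>xs. (\<integral>y. g (add_col k Z \<sigma> (\<phi> y)) xs \<partial>M) \<partial>?P)
        = (\<integral>y. (\<integral>xs. g (add_col k Z \<sigma> (\<phi> y)) xs \<partial>?P) \<partial>M)"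
      using PM.Fubini_integral[OF int_g[OF k]] by simp
    also have "\<dots> \<le> (\<integral>y. \<Lambda> * B * (V y / s + s) \<partial>M)"
    proof (rule integral_mono)
      show "integrable M (\<lambda>y. \<integral>xs. g (add_col k Z \<sigma> (\<phi> y)) xs \<partial>?P)"
        using PM.integrable_snd[OF int_g[OF k]] by simp
      show "integrable M (\<lambda>y. \<Lambda> * B * (V y / s + s))"
        using int_V by simp
      show "(\<integral>xs. g (add_col k Z \<sigma> (\<phi> y)) xs \<partial>?P) \<le> \<Lambda> * B * (V y / s + s)" for y
        using Suc.IH[of "add_col k Z \<sigma> (\<phi> y)"]
        unfolding mat_inner_add_col(2)[OF k] g_def a_def E_def V_def .
    qed
    also have "\<dots> = \<Lambda> * B * ((\<integral>y. V y \<partial>M) / s + s)"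
      using int_V by (simp add: prob_space)
    also have "(\<integral>y. V y \<partial>M) = mat_inner m K Z Z + 2 * \<sigma> * (\<integral>y. (\<Sum>i<m. Z i k * \<phi> y i) \<partial>M)
          + \<sigma>\<^sup>2 * T + real N * (real K)\<^sup>2 * T"
      unfolding V_def T_def using int_lin int_sq by (simp add: prob_space)
    finally show ?thesis .
  qed
  have "(\<integral>xs. f xs \<partial>PiM {..<Suc N} (\<lambda>_. M)) = (\<integral>xs. (\<integral>y. f (xs(N := y)) \<partial>M) \<partial>?P)"
    unfolding lessThan_Suc by (intro PS.product_integral_insert int_f) auto
  also have "\<dots> \<le> (\<integral>xs. (\<integral>y. symmetrized_max F K \<Lambda> (a Z xs) (\<lambda>\<Theta>. tmulv m \<Theta> (\<phi> y)) \<partial>M) \<partial>?P)"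
  proof (rule integral_mono)
    have "integrable (?P \<Otimes>\<^sub>M M) (\<lambda>(xs, y). f (xs(N := y)))"
      unfolding f_upd a_def case_prod_beta
      by (intro integrable_Max F Bochner_Integration.integrable_add Bochner_Integration.integrable_sum
          Bochner_Integration.integrable_diff int_fst int_snd int_h) auto
    from PM.integrable_fst'[OF this] show "integrable ?P (\<lambda>xs. \<integral>y. f (xs(N := y)) \<partial>M)"
      by simp
    have "integrable (?P \<Otimes>\<^sub>M M)
        (\<lambda>(xs, y). symmetrized_max F K \<Lambda> (a Z xs) (\<lambda>\<Theta>. tmulv m \<Theta> (\<phi> y)))"
      unfolding sym case_prod_beta
      by (intro integrable_divide_zero Bochner_Integration.integrable_sum Bochner_Integration.integrable_add
          int_g[unfolded case_prod_beta]) auto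
    from PM.integrable_fst'[OF this]
    show "integrable ?P (\<lambda>xs. \<integral>y. symmetrized_max F K \<Lambda> (a Z xs) (\<lambda>\<Theta>. tmulv m \<Theta> (\<phi> y)) \<partial>M)"
      by simp
    show "(\<integral>y. f (xs(N := y)) \<partial>M)
      \<le> (\<integral>y. symmetrized_max F K \<Lambda> (a Z xs) (\<lambda>\<Theta>. tmulv m \<Theta> (\<phi> y)) \<partial>M)" for xs
      unfolding f_upd E_def
      by (intro symmetrization_step[where b=b] F pos h bound lip int_e) auto
  qed
  also have "\<dots> = (\<Sum>k<K. (\<integral>xs. (\<integral>y. g (add_col k Z t (\<phi> y)) xs \<partial>M) \<partial>?P)
        + (\<integral>xs. (\<integral>y. g (add_col k Z (- t) (\<phi> y)) xs \<partial>M) \<partial>?P)) / (2 * t)"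
  proof -
    have "integrable ?P (\<lambda>xs. \<integral>y. g (add_col k Z \<sigma> (\<phi> y)) xs \<partial>M)" if "k < K" for k \<sigma>
      using PM.integrable_fst'[OF int_g[OF that]] by simp
    then show ?thesis unfolding sym using int_gx by simp
  qed
  also have "\<dots> \<le> (\<Sum>k<K. 2 * (\<Lambda> * B * ((mat_inner m K Z Z + t\<^sup>2 * T + real N * (real K)\<^sup>2 * T) / s + s)))
      / (2 * t)"
  \<comment> \<open>The terms linear in the shift cancel between \<open>t\<close> and
    \<open>- t\<close>. The quadratic term is \<open>t\<^sup>2 * T\<close> with
    \<open>t = K\<close>, for every \<open>k\<close>, and is kept by the average over
    \<open>k\<close>.\<close>
  proof (intro divide_right_mono sum_mono)
    fix k assume "k \<in> {..<K}"
    then have k: "k < K" by simp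
    show "(\<integral>xs. (\<integral>y. g (add_col k Z t (\<phi> y)) xs \<partial>M) \<partial>?P)
        + (\<integral>xs. (\<integral>y. g (add_col k Z (- t) (\<phi> y)) xs \<partial>M) \<partial>?P)
      \<le> 2 * (\<Lambda> * B * ((mat_inner m K Z Z + t\<^sup>2 * T + real N * (real K)\<^sup>2 * T) / s + s))"
      by (rule order_trans[OF add_mono[OF g_le[OF k, of t] g_le[OF k, of "- t"]]])
        (use pos(4) in \<open>simp add: field_simps\<close>)
  qed (simp add: t_def)
  also have "\<dots> = \<Lambda> * B * ((mat_inner m K Z Z + real (Suc N) * (real K)\<^sup>2 * T) / s + s)"
  proof -
    have "mat_inner m K Z Z + t\<^sup>2 * T + real N * (real K)\<^sup>2 * T
        = mat_inner m K Z Z + real (Suc N) * (real K)\<^sup>2 * T"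
      by (simp add: t_def algebra_simps)
    then show ?thesis using pos(1) by (simp only:) (simp add: t_def)
  qed
  finally show ?case by (simp add: f_def E_def)
qed

text \<open>Rounding towards zero keeps a matrix inside the Frobenius ball.\<close>

lemma fro_ball_net:
  assumes \<delta>: "0 < \<delta>" and B: "0 \<le> B"
  obtains F where "finite F" "F \<noteq> {}" "F \<subseteq> fro_ball m K B"
    "\<And>\<Theta>. \<Theta> \<in> fro_ball m K B \<Longrightarrow> \<exists>\<Theta>'\<in>F. \<forall>i k. \<bar>\<Theta> i k - \<Theta>' i k\<bar> \<le> \<delta>"
proof -
  \<comment> \<open>The absolute value is rounded down to a multiple of \<open>\<delta>\<close> and
    the sign is restored.\<close>
  define r where "r x = sgn x * (\<delta> * of_int \<lfloor>\<bar>x\<bar> / \<delta>\<rfloor>)" for x :: real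
  \<comment> \<open>Entries of a matrix in the ball are at most \<open>B\<close> in absolute value,
    so the rounded ones take finitely many values.\<close>
  define V where "V = (\<lambda>z. \<delta> * of_int z) ` {- \<lceil>B / \<delta>\<rceil>..\<lceil>B / \<delta>\<rceil>}"
  define F where "F = (\<lambda>\<Theta> i k. r (\<Theta> i k)) ` fro_ball m K B"
  have abs_r: "\<bar>r x\<bar> \<le> \<bar>x\<bar>" and near: "\<bar>x - r x\<bar> \<le> \<delta>" for x
  proof -
    have "of_int \<lfloor>\<bar>x\<bar> / \<delta>\<rfloor> * \<delta> \<le> \<bar>x\<bar>"
      using floor_divide_lower[OF \<delta>] .
    then have fl: "\<delta> * of_int \<lfloor>\<bar>x\<bar> / \<delta>\<rfloor> \<le> \<bar>x\<bar>" "\<bar>x\<bar> \<le> \<delta> * of_int \<lfloor>\<bar>x\<bar> / \<delta>\<rfloor> + \<delta>"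
      "0 \<le> \<delta> * of_int \<lfloor>\<bar>x\<bar> / \<delta>\<rfloor>"
      using \<delta> real_of_int_floor_add_one_ge[of "\<bar>x\<bar> / \<delta>"]
      by (simp_all add: field_simps)
    show "\<bar>r x\<bar> \<le> \<bar>x\<bar>" "\<bar>x - r x\<bar> \<le> \<delta>"
      unfolding r_def using fl \<delta> by (cases x "0 :: real" rule: linorder_cases; simp)+
  qed
  have ball: "F \<subseteq> fro_ball m K B"
  proof
    fix \<Theta> assume "\<Theta> \<in> F"
    then obtain \<Theta>' where \<Theta>': "\<Theta>' \<in> fro_ball m K B" "\<Theta> = (\<lambda>i k. r (\<Theta>' i k))" by (auto simp: F_def)
    have "fnorm m K \<Theta> \<le> fnorm m K \<Theta>'"
      unfolding fnorm_def \<Theta>'(2) by (intro real_sqrt_le_mono sum_mono) (simp add: abs_r abs_le_square_iff[symmetric])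
    then show "\<Theta> \<in> fro_ball m K B"
      using \<Theta>' by (auto simp: fro_ball_def Rmat_def r_def)
  qed
  have "finite {\<Theta>. \<forall>i. (i \<in> {..<m} \<longrightarrow> \<Theta> i \<in> {v. \<forall>k. (k \<in> {..<K} \<longrightarrow> v k \<in> V) \<and> (k \<notin> {..<K} \<longrightarrow> v k = 0)})
      \<and> (i \<notin> {..<m} \<longrightarrow> \<Theta> i = (\<lambda>_. 0))}"
    by (intro finite_set_of_finite_funs) (auto simp: V_def)
  moreover have "F \<subseteq> {\<Theta>. \<forall>i. (i \<in> {..<m} \<longrightarrow> \<Theta> i \<in> {v. \<forall>k. (k \<in> {..<K} \<longrightarrow> v k \<in> V) \<and> (k \<notin> {..<K} \<longrightarrow> v k = 0)})
      \<and> (i \<notin> {..<m} \<longrightarrow> \<Theta> i = (\<lambda>_. 0))}"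
  proof -
    have "r (\<Theta> i k) \<in> V" if \<Theta>: "\<Theta> \<in> fro_ball m K B" and ik: "i < m" "k < K" for \<Theta> i k
    proof -
      let ?x = "\<Theta> i k"
      have "?x\<^sup>2 \<le> (\<Sum>k<K. (\<Theta> i k)\<^sup>2)"
        using ik by (intro member_le_sum) auto
      also have "\<dots> \<le> (\<Sum>i<m. \<Sum>k<K. (\<Theta> i k)\<^sup>2)"
        using ik by (intro member_le_sum[where f="\<lambda>i. \<Sum>k<K. (\<Theta> i k)\<^sup>2"]) (auto intro: sum_nonneg)
      finally have "\<bar>?x\<bar> \<le> B"
        using \<Theta> by (auto simp: fro_ball_def fnorm_def intro: order_trans[OF real_le_rsqrt])
      then have "\<bar>?x\<bar> / \<delta> \<le> B / \<delta>" using \<delta> by (simp add: divide_right_mono)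
      define z where "z = \<lfloor>\<bar>?x\<bar> / \<delta>\<rfloor>"
      obtain u :: int where u: "sgn ?x = of_int u" "u = -1 \<or> u = 0 \<or> u = 1"
        by (cases "?x = 0"; cases "?x > 0") (auto simp: sgn_if intro: that[of 0] that[of 1] that[of "-1"])
      have "0 \<le> z" using \<delta> by (simp add: z_def)
      moreover have "z \<le> \<lceil>B / \<delta>\<rceil>"
        unfolding z_def using \<open>\<bar>?x\<bar> / \<delta> \<le> B / \<delta>\<close> by (rule order_trans[OF floor_mono floor_le_ceiling])
      moreover have "u * z \<in> {- c..c}" if "0 \<le> z" "z \<le> c" for c
        using u(2) that by auto
      ultimately have "u * z \<in> {- \<lceil>B / \<delta>\<rceil>..\<lceil>B / \<delta>\<rceil>}"
        by blast
      then show ?thesis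
        unfolding V_def r_def u z_def[symmetric] by (intro image_eqI[where x="u * z"]) simp_all
    qed
    then show ?thesis by (auto simp: F_def fro_ball_def Rmat_def r_def)
  qed
  ultimately have "finite F" by (rule rev_finite_subset)
  moreover have "(\<lambda>_ _. 0) \<in> fro_ball m K B"
    using B by (auto simp: fro_ball_def Rmat_def fnorm_def)
  then have "F \<noteq> {}" by (auto simp: F_def)
  moreover have "\<exists>\<Theta>'\<in>F. \<forall>i k. \<bar>\<Theta> i k - \<Theta>' i k\<bar> \<le> \<delta>" if "\<Theta> \<in> fro_ball m K B" for \<Theta>
    using that near by (auto simp: F_def)
  ultimately show ?thesis using ball by (intro that)
qed

text \<open>The optimal choice is \<open>s = sqrt V\<close>. For \<open>V = 0\<close> it is not
  positive, and the bound arises from letting \<open>s\<close> tend to zero.\<close>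

lemma le_sqrt_if_le_amgm:
  assumes "0 \<le> V" "0 \<le> c" "\<And>s. 0 < s \<Longrightarrow> x \<le> c * (V / s + s)"
  shows "x \<le> 2 * c * sqrt V"
proof (cases "V = 0")
  case False
  then show ?thesis
    using assms(1) assms(3)[of "sqrt V"] by (simp add: real_div_sqrt mult_ac)
next
  case True
  have "x \<le> 0 + \<epsilon>" if "0 < \<epsilon>" for \<epsilon>
  proof (cases "c = 0")
    case True
    then show ?thesis using assms(3)[of 1] that by simp
  next
    case False
    then show ?thesis using assms(3)[of "\<epsilon> / c"] assms(2) that \<open>V = 0\<close> by simp
  qed
  then have "x \<le> 0" by (rule field_le_epsilon)
  then show ?thesis using True by simp
qed

text \<open>Only \<open>r\<close> and \<open>q\<close> are integrated on the left and right, never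
  the deviation at the data-dependent \<open>\<Theta>hat\<close>. At each sample that deviation is
  at most a maximum over a finite net plus an error of order \<open>\<delta>\<close>, and
  \<open>\<delta>\<close> tends to zero after integration.\<close>

lemma (in prob_space) uniform_deviation:
  fixes h :: "rmat \<Rightarrow> 'a \<Rightarrow> real" and \<phi> :: "'a \<Rightarrow> rvec" and N :: nat
  assumes pos: "0 < K" "0 < B" "0 \<le> \<Lambda>" "0 < N"
    and h: "\<And>\<Theta>. \<Theta> \<in> fro_ball m K B \<Longrightarrow> h \<Theta> \<in> borel_measurable M"
    and bound: "\<And>\<Theta> x. \<Theta> \<in> fro_ball m K B \<Longrightarrow> x \<in> space M \<Longrightarrow> \<bar>h \<Theta> x\<bar> \<le> b"
    and lip: "\<And>\<Theta> \<Theta>' x. \<Theta> \<in> fro_ball m K B \<Longrightarrow> \<Theta>' \<in> fro_ball m K B \<Longrightarrow> x \<in> space M \<Longrightarrow>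
      \<bar>h \<Theta> x - h \<Theta>' x\<bar> \<le> \<Lambda> * (\<Sum>k<K. \<bar>tmulv m \<Theta> (\<phi> x) k - tmulv m \<Theta>' (\<phi> x) k\<bar>)"
    and \<phi>: "\<And>i. i < m \<Longrightarrow> integrable M (\<lambda>x. \<phi> x i)" "\<And>i. i < m \<Longrightarrow> integrable M (\<lambda>x. (\<phi> x i)\<^sup>2)"
    and r: "integrable (PiM {..<N} (\<lambda>_. M)) r" and q: "integrable (PiM {..<N} (\<lambda>_. M)) q"
    and est: "\<And>xs. xs \<in> space (PiM {..<N} (\<lambda>_. M)) \<Longrightarrow> \<Theta>hat xs \<in> fro_ball m K B"
    and le: "\<And>xs. xs \<in> space (PiM {..<N} (\<lambda>_. M)) \<Longrightarrow>
      r xs \<le> (\<integral>y. h (\<Theta>hat xs) y \<partial>M) - (\<Sum>j<N. h (\<Theta>hat xs) (xs j)) / real N + q xs"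
  shows "(\<integral>xs. r xs \<partial>PiM {..<N} (\<lambda>_. M)) \<le> (\<integral>xs. q xs \<partial>PiM {..<N} (\<lambda>_. M))
    + 2 * \<Lambda> * real K * B * sqrt (\<integral>x. (\<Sum>i<m. (\<phi> x i)\<^sup>2) \<partial>M) / sqrt (real N)"
proof -
  let ?P = "PiM {..<N} (\<lambda>_. M)" and ?H = "fro_ball m K B"
  define T where "T = (\<integral>x. (\<Sum>i<m. (\<phi> x i)\<^sup>2) \<partial>M)"
  define W where "W x = (\<Sum>i<m. \<bar>\<phi> x i\<bar>)" for x
  define E where "E \<Theta> = (\<integral>y. h \<Theta> y \<partial>M)" for \<Theta>
  define C where "C = \<Lambda> * real K"
  have C: "0 \<le> C" using pos by (simp add: C_def)
  interpret P: prob_space ?P by (intro prob_space_PiM prob_space_axioms)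
  have int_W: "integrable M W" unfolding W_def using \<phi>(1) by auto
  have int_h: "integrable M (h \<Theta>)" if "\<Theta> \<in> ?H" for \<Theta>
    using bound h that by (intro integrable_const_bound[of _ b]) auto
  have comp: "integrable ?P (\<lambda>xs. f (xs j))" "(\<integral>xs. f (xs j) \<partial>?P) = (\<integral>x. f x \<partial>M)"
    if "integrable M f" "j < N" for f :: "'a \<Rightarrow> real" and j
    using integral_PiM_component[OF prob_space_axioms _ that(1), of j "{..<N}"] that(2) by auto
  have close: "\<bar>h \<Theta> x - h \<Theta>' x\<bar> \<le> C * \<delta> * W x"
    if "\<Theta> \<in> ?H" "\<Theta>' \<in> ?H" "x \<in> space M" "\<forall>i k. \<bar>\<Theta> i k - \<Theta>' i k\<bar> \<le> \<delta>" for \<Theta> \<Theta>' x \<delta>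
  proof -
    have "\<bar>tmulv m \<Theta> (\<phi> x) k - tmulv m \<Theta>' (\<phi> x) k\<bar> \<le> \<delta> * W x" for k
    proof -
      have "tmulv m \<Theta> (\<phi> x) k - tmulv m \<Theta>' (\<phi> x) k = (\<Sum>i<m. (\<Theta> i k - \<Theta>' i k) * \<phi> x i)"
        by (simp add: tmulv_def left_diff_distrib sum_subtractf)
      also have "\<bar>\<dots>\<bar> \<le> (\<Sum>i<m. \<bar>\<Theta> i k - \<Theta>' i k\<bar> * \<bar>\<phi> x i\<bar>)"
        by (rule order_trans[OF sum_abs]) (simp add: abs_mult)
      also have "\<dots> \<le> (\<Sum>i<m. \<delta> * \<bar>\<phi> x i\<bar>)"
        using that(4) by (intro sum_mono mult_right_mono) auto
      finally show ?thesis by (simp add: W_def sum_distrib_left)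
    qed
    then have "(\<Sum>k<K. \<bar>tmulv m \<Theta> (\<phi> x) k - tmulv m \<Theta>' (\<phi> x) k\<bar>) \<le> (\<Sum>k<K. \<delta> * W x)"
      by (intro sum_mono)
    from mult_left_mono[OF this pos(3)] lip[OF that(1-3)] show ?thesis
      by (simp add: C_def mult_ac)
  qed
  have bound_\<delta>: "(\<integral>xs. r xs \<partial>?P) \<le> (\<integral>xs. q xs \<partial>?P) + 2 * \<Lambda> * real K * B * sqrt T / sqrt (real N)
      + 2 * C * (\<integral>x. W x \<partial>M) * \<delta>" if \<delta>: "0 < \<delta>" for \<delta>
  proof -
    obtain F where F: "finite F" "F \<noteq> {}" "F \<subseteq> ?H"
      and net: "\<And>\<Theta>. \<Theta> \<in> ?H \<Longrightarrow> \<exists>\<Theta>'\<in>F. \<forall>i k. \<bar>\<Theta> i k - \<Theta>' i k\<bar> \<le> \<delta>"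
      using fro_ball_net[OF \<delta>, of B m K] pos(2) by (metis less_imp_le)
    \<comment> \<open>The zero matrix starts the induction of \<open>deviation_potential\<close>: no
      sample point has been revealed yet.\<close>
    define Z :: rmat where "Z = (\<lambda>_ _. 0)"
    define D where "D xs = (MAX \<Theta>\<in>F. 2 * \<Lambda> * mat_inner m K \<Theta> Z + (\<Sum>j<N. E \<Theta> - h \<Theta> (xs j)))" for xs
    have int_D: "integrable ?P D"
      unfolding D_def using F(3)
      by (intro integrable_Max F Bochner_Integration.integrable_add Bochner_Integration.integrable_sum
        Bochner_Integration.integrable_diff comp(1)[OF int_h]) auto
    have "(\<integral>xs. D xs \<partial>?P) \<le> \<Lambda> * B * ((real N * (real K)\<^sup>2 * T) / s + s)" if "0 < s" for s
      using deviation_potential[OF F(1,2) _ pos(1-3) that h bound lip \<phi>, of N Z] F(3)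
      unfolding D_def E_def T_def by (force simp: Z_def mat_inner_def fro_ball_def)
    then have "(\<integral>xs. D xs \<partial>?P) \<le> 2 * (\<Lambda> * B) * sqrt (real N * (real K)\<^sup>2 * T)"
      using pos by (intro le_sqrt_if_le_amgm) (auto simp: T_def sum_nonneg)
    also have "\<dots> = 2 * \<Lambda> * real K * B * sqrt T * sqrt (real N)"
      by (simp add: real_sqrt_mult)
    finally have "(\<integral>xs. D xs \<partial>?P) / real N \<le> 2 * \<Lambda> * real K * B * sqrt T * sqrt (real N) / real N"
      by (rule divide_right_mono) simp
    then have D_le: "(\<integral>xs. D xs \<partial>?P) / real N \<le> 2 * \<Lambda> * real K * B * sqrt T / sqrt (real N)"
      by (simp add: sqrt_divide_self_eq flip: times_divide_eq_right) (simp add: divide_inverse)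
    \<comment> \<open>Moving from the estimator to a net point changes both the population mean and
      the sample mean. The errors are \<open>C * \<delta>\<close> times the population and the
      empirical mean of \<open>W\<close>, which have the same expectation.\<close>
    have "r xs \<le> D xs / real N + q xs + C * \<delta> * (\<integral>x. W x \<partial>M) + C * \<delta> * ((\<Sum>j<N. W (xs j)) / real N)"
      if xs: "xs \<in> space ?P" for xs
    proof -
      obtain \<Theta> where \<Theta>: "\<Theta> \<in> F" "\<forall>i k. \<bar>\<Theta>hat xs i k - \<Theta> i k\<bar> \<le> \<delta>"
        using net[OF est[OF xs]] by blast
      then have \<Theta>H: "\<Theta> \<in> ?H" using F by auto
      have "E (\<Theta>hat xs) - E \<Theta> = (\<integral>x. h (\<Theta>hat xs) x - h \<Theta> x \<partial>M)"
        unfolding E_def using int_h est[OF xs] \<Theta>H by simp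
      also have "\<dots> \<le> (\<integral>x. C * \<delta> * W x \<partial>M)"
        using int_h[OF est[OF xs]] int_h[OF \<Theta>H] int_W close[OF est[OF xs] \<Theta>H _ \<Theta>(2)]
        by (intro integral_mono) (auto simp: abs_le_iff)
      finally have 1: "E (\<Theta>hat xs) - E \<Theta> \<le> C * \<delta> * (\<integral>x. W x \<partial>M)" by simp
      have "h \<Theta> (xs j) - h (\<Theta>hat xs) (xs j) \<le> C * \<delta> * W (xs j)" if "j < N" for j
        using close[OF est[OF xs] \<Theta>H _ \<Theta>(2), of "xs j"] xs that
        by (auto simp: space_PiM PiE_iff abs_le_iff)
      then have "(\<Sum>j<N. h \<Theta> (xs j) - h (\<Theta>hat xs) (xs j)) \<le> (\<Sum>j<N. C * \<delta> * W (xs j))"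
        by (intro sum_mono) auto
      from divide_right_mono[OF this, of "real N"]
      have 2: "(\<Sum>j<N. h \<Theta> (xs j)) / real N - (\<Sum>j<N. h (\<Theta>hat xs) (xs j)) / real N
          \<le> C * \<delta> * ((\<Sum>j<N. W (xs j)) / real N)"
        by (simp add: sum_subtractf diff_divide_distrib flip: sum_distrib_left)
      have "2 * \<Lambda> * mat_inner m K \<Theta> Z + (\<Sum>j<N. E \<Theta> - h \<Theta> (xs j)) \<le> D xs"
        unfolding D_def using F \<Theta> by (intro Max_ge) auto
      then have "real N * E \<Theta> - (\<Sum>j<N. h \<Theta> (xs j)) \<le> D xs"
        by (simp add: Z_def mat_inner_def sum_subtractf)
      from divide_right_mono[OF this, of "real N"]
      have 3: "E \<Theta> - (\<Sum>j<N. h \<Theta> (xs j)) / real N \<le> D xs / real N"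
        using pos(4) by (simp add: diff_divide_distrib)
      show ?thesis using le[OF xs] 1 2 3 unfolding E_def by linarith
    qed
    then have "(\<integral>xs. r xs \<partial>?P) \<le> (\<integral>xs. D xs / real N + q xs + C * \<delta> * (\<integral>x. W x \<partial>M)
        + C * \<delta> * ((\<Sum>j<N. W (xs j)) / real N) \<partial>?P)"
      by (intro integral_mono Bochner_Integration.integrable_add integrable_mult_right
          integrable_divide_zero Bochner_Integration.integrable_sum r q int_D comp(1)[OF int_W]) auto
    also have "\<dots> = (\<integral>xs. D xs \<partial>?P) / real N + (\<integral>xs. q xs \<partial>?P) + 2 * C * (\<integral>x. W x \<partial>M) * \<delta>"
    proof -
      have "integrable ?P (\<lambda>xs. \<Sum>j<N. W (xs j))" "(\<integral>xs. (\<Sum>j<N. W (xs j)) \<partial>?P) = real N * (\<integral>x. W x \<partial>M)"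
        using comp[OF int_W] by (auto intro!: Bochner_Integration.integrable_sum)
      then show ?thesis using q int_D pos(4) by (simp add: P.prob_space)
    qed
    finally show ?thesis using D_le by linarith
  qed
  define c where "c = 2 * C * (\<integral>x. W x \<partial>M) + 1"
  have c: "0 < c" unfolding c_def W_def using C by (intro add_nonneg_pos mult_nonneg_nonneg Bochner_Integration.integral_nonneg sum_nonneg) auto
  show ?thesis
  proof (rule field_le_epsilon)
    fix \<epsilon> :: real assume \<epsilon>: "0 < \<epsilon>"
    have "2 * C * (\<integral>x. W x \<partial>M) * (\<epsilon> / c) \<le> c * (\<epsilon> / c)"
      using c \<epsilon> by (intro mult_right_mono) (auto simp: c_def)
    then show "(\<integral>xs. r xs \<partial>?P) \<le> (\<integral>xs. q xs \<partial>?P)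
      + 2 * \<Lambda> * real K * B * sqrt (\<integral>x. (\<Sum>i<m. (\<phi> x i)\<^sup>2) \<partial>M) / sqrt (real N) + \<epsilon>"
      using bound_\<delta>[of "\<epsilon> / c"] \<epsilon> c by (simp add: T_def)
  qed
qed

subsection \<open>Square integrable features and the correlation dimension\<close>

text \<open>Measurability is listed separately because integrability of the square does not imply
  it.\<close>

definition sq_integrable :: "'a measure \<Rightarrow> ('a \<Rightarrow> real) \<Rightarrow> bool" where
  "sq_integrable M f \<longleftrightarrow> f \<in> borel_measurable M \<and> integrable M (\<lambda>x. (f x)\<^sup>2)"

lemma sq_integrable_sq: "sq_integrable M f \<Longrightarrow> integrable M (\<lambda>x. (f x)\<^sup>2)"
  by (simp add: sq_integrable_def)

lemma sq_integrable_mult: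
  assumes "sq_integrable M f" "sq_integrable M g"
  shows "integrable M (\<lambda>x. f x * g x)"
proof (rule Bochner_Integration.integrable_bound)
  show "integrable M (\<lambda>x. (f x)\<^sup>2 + (g x)\<^sup>2)"
    using assms by (simp add: sq_integrable_def)
  show "(\<lambda>x. f x * g x) \<in> borel_measurable M"
    using assms by (auto simp: sq_integrable_def)
  have "\<bar>f x * g x\<bar> \<le> (f x)\<^sup>2 + (g x)\<^sup>2" for x
  proof -
    have "2 * (\<bar>f x\<bar> * \<bar>g x\<bar>) \<le> (f x)\<^sup>2 + (g x)\<^sup>2"
      using sum_squares_bound[of "\<bar>f x\<bar>" "\<bar>g x\<bar>"] by simp
    moreover have "0 \<le> \<bar>f x\<bar> * \<bar>g x\<bar>" by simp
    ultimately show ?thesis unfolding abs_mult by linarith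
  qed
  then show "AE x in M. norm (f x * g x) \<le> norm ((f x)\<^sup>2 + (g x)\<^sup>2)" by simp
qed

lemma sq_integrable_add:
  assumes "sq_integrable M f" "sq_integrable M g"
  shows "sq_integrable M (\<lambda>x. f x + g x)"
  using assms sq_integrable_mult[OF assms]
  by (auto simp: sq_integrable_def power2_sum mult.assoc)

lemma sq_integrable_cmult: "sq_integrable M f \<Longrightarrow> sq_integrable M (\<lambda>x. c * f x)"
  by (auto simp: sq_integrable_def power_mult_distrib)

lemma sq_integrable_diff:
  assumes "sq_integrable M f" "sq_integrable M g"
  shows "sq_integrable M (\<lambda>x. f x - g x)"
  using sq_integrable_add[OF assms(1) sq_integrable_cmult[OF assms(2), of "-1"]] by simp

lemma sq_integrable_sum:
  assumes "\<And>i. i \<in> I \<Longrightarrow> sq_integrable M (f i)"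
  shows "sq_integrable M (\<lambda>x. \<Sum>i\<in>I. f i x)"
  using assms
  by (induction I rule: infinite_finite_induct) (auto intro: sq_integrable_add simp: sq_integrable_def[of _ "\<lambda>_. 0"])

lemma sq_integrable_tmulv:
  assumes "\<And>i. i < m \<Longrightarrow> sq_integrable M (\<lambda>x. f x i)"
  shows "sq_integrable M (\<lambda>x. tmulv m A (f x) k)"
  unfolding tmulv_def using assms by (intro sq_integrable_sum sq_integrable_cmult) auto

section \<open>Second moments in spectral coordinates\<close>

lemma integral_bilinear:
  assumes f: "\<And>i. i < m \<Longrightarrow> sq_integrable M (\<lambda>x. f x i)"
    and g: "\<And>i. i < m \<Longrightarrow> sq_integrable M (\<lambda>x. g x i)"
  shows "(\<integral>x. (\<Sum>i<m. a i * f x i) * (\<Sum>j<m. b j * g x j) \<partial>M)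
    = (\<Sum>i<m. \<Sum>j<m. a i * cross_moment M f g i j * b j)"
proof -
  have "(\<integral>x. (\<Sum>i<m. a i * f x i) * (\<Sum>j<m. b j * g x j) \<partial>M)
      = (\<integral>x. (\<Sum>i<m. \<Sum>j<m. a i * b j * (f x i * g x j)) \<partial>M)"
    by (simp add: sum_product mult_ac)
  also have "\<dots> = (\<Sum>i<m. \<Sum>j<m. a i * b j * (\<integral>x. f x i * g x j \<partial>M))"
    using sq_integrable_mult[OF f g]
    by (subst Bochner_Integration.integral_sum;
        auto intro!: sum.cong Bochner_Integration.integral_sum Bochner_Integration.integrable_sum)+
  finally show ?thesis by (simp add: cross_moment_def mult_ac)
qed

lemma sum_rotate:
  "(\<Sum>a\<in>A. \<Sum>b\<in>B. \<Sum>c\<in>C. f a b c) = (\<Sum>b\<in>B. \<Sum>c\<in>C. \<Sum>a\<in>A. f a b c)"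
  by (subst sum.swap, rule sum.cong[OF refl], rule sum.swap)

lemma reduced_spectralD:
  assumes "reduced_spectral m r V lam S"
  shows "\<And>l. l < r \<Longrightarrow> 0 < lam l"
    and "\<And>l l'. l < r \<Longrightarrow> l' < r \<Longrightarrow> (\<Sum>i<m. V i l * V i l') = (if l = l' then 1 else 0)"
    and "\<And>i j. i < m \<Longrightarrow> j < m \<Longrightarrow> S i j = (\<Sum>l<r. V i l * lam l * V j l)"
  using assms by (auto simp: reduced_spectral_def)

lemma orthonormal_norm:
  fixes V :: rmat
  assumes orth: "\<And>l l'. l < r \<Longrightarrow> l' < r \<Longrightarrow> (\<Sum>i<m. V i l * V i l') = (if l = l' then 1 else 0)"
  shows "(\<Sum>i<m. (\<Sum>l<r. V i l * x l)\<^sup>2) = (\<Sum>l<r. (x l)\<^sup>2)"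
proof -
  have "(\<Sum>i<m. (\<Sum>l<r. V i l * x l)\<^sup>2) = (\<Sum>i<m. \<Sum>l<r. \<Sum>l'<r. (V i l * V i l') * (x l * x l'))"
    by (simp add: power2_eq_square sum_product mult_ac)
  also have "\<dots> = (\<Sum>l<r. \<Sum>l'<r. (\<Sum>i<m. V i l * V i l') * (x l * x l'))"
    unfolding sum_distrib_right by (rule sum_rotate)
  also have "\<dots> = (\<Sum>l<r. \<Sum>l'<r. if l = l' then x l * x l' else 0)"
    using orth by (intro sum.cong) auto
  finally show ?thesis by (simp add: power2_eq_square)
qed

text \<open>Expand the nonnegative squared distance of \<open>y\<close> from its projection onto the
  columns of \<open>V\<close>.\<close>

lemma bessel:
  fixes V :: rmat
  assumes orth: "\<And>l l'. l < r \<Longrightarrow> l' < r \<Longrightarrow> (\<Sum>i<m. V i l * V i l') = (if l = l' then 1 else 0)"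
  shows "(\<Sum>l<r. (\<Sum>i<m. V i l * y i)\<^sup>2) \<le> (\<Sum>i<m. (y i)\<^sup>2)"
proof -
  define z where "z l = (\<Sum>i<m. V i l * y i)" for l
  have "(\<Sum>i<m. y i * (\<Sum>l<r. V i l * z l)) = (\<Sum>l<r. (z l)\<^sup>2)"
    unfolding sum_distrib_left
    by (subst sum.swap) (simp add: z_def power2_eq_square sum_distrib_right sum_distrib_left mult_ac)
  moreover have "0 \<le> (\<Sum>i<m. (y i - (\<Sum>l<r. V i l * z l))\<^sup>2)" by (intro sum_nonneg) auto
  ultimately show ?thesis
    by (simp add: power2_diff sum.distrib sum_subtractf mult.assoc orthonormal_norm[OF orth]
        flip: sum_distrib_left z_def)
qed

text \<open>The left side is the quadratic form of the second-moment matrix at \<open>a\<close>,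
  which \<open>V\<close> diagonalizes.\<close>

lemma second_moment:
  assumes f: "\<And>i. i < m \<Longrightarrow> sq_integrable M (\<lambda>x. f x i)"
    and S: "reduced_spectral m r V lam (cross_moment M f f)"
  shows "(\<integral>x. (\<Sum>i<m. a i * f x i)\<^sup>2 \<partial>M) = (\<Sum>l<r. lam l * (\<Sum>i<m. V i l * a i)\<^sup>2)"
proof -
  have "(\<integral>x. (\<Sum>i<m. a i * f x i)\<^sup>2 \<partial>M) = (\<Sum>i<m. \<Sum>j<m. a i * cross_moment M f f i j * a j)"
    unfolding power2_eq_square by (rule integral_bilinear[OF f f])
  also have "\<dots> = (\<Sum>i<m. \<Sum>j<m. \<Sum>l<r. lam l * ((V i l * a i) * (V j l * a j)))"
    by (intro sum.cong refl) (simp add: reduced_spectralD(3)[OF S] sum_distrib_left sum_distrib_right mult_ac)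
  also have "\<dots> = (\<Sum>l<r. \<Sum>i<m. \<Sum>j<m. lam l * ((V i l * a i) * (V j l * a j)))"
    by (rule sum_rotate[symmetric])
  also have "\<dots> = (\<Sum>l<r. lam l * (\<Sum>i<m. V i l * a i)\<^sup>2)"
    unfolding power2_eq_square sum_product unfolding sum_distrib_left ..
  finally show ?thesis .
qed

text \<open>Directions orthogonal to the range of the second-moment matrix have vanishing second
  moment, so the features almost surely have no component there.\<close>

lemma range_features:
  assumes f: "\<And>i. i < m \<Longrightarrow> sq_integrable M (\<lambda>x. f x i)"
    and S: "reduced_spectral m r V lam (cross_moment M f f)" and i: "i < m"
  shows "AE x in M. f x i = (\<Sum>l<r. V i l * (\<Sum>j<m. V j l * f x j))"
proof -
  \<comment> \<open>Row \<open>i\<close> of the projection \<open>I - V V^T\<close> onto the kernel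
    of the second-moment matrix.\<close>
  define a where "a j = (if j = i then 1 else 0) - (\<Sum>l<r. V i l * V j l)" for j
  have a: "(\<Sum>j<m. a j * f x j) = f x i - (\<Sum>l<r. V i l * (\<Sum>j<m. V j l * f x j))" for x
  proof -
    have "(\<Sum>j<m. (\<Sum>l<r. V i l * V j l) * f x j) = (\<Sum>l<r. V i l * (\<Sum>j<m. V j l * f x j))"
      unfolding sum_distrib_left sum_distrib_right by (subst sum.swap) (simp add: mult_ac)
    then show ?thesis
      using i by (simp add: a_def left_diff_distrib sum_subtractf if_distrib[of "\<lambda>c. c * _"] cong: if_cong)
  qed
  have "(\<Sum>j<m. V j l * a j) = 0" if l: "l < r" for l
  proof -
    have "(\<Sum>j<m. V j l * (\<Sum>l'<r. V i l' * V j l')) = (\<Sum>l'<r. V i l' * (\<Sum>j<m. V j l' * V j l))"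
      unfolding sum_distrib_left by (subst sum.swap) (simp add: mult_ac)
    also have "\<dots> = (\<Sum>l'<r. if l' = l then V i l' else 0)"
      using l by (intro sum.cong) (auto simp: reduced_spectralD(2)[OF S])
    finally show ?thesis
      using i l by (simp add: a_def right_diff_distrib sum_subtractf if_distrib[of "\<lambda>c. _ * c"] cong: if_cong)
  qed
  then have "(\<integral>x. (\<Sum>j<m. a j * f x j)\<^sup>2 \<partial>M) = 0"
    by (simp add: second_moment[OF f S])
  moreover have "sq_integrable M (\<lambda>x. \<Sum>j<m. a j * f x j)"
    using f by (intro sq_integrable_sum sq_integrable_cmult) auto
  ultimately have "AE x in M. (\<Sum>j<m. a j * f x j)\<^sup>2 = 0"
    using integral_nonneg_eq_0_iff_AE[of M "\<lambda>x. (\<Sum>j<m. a j * f x j)\<^sup>2"] by (simp add: sq_integrable_def)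
  then show ?thesis unfolding a by simp
qed

text \<open>Cross moments inherit the range of the features. Whitening by a pseudo-inverse square
  root therefore loses nothing and can be undone.\<close>

lemma cross_moment_range:
  assumes f: "\<And>i. i < m \<Longrightarrow> sq_integrable M (\<lambda>x. f x i)"
    and g: "\<And>i. i < m \<Longrightarrow> sq_integrable M (\<lambda>x. g x i)"
    and S: "reduced_spectral m r V lam (cross_moment M f f)" and i: "i < m" and j: "j < m"
  shows "cross_moment M f g i j = (\<Sum>l<r. V i l * (\<Sum>a<m. V a l * cross_moment M f g a j))"
proof -
  have "cross_moment M f g i j = (\<integral>x. (\<Sum>l<r. V i l * (\<Sum>a<m. V a l * f x a)) * g x j \<partial>M)"
    unfolding cross_moment_def
  proof (rule integral_cong_AE)
    have fm[measurable]: "a < m \<Longrightarrow> (\<lambda>x. f x a) \<in> borel_measurable M" for a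
      using f by (auto simp: sq_integrable_def)
    have gm[measurable]: "(\<lambda>x. g x j) \<in> borel_measurable M"
      using g[OF j] by (auto simp: sq_integrable_def)
    show "(\<lambda>x. f x i * g x j) \<in> borel_measurable M" using i by measurable
    show "(\<lambda>x. (\<Sum>l<r. V i l * (\<Sum>a<m. V a l * f x a)) * g x j) \<in> borel_measurable M"
      by (intro borel_measurable_times borel_measurable_sum fm gm borel_measurable_const) auto
    show "AE x in M. f x i * g x j = (\<Sum>l<r. V i l * (\<Sum>a<m. V a l * f x a)) * g x j"
      using range_features[OF f S i, simplified] by (rule eventually_mono) simp
  qed
  also have "\<dots> = (\<integral>x. (\<Sum>l<r. \<Sum>a<m. V i l * V a l * (f x a * g x j)) \<partial>M)"
    by (simp add: sum_distrib_left sum_distrib_right mult_ac)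
  also have "\<dots> = (\<Sum>l<r. \<Sum>a<m. V i l * V a l * (\<integral>x. f x a * g x j \<partial>M))"
    using sq_integrable_mult[OF f g[OF j]]
    by (subst Bochner_Integration.integral_sum;
        auto intro!: sum.cong Bochner_Integration.integral_sum Bochner_Integration.integrable_sum)+
  finally show ?thesis
    by (simp add: cross_moment_def sum_distrib_left mult_ac)
qed

lemma cross_moment_swap: "cross_moment M f g i j = cross_moment M g f j i"
  by (simp add: cross_moment_def mult.commute)

text \<open>The product of whitened factors defining \<open>corr_dim\<close>, written in the two
  eigenbases: a \<open>ds\<close> by \<open>dw\<close> matrix whose singular values are the
  canonical correlations when the features are centered.\<close>

definition whitened_cross :: "nat \<Rightarrow> rmat \<Rightarrow> rmat \<Rightarrow> rvec \<Rightarrow> rmat \<Rightarrow> rvec \<Rightarrow> rmat" where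
  "whitened_cross m S Vs lams Vw lamw =
     (\<lambda>l r. (\<Sum>b<m. (\<Sum>a<m. Vs a l * S a b) * Vw b r) / (sqrt (lams l) * sqrt (lamw r)))"

text \<open>The outer factors \<open>Vs\<close> and \<open>Vw\<close> have orthonormal columns and
  drop out of the Frobenius norm.\<close>

lemma corr_dim_eq:
  assumes Ss: "reduced_spectral m ds Vs lams (cross_moment M \<phi>s \<phi>s)"
    and Sw: "reduced_spectral m dw Vw lamw (cross_moment M \<phi>w \<phi>w)"
  shows "corr_dim m M \<phi>s \<phi>w ds Vs lams dw Vw lamw
    = (\<Sum>l<ds. \<Sum>r<dw. (whitened_cross m (cross_moment M \<phi>s \<phi>w) Vs lams Vw lamw l r)\<^sup>2)"
proof -
  define S where "S = cross_moment M \<phi>s \<phi>w"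
  define R where "R = whitened_cross m S Vs lams Vw lamw"
  define U where "U l b = (\<Sum>a<m. Vs a l * S a b) / sqrt (lams l)" for l b
  have A: "mprod m (inv_sqrt ds Vs lams) S i b = (\<Sum>l<ds. Vs i l * U l b)" for i b
    unfolding mprod_def inv_sqrt_def U_def sum_distrib_left sum_distrib_right sum_divide_distrib
    by (subst sum.swap) (simp add: mult_ac)
  have R: "R l r = (\<Sum>b<m. U l b * Vw b r) / sqrt (lamw r)" for l r
    by (simp add: R_def whitened_cross_def U_def flip: sum_divide_distrib)
  have B: "mprod m (mprod m (inv_sqrt ds Vs lams) S) (inv_sqrt dw Vw lamw) i j
      = (\<Sum>l<ds. Vs i l * (\<Sum>r<dw. Vw j r * R l r))" for i j
  proof -
    have "mprod m (mprod m (inv_sqrt ds Vs lams) S) (inv_sqrt dw Vw lamw) i j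
      = (\<Sum>b<m. \<Sum>l<ds. \<Sum>r<dw. Vs i l * (Vw j r * (U l b * Vw b r / sqrt (lamw r))))"
      unfolding mprod_def[of m "mprod m (inv_sqrt ds Vs lams) S"] A
      unfolding inv_sqrt_def sum_product by (simp add: mult_ac)
    also have "\<dots> = (\<Sum>l<ds. \<Sum>r<dw. \<Sum>b<m. Vs i l * (Vw j r * (U l b * Vw b r / sqrt (lamw r))))"
      by (rule sum_rotate)
    finally show ?thesis
      by (simp add: R sum_distrib_left sum_divide_distrib)
  qed
  have "corr_dim m M \<phi>s \<phi>w ds Vs lams dw Vw lamw
      = (\<Sum>i<m. \<Sum>j<m. (\<Sum>l<ds. Vs i l * (\<Sum>r<dw. Vw j r * R l r))\<^sup>2)"
    unfolding corr_dim_def S_def[symmetric] B fnorm_def by (simp add: sum_nonneg B)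
  also have "\<dots> = (\<Sum>j<m. \<Sum>l<ds. (\<Sum>r<dw. Vw j r * R l r)\<^sup>2)"
    by (subst sum.swap) (simp add: orthonormal_norm[OF reduced_spectralD(2)[OF Ss]])
  also have "\<dots> = (\<Sum>l<ds. \<Sum>r<dw. (R l r)\<^sup>2)"
    by (subst sum.swap) (simp add: orthonormal_norm[OF reduced_spectralD(2)[OF Sw]])
  finally show ?thesis by (simp add: R_def S_def)
qed

text \<open>The triple sum pairs \<open>R\<close> with the product of \<open>\<alpha>\<close> and
  \<open>\<beta>\<close> over \<open>k\<close>. Cauchy-Schwarz is used once for this pairing and
  once for each entry of the product.\<close>

lemma trilinear_le:
  fixes \<alpha> \<beta> R :: rmat
  shows "(\<Sum>k<K. \<Sum>l<p. \<Sum>r<q. \<alpha> l k * R l r * \<beta> r k)\<^sup>2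
    \<le> (\<Sum>l<p. \<Sum>k<K. (\<alpha> l k)\<^sup>2) * ((\<Sum>l<p. \<Sum>r<q. (R l r)\<^sup>2) * (\<Sum>r<q. \<Sum>k<K. (\<beta> r k)\<^sup>2))"
proof -
  let ?N = "\<lambda>l r. \<Sum>k<K. \<alpha> l k * \<beta> r k"
  have "(\<Sum>k<K. \<Sum>l<p. \<Sum>r<q. \<alpha> l k * R l r * \<beta> r k) = (\<Sum>l<p. \<Sum>r<q. R l r * ?N l r)"
    unfolding sum_distrib_left by (rule trans[OF sum_rotate]) (simp add: mult_ac)
  then have "(\<Sum>k<K. \<Sum>l<p. \<Sum>r<q. \<alpha> l k * R l r * \<beta> r k)\<^sup>2
      = (\<Sum>(l,r)\<in>{..<p} \<times> {..<q}. R l r * ?N l r)\<^sup>2"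
    by (simp add: sum.cartesian_product)
  also have "\<dots> \<le> (\<Sum>(l,r)\<in>{..<p} \<times> {..<q}. (R l r)\<^sup>2) * (\<Sum>(l,r)\<in>{..<p} \<times> {..<q}. (?N l r)\<^sup>2)"
    using Cauchy_Schwarz_ineq_sum[of "\<lambda>(l,r). R l r" "\<lambda>(l,r). ?N l r" "{..<p} \<times> {..<q}"]
    by (simp add: case_prod_beta)
  also have "\<dots> \<le> (\<Sum>l<p. \<Sum>r<q. (R l r)\<^sup>2) * (\<Sum>l<p. \<Sum>r<q. (\<Sum>k<K. (\<alpha> l k)\<^sup>2) * (\<Sum>k<K. (\<beta> r k)\<^sup>2))"
    unfolding sum.cartesian_product[symmetric]
    by (intro mult_left_mono sum_mono Cauchy_Schwarz_ineq_sum sum_nonneg) auto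
  also have "(\<Sum>l<p. \<Sum>r<q. (\<Sum>k<K. (\<alpha> l k)\<^sup>2) * (\<Sum>k<K. (\<beta> r k)\<^sup>2))
      = (\<Sum>l<p. \<Sum>k<K. (\<alpha> l k)\<^sup>2) * (\<Sum>r<q. \<Sum>k<K. (\<beta> r k)\<^sup>2)"
    by (simp add: sum_product)
  finally show ?thesis by (simp add: mult_ac)
qed

text \<open>This is where the correlation dimension enters. In spectral coordinates the pairing is
  trilinear in the whitened coefficients of \<open>Q\<close>, the whitened cross moment and those of
  \<open>\<Delta>\<close>: the first have squared norm equal to the second moment of the strong
  logits, the last are bounded by the largest eigenvalue through Bessel's inequality.\<close>

lemma cross_moment_le:
  assumes s: "\<And>i. i < m \<Longrightarrow> sq_integrable M (\<lambda>x. \<phi>s x i)"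
    and w: "\<And>i. i < m \<Longrightarrow> sq_integrable M (\<lambda>x. \<phi>w x i)"
    and Ss: "reduced_spectral m ds Vs lams (cross_moment M \<phi>s \<phi>s)"
    and Sw: "reduced_spectral m dw Vw lamw (cross_moment M \<phi>w \<phi>w)"
  shows "(\<Sum>k<K. \<integral>x. tmulv m Q (\<phi>s x) k * tmulv m \<Delta> (\<phi>w x) k \<partial>M)\<^sup>2
    \<le> (\<Sum>k<K. \<integral>x. (tmulv m Q (\<phi>s x) k)\<^sup>2 \<partial>M)
      * (Max (lamw ` {..<dw}) * (fnorm m K \<Delta>)\<^sup>2 * corr_dim m M \<phi>s \<phi>w ds Vs lams dw Vw lamw)"
proof -
  define S where "S = cross_moment M \<phi>s \<phi>w"
  define R where "R = whitened_cross m S Vs lams Vw lamw"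
  define U where "U l b = (\<Sum>a<m. Vs a l * S a b)" for l b
  define q where "q l k = (\<Sum>a<m. Vs a l * Q a k)" for l k
  define e where "e r k = (\<Sum>b<m. Vw b r * \<Delta> b k)" for r k
  define \<alpha> where "\<alpha> l k = sqrt (lams l) * q l k" for l k
  define \<beta> where "\<beta> r k = sqrt (lamw r) * e r k" for r k
  let ?C = "corr_dim m M \<phi>s \<phi>w ds Vs lams dw Vw lamw"
  have pos: "\<And>l. l < ds \<Longrightarrow> 0 < lams l" "\<And>r. r < dw \<Longrightarrow> 0 < lamw r"
    using reduced_spectralD(1)[OF Ss] reduced_spectralD(1)[OF Sw] by auto
  have S1: "S a b = (\<Sum>l<ds. Vs a l * U l b)" if "a < m" "b < m" for a b
    unfolding U_def S_def by (rule cross_moment_range[OF s w Ss that])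
  have S2: "S a b = (\<Sum>r<dw. Vw b r * (\<Sum>b'<m. Vw b' r * S a b'))" if "a < m" "b < m" for a b
    using cross_moment_range[OF w s Sw that(2,1)] by (simp add: S_def cross_moment_swap[of M \<phi>s])
  have U: "U l b = (\<Sum>r<dw. Vw b r * (\<Sum>b'<m. Vw b' r * U l b'))" if b: "b < m" for l b
  proof -
    have "U l b = (\<Sum>a<m. \<Sum>r<dw. \<Sum>b'<m. Vw b r * (Vw b' r * (Vs a l * S a b')))"
      unfolding U_def by (intro sum.cong refl, subst S2[OF _ b]) (auto simp: sum_distrib_left mult_ac)
    also have "\<dots> = (\<Sum>r<dw. \<Sum>b'<m. \<Sum>a<m. Vw b r * (Vw b' r * (Vs a l * S a b')))"
      by (rule sum_rotate)
    finally show ?thesis by (simp add: U_def sum_distrib_left)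
  qed
  \<comment> \<open>\<open>S1\<close> and \<open>U\<close> project the cross moment on its strong
    and its weak side; afterwards the square roots of eigenvalues in \<open>\<alpha>\<close> and
    \<open>\<beta>\<close> cancel those in \<open>R\<close>.\<close>
  have sum_eq: "(\<Sum>a<m. \<Sum>b<m. Q a k * S a b * \<Delta> b k) = (\<Sum>l<ds. \<Sum>r<dw. \<alpha> l k * R l r * \<beta> r k)" for k
  proof -
    have "(\<Sum>a<m. \<Sum>b<m. Q a k * S a b * \<Delta> b k)
        = (\<Sum>a<m. \<Sum>b<m. \<Sum>l<ds. (Vs a l * Q a k) * (U l b * \<Delta> b k))"
      by (intro sum.cong refl) (simp add: S1 sum_distrib_left sum_distrib_right mult_ac)
    also have "\<dots> = (\<Sum>l<ds. q l k * (\<Sum>b<m. U l b * \<Delta> b k))"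
      unfolding q_def sum_product
      by (rule sum_rotate[symmetric])
    also have "\<dots> = (\<Sum>l<ds. \<Sum>r<dw. \<alpha> l k * R l r * \<beta> r k)"
    proof (intro sum.cong refl)
      fix l assume "l \<in> {..<ds}"
      then have l: "l < ds" by simp
      have "(\<Sum>b<m. U l b * \<Delta> b k) = (\<Sum>b<m. \<Sum>r<dw. (\<Sum>b'<m. Vw b' r * U l b') * (Vw b r * \<Delta> b k))"
        unfolding sum_distrib_right[of _ "{..<dw}", symmetric] mult.assoc[symmetric]
        by (intro sum.cong refl arg_cong2[where f="(*)"], subst U) (auto simp: mult_ac)
      also have "\<dots> = (\<Sum>r<dw. (\<Sum>b'<m. Vw b' r * U l b') * e r k)"
        unfolding e_def sum_distrib_left by (rule sum.swap)
      also have "q l k * \<dots> = (\<Sum>r<dw. \<alpha> l k * R l r * \<beta> r k)"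
        unfolding sum_distrib_left
      proof (intro sum.cong refl)
        fix r assume "r \<in> {..<dw}"
        then have "0 < sqrt (lams l)" "0 < sqrt (lamw r)" using pos l by auto
        then show "q l k * ((\<Sum>b'<m. Vw b' r * U l b') * e r k) = \<alpha> l k * R l r * \<beta> r k"
          by (simp add: \<alpha>_def \<beta>_def R_def whitened_cross_def U_def mult_ac)
      qed
      finally show "q l k * (\<Sum>b<m. U l b * \<Delta> b k) = (\<Sum>r<dw. \<alpha> l k * R l r * \<beta> r k)" .
    qed
    finally show ?thesis .
  qed
  have \<alpha>: "(\<Sum>l<ds. \<Sum>k<K. (\<alpha> l k)\<^sup>2) = (\<Sum>k<K. \<integral>x. (tmulv m Q (\<phi>s x) k)\<^sup>2 \<partial>M)"
  proof -
    have "(\<integral>x. (tmulv m Q (\<phi>s x) k)\<^sup>2 \<partial>M) = (\<Sum>l<ds. (\<alpha> l k)\<^sup>2)" for k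
      unfolding tmulv_def
      by (subst second_moment[OF s Ss])
        (auto simp: \<alpha>_def q_def power_mult_distrib less_imp_le[OF pos(1)] intro!: sum.cong)
    then show ?thesis by (simp add: sum.swap[of _ "{..<K}"])
  qed
  have \<beta>: "(\<Sum>r<dw. \<Sum>k<K. (\<beta> r k)\<^sup>2) \<le> Max (lamw ` {..<dw}) * (fnorm m K \<Delta>)\<^sup>2" if "0 < dw"
  proof -
    have le_Max: "lamw r \<le> Max (lamw ` {..<dw})" if "r < dw" for r
      using that by (intro Max_ge) auto
    have "0 \<le> Max (lamw ` {..<dw})" using le_Max[OF \<open>0 < dw\<close>] pos(2)[OF \<open>0 < dw\<close>] by linarith
    have "(\<Sum>r<dw. \<Sum>k<K. (\<beta> r k)\<^sup>2) = (\<Sum>r<dw. \<Sum>k<K. lamw r * (e r k)\<^sup>2)"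
      by (auto simp: \<beta>_def power_mult_distrib less_imp_le[OF pos(2)] intro!: sum.cong)
    also have "\<dots> \<le> (\<Sum>r<dw. \<Sum>k<K. Max (lamw ` {..<dw}) * (e r k)\<^sup>2)"
      by (intro sum_mono mult_right_mono le_Max) auto
    also have "\<dots> = Max (lamw ` {..<dw}) * (\<Sum>k<K. \<Sum>r<dw. (e r k)\<^sup>2)"
      by (subst sum.swap) (simp add: sum_distrib_left)
    also have "\<dots> \<le> Max (lamw ` {..<dw}) * (\<Sum>k<K. \<Sum>b<m. (\<Delta> b k)\<^sup>2)"
      unfolding e_def
      by (intro mult_left_mono sum_mono bessel reduced_spectralD(2)[OF Sw] \<open>0 \<le> Max _\<close>)
    also have "(\<Sum>k<K. \<Sum>b<m. (\<Delta> b k)\<^sup>2) = (fnorm m K \<Delta>)\<^sup>2"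
      unfolding fnorm_def by (subst sum.swap) (simp add: sum_nonneg)
    finally show ?thesis .
  qed
  have C: "?C = (\<Sum>l<ds. \<Sum>r<dw. (R l r)\<^sup>2)"
    unfolding corr_dim_eq[OF Ss Sw] R_def S_def ..
  have "(\<Sum>k<K. \<integral>x. tmulv m Q (\<phi>s x) k * tmulv m \<Delta> (\<phi>w x) k \<partial>M)\<^sup>2
      = (\<Sum>k<K. \<Sum>l<ds. \<Sum>r<dw. \<alpha> l k * R l r * \<beta> r k)\<^sup>2"
  proof -
    have "(\<integral>x. tmulv m Q (\<phi>s x) k * tmulv m \<Delta> (\<phi>w x) k \<partial>M)
        = (\<Sum>l<ds. \<Sum>r<dw. \<alpha> l k * R l r * \<beta> r k)" for k
      unfolding tmulv_def sum_eq[symmetric] S_def by (rule integral_bilinear[OF s w])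
    then show ?thesis by simp
  qed
  also have "\<dots> \<le> (\<Sum>l<ds. \<Sum>k<K. (\<alpha> l k)\<^sup>2) * (?C * (\<Sum>r<dw. \<Sum>k<K. (\<beta> r k)\<^sup>2))"
    unfolding C by (rule trilinear_le)
  also have "\<dots> \<le> (\<Sum>l<ds. \<Sum>k<K. (\<alpha> l k)\<^sup>2) * (Max (lamw ` {..<dw}) * (fnorm m K \<Delta>)\<^sup>2 * ?C)"
  \<comment> \<open>For \<open>dw = 0\<close> the maximum of the empty set is an unspecified number,
    possibly negative, but it is multiplied by a correlation dimension equal to zero.\<close>
  proof (cases "0 < dw")
    case True
    have "0 \<le> ?C" unfolding C by (intro sum_nonneg) auto
    from mult_left_mono[OF \<beta>[OF True] this] show ?thesis
      by (intro mult_left_mono sum_nonneg) (auto simp: mult_ac)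
  next
    case False
    then have "?C = 0" unfolding C by simp
    then show ?thesis by simp
  qed
  finally show ?thesis unfolding \<alpha> .
qed

section \<open>Error of the weak logits\<close>

lemma fit_error_eq:
  assumes f: "\<And>i. i < m \<Longrightarrow> sq_integrable M (\<lambda>x. f x i)"
    and h: "\<And>k. k < K \<Longrightarrow> sq_integrable M (\<lambda>x. h x k)"
  shows "fit_error M m K f h \<Theta> = (\<Sum>k<K. \<integral>x. (tmulv m \<Theta> (f x) k - h x k)\<^sup>2 \<partial>M)"
  unfolding fit_error_def vnorm_sq vdiff_def using f h
  by (intro Bochner_Integration.integral_sum sq_integrable_sq sq_integrable_diff sq_integrable_tmulv) auto

text \<open>The weight \<open>1 / 8\<close> is chosen so that the four cross terms in
  \<open>weak_fit_error_le\<close> together return only half of the squared norm of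
  \<open>p\<close>.\<close>

lemma integral_young:
  assumes "sq_integrable M p" "sq_integrable M u"
  shows "(\<integral>x. p x * u x \<partial>M) \<le> (\<integral>x. (p x)\<^sup>2 \<partial>M) / 8 + 2 * (\<integral>x. (u x)\<^sup>2 \<partial>M)"
proof -
  have "(\<integral>x. p x * u x \<partial>M) \<le> (\<integral>x. (p x)\<^sup>2 / 8 + 2 * (u x)\<^sup>2 \<partial>M)"
  proof (intro integral_mono)
    show "p x * u x \<le> (p x)\<^sup>2 / 8 + 2 * (u x)\<^sup>2" for x
      using zero_le_power2[of "p x - 4 * u x"] by (simp add: power2_eq_square algebra_simps)
  qed (use assms sq_integrable_mult[OF assms] in \<open>auto simp: sq_integrable_def\<close>)
  then show ?thesis using assms by (simp add: sq_integrable_sq)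
qed

text \<open>
  The difference \<open>p\<close> of \<open>\<Theta>\<close> and \<open>S\<close> lies in the span of the strong features, so in
  \<open>\<parallel>p\<parallel>\<^sup>2\<close> the weak estimation error \<open>A - W\<close> only enters through its strong component.
\<close>

lemma weak_fit_error_le:
  fixes M :: "rvec measure"
  assumes s: "\<And>i. i < m \<Longrightarrow> sq_integrable M (\<lambda>x. \<phi>s x i)"
    and w: "\<And>i. i < m \<Longrightarrow> sq_integrable M (\<lambda>x. \<phi>w x i)"
    and \<eta>: "\<And>k. k < K \<Longrightarrow> sq_integrable M (\<lambda>x. \<eta> x k)"
    and Ss: "reduced_spectral m ds Vs lams (cross_moment M \<phi>s \<phi>s)"
    and Sw: "reduced_spectral m dw Vw lamw (cross_moment M \<phi>w \<phi>w)"
  shows "fit_error M m K \<phi>w \<eta> A \<le> 15 * (fit_error M m K \<phi>s (\<lambda>x. tmulv m A (\<phi>w x)) \<Theta>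
    + fit_error M m K \<phi>w \<eta> W + fit_error M m K \<phi>s \<eta> S
    + Max (lamw ` {..<dw}) * (fnorm m K (mdiff A W))\<^sup>2 * corr_dim m M \<phi>s \<phi>w ds Vs lams dw Vw lamw)"
proof -
  define D where "D = Max (lamw ` {..<dw}) * (fnorm m K (mdiff A W))\<^sup>2 * corr_dim m M \<phi>s \<phi>w ds Vs lams dw Vw lamw"
  define I where "I f = (\<Sum>k<K. \<integral>x. (f x k)\<^sup>2 \<partial>M)" for f :: "rvec \<Rightarrow> rvec"
  define J where "J f g = (\<Sum>k<K. \<integral>x. f x k * g x k \<partial>M)" for f g :: "rvec \<Rightarrow> rvec"
  define p where "p x = vdiff (tmulv m \<Theta> (\<phi>s x)) (tmulv m S (\<phi>s x))" for x
  define u where "u x = vdiff (tmulv m \<Theta> (\<phi>s x)) (tmulv m A (\<phi>w x))" for x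
  define z where "z x = tmulv m (mdiff A W) (\<phi>w x)" for x
  define v where "v x = vdiff (tmulv m W (\<phi>w x)) (\<eta> x)" for x
  define t where "t x = vdiff (tmulv m S (\<phi>s x)) (\<eta> x)" for x
  define y where "y x = vdiff (tmulv m A (\<phi>w x)) (\<eta> x)" for x
  have sqi: "sq_integrable M (\<lambda>x. p x k)" "sq_integrable M (\<lambda>x. u x k)" "sq_integrable M (\<lambda>x. z x k)"
    "sq_integrable M (\<lambda>x. v x k)" "sq_integrable M (\<lambda>x. t x k)" "sq_integrable M (\<lambda>x. y x k)" if "k < K" for k
    unfolding p_def u_def z_def v_def t_def y_def vdiff_def
    using s w \<eta> that by (auto intro!: sq_integrable_diff sq_integrable_tmulv)
  have p_eq: "p x = tmulv m (mdiff \<Theta> S) (\<phi>s x)" for x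
    by (simp add: p_def vdiff_def tmulv_def mdiff_def left_diff_distrib sum_subtractf fun_eq_iff)
  have z_eq: "z x = vdiff (tmulv m A (\<phi>w x)) (tmulv m W (\<phi>w x))" for x
    by (simp add: z_def vdiff_def tmulv_def mdiff_def left_diff_distrib sum_subtractf fun_eq_iff)
  have young: "J p f \<le> I p / 8 + 2 * I f" if "\<And>k. k < K \<Longrightarrow> sq_integrable M (\<lambda>x. f x k)" for f
    unfolding J_def I_def sum_divide_distrib sum_distrib_left sum.distrib[symmetric]
    using sqi that by (intro sum_mono integral_young) auto
  have I_nonneg: "0 \<le> I f" for f by (simp add: I_def sum_nonneg)
  have D_nonneg: "0 \<le> D"
  proof (cases "dw = 0")
    case True
    have "corr_dim m M \<phi>s \<phi>w ds Vs lams dw Vw lamw = 0"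
      unfolding corr_dim_eq[OF Ss Sw] using True by simp
    then show ?thesis unfolding D_def by simp
  next
    case False
    then have "lamw 0 \<le> Max (lamw ` {..<dw})" "0 < lamw 0"
      using reduced_spectralD(1)[OF Sw] by (auto intro: Max_ge)
    then show ?thesis unfolding D_def corr_dim_eq[OF Ss Sw] by (auto intro!: mult_nonneg_nonneg sum_nonneg)
  qed
  have "(J p z)\<^sup>2 \<le> I p * D"
    unfolding J_def I_def D_def p_eq z_def by (rule cross_moment_le[OF s w Ss Sw])
  also have "\<dots> \<le> (I p / 8 + 2 * D)\<^sup>2"
    using zero_le_power2[of "I p / 8 - 2 * D"] by (simp add: power2_eq_square algebra_simps)
  finally have Jz: "J p z \<le> I p / 8 + 2 * D"
    by (rule power2_le_imp_le) (use I_nonneg[of p] D_nonneg in simp)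
  \<comment> \<open>The decomposition \<open>p = u + z + v - t\<close> telescopes through the weak
    logits, their best approximation and the true logits. One factor \<open>p\<close> is kept
    unsplit because it lies in the strong span, as \<open>cross_moment_le\<close> requires for the
    pairing with \<open>z\<close>.\<close>
  have "I p = (\<Sum>k<K. \<integral>x. p x k * u x k + p x k * z x k + p x k * v x k - p x k * t x k \<partial>M)"
  proof -
    have "p x k = u x k + z x k + v x k - t x k" for x k
      by (simp add: p_def u_def z_eq v_def t_def vdiff_def)
    then have "(p x k)\<^sup>2 = p x k * (u x k + z x k + v x k - t x k)" for x k
      by (simp add: power2_eq_square)
    then show ?thesis by (simp add: I_def distrib_left right_diff_distrib)
  qed
  also have "\<dots> = J p u + J p z + J p v - J p t"
    unfolding J_def sum.distrib[symmetric] sum_subtractf[symmetric]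
    using sqi by (intro sum.cong refl) (simp add: sq_integrable_mult)
  finally have Ip: "I p \<le> J p u + J p z + J p v - J p t" by simp
  have "- J p t = J p (\<lambda>x k. - t x k)" by (simp add: J_def sum_negf)
  also have "\<dots> \<le> I p / 8 + 2 * I (\<lambda>x k. - t x k)"
    using sq_integrable_cmult[OF sqi(5), of _ "-1"] by (intro young) auto
  also have "I (\<lambda>x k. - t x k) = I t" by (simp add: I_def)
  \<comment> \<open>The four terms contribute \<open>4 * I p / 8\<close> on the right; moving this
    half to the left doubles the factor \<open>2\<close>.\<close>
  finally have "I p \<le> 4 * (I u + I v + I t + D)"
    using Ip Jz young[of u] young[of v] sqi by simp
  moreover have "I y \<le> 3 * I u + 3 * I p + 3 * I t"
    unfolding I_def sum_distrib_left sum.distrib[symmetric]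
  proof (intro sum_mono)
    fix k assume "k \<in> {..<K}"
    then have k: "k < K" by simp
    have "(y x k)\<^sup>2 \<le> 3 * (u x k)\<^sup>2 + 3 * (p x k)\<^sup>2 + 3 * (t x k)\<^sup>2" for x
    proof -
      have "y x k = p x k + t x k - u x k" by (simp add: y_def u_def p_def t_def vdiff_def)
      show ?thesis
        unfolding \<open>y x k = _\<close>
        using zero_le_power2[of "u x k + p x k"] zero_le_power2[of "u x k + t x k"] zero_le_power2[of "p x k - t x k"]
        by (simp add: power2_eq_square algebra_simps)
    qed
    then have "(\<integral>x. (y x k)\<^sup>2 \<partial>M) \<le> (\<integral>x. 3 * (u x k)\<^sup>2 + 3 * (p x k)\<^sup>2 + 3 * (t x k)\<^sup>2 \<partial>M)"
      by (intro integral_mono Bochner_Integration.integrable_add integrable_mult_right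
          sq_integrable_sq sqi k)
    also have "\<dots> = 3 * (\<integral>x. (u x k)\<^sup>2 \<partial>M) + 3 * (\<integral>x. (p x k)\<^sup>2 \<partial>M) + 3 * (\<integral>x. (t x k)\<^sup>2 \<partial>M)"
      using sqi[OF k] by (simp add: sq_integrable_sq)
    finally show "(\<integral>x. (y x k)\<^sup>2 \<partial>M) \<le> \<dots>" .
  qed
  \<comment> \<open>\<open>15 = 3 + 3 * 4\<close>: the direct share of \<open>u\<close> or
    \<open>t\<close>, plus the share that comes through \<open>p\<close>.\<close>
  ultimately have "I y \<le> 15 * (I u + I v + I t + D)"
    using I_nonneg[of v] I_nonneg[of t] I_nonneg[of u] D_nonneg
    unfolding distrib_left by linarith
  moreover have "fit_error M m K \<phi>w \<eta> A = I y" "fit_error M m K \<phi>w \<eta> W = I v" "fit_error M m K \<phi>s \<eta> S = I t"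
    "fit_error M m K \<phi>s (\<lambda>x. tmulv m A (\<phi>w x)) \<Theta> = I u"
    using s w \<eta> by (simp_all add: fit_error_eq I_def y_def v_def t_def u_def vdiff_def sq_integrable_tmulv)
  ultimately show ?thesis by (simp add: D_def)
qed

subsection \<open>Excess risk\<close>

lemma sq_integrable_of_exp:
  assumes f: "f \<in> borel_measurable M" 
    and "integrable M (\<lambda>x. exp (f x))" "integrable M (\<lambda>x. exp (- f x))"
  shows "sq_integrable M f"
proof -
  have "integrable M (\<lambda>x. (f x)\<^sup>2)"
  proof (rule Bochner_Integration.integrable_bound)
    show "integrable M (\<lambda>x. 2 * (exp (f x) + exp (- f x)))" using assms by simp
    show "(\<lambda>x. (f x)\<^sup>2) \<in> borel_measurable M" using f by simp
    have "y\<^sup>2 \<le> 2 * (exp y + exp (- y))" for y :: real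
    proof -
      have "\<bar>y\<bar>\<^sup>2 \<le> 2 * exp \<bar>y\<bar>" using exp_lower_Taylor_quadratic[of "\<bar>y\<bar>"] by simp
      moreover have "exp \<bar>y\<bar> \<le> exp y + exp (- y)" by (simp add: abs_if)
      ultimately show ?thesis by simp
    qed
    then show "AE x in M. norm ((f x)\<^sup>2) \<le> norm (2 * (exp (f x) + exp (- f x)))"
      by simp
  qed
  then show ?thesis using f by (simp add: sq_integrable_def)
qed

lemma subgaussian_sq_integrable:
  assumes "subgaussian M m f \<kappa>" "i < m" "(\<lambda>x. f x i) \<in> borel_measurable M"
  shows "sq_integrable M (\<lambda>x. f x i)"
proof (rule sq_integrable_of_exp)
  have "integrable M (\<lambda>x. exp (s * f x i))" for s
  proof -
    define u where "u = (\<lambda>j. if j = i then s else 0)"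
    have "u \<in> Rvec m" using assms(2) by (auto simp: u_def Rvec_def)
    moreover have "dotp m u v = s * v i" for v
      using assms(2) by (simp add: dotp_def u_def if_distrib[of "\<lambda>c. c * _"] cong: if_cong)
    ultimately show ?thesis using assms(1) by (auto simp: subgaussian_def)
  qed
  from this[of 1] this[of "-1"] show "integrable M (\<lambda>x. exp (f x i))" "integrable M (\<lambda>x. exp (- f x i))"
    by simp_all
qed (use assms in auto)

lemma sq_integrable_of_vnorm4:
  assumes "prob_space M" "i < m" "(\<lambda>x. f x i) \<in> borel_measurable M" "integrable M (\<lambda>x. vnorm m (f x) ^ 4)"
  shows "sq_integrable M (\<lambda>x. f x i)"
proof -
  interpret prob_space M by fact
  have le: "norm ((f x i)\<^sup>2) \<le> norm (1 + vnorm m (f x) ^ 4)" for x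
  proof -
    have "(f x i)\<^sup>2 \<le> (vnorm m (f x))\<^sup>2"
      using power_mono[OF abs_nth_le_vnorm[OF assms(2), of "f x"] abs_ge_zero, of 2] by simp
    also have "\<dots> \<le> 1 + ((vnorm m (f x))\<^sup>2)\<^sup>2"
    proof -
      have "y \<le> 1 + y\<^sup>2" if "0 \<le> y" for y :: real
        using zero_le_power2[of "y - 1"] that unfolding power2_eq_square by (simp add: algebra_simps)
      from this[of "(vnorm m (f x))\<^sup>2"] show ?thesis by simp
    qed
    finally show ?thesis by simp
  qed
  have "integrable M (\<lambda>x. (f x i)\<^sup>2)"
  proof (rule Bochner_Integration.integrable_bound)
    show "integrable M (\<lambda>x. 1 + vnorm m (f x) ^ 4)" using assms(4) by simp
    show "(\<lambda>x. (f x i)\<^sup>2) \<in> borel_measurable M" using assms(3) by simp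
    show "AE x in M. norm ((f x i)\<^sup>2) \<le> norm (1 + vnorm m (f x) ^ 4)" by (intro AE_I2 le)
  qed
  then show ?thesis using assms by (simp add: sq_integrable_def)
qed

lemma (in prob_space) sq_integrable_integrable: "sq_integrable M f \<Longrightarrow> integrable M f"
  unfolding sq_integrable_def by (auto intro: square_integrable_imp_integrable)

text \<open>Passes a bound valid for every competitor to the infimum; used for the strong
  approximation error and for \<open>rho_sw\<close>.\<close>

lemma le_cINF_affine:
  fixes f :: "'i \<Rightarrow> real"
  assumes "A \<noteq> {}" "0 \<le> b" "\<And>i. i \<in> A \<Longrightarrow> x \<le> a + b * f i"
  shows "x \<le> a + b * (INF i\<in>A. f i)"
proof (cases "b = 0")
  case True
  then show ?thesis using assms by auto
next
  case False
  then have "(x - a) / b \<le> (INF i\<in>A. f i)"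
    using assms by (intro cINF_greatest) (auto simp: field_simps)
  then show ?thesis using False assms(2) by (simp add: field_simps)
qed

text \<open>On the slice where the scenario is \<open>k\<close>, the image of \<open>D\<close> under
  the first projection has density \<open>Pstar x k\<close> with respect to the marginal. The
  integral over \<open>D\<close> is the sum over these finitely many slices.\<close>

lemma integral_conditional:
  fixes f :: "rvec \<Rightarrow> nat \<Rightarrow> real"
  assumes D: "joint_law dx X K D" and P: "conditional_law X K D Pstar"
    and f: "\<And>k. k < K \<Longrightarrow> (\<lambda>x. f x k) \<in> borel_measurable (marginal X D)"
    and b: "\<And>x k. x \<in> X \<Longrightarrow> k < K \<Longrightarrow> \<bar>f x k\<bar> \<le> b k"
  shows "(\<integral>z. f (fst z) (snd z) \<partial>D) = (\<integral>x. (\<Sum>k<K. Pstar x k * f x k) \<partial>marginal X D)"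
proof -
  let ?B = "restrict_space borel X" and ?Dx = "marginal X D"
  interpret D: prob_space D using D by (simp add: joint_law_def)
  have sets_D: "sets D = sets (?B \<Otimes>\<^sub>M count_space {..<K})" using D by (simp add: joint_law_def)
  then have space_D: "space D = X \<times> {..<K}"
    using sets_eq_imp_space_eq[OF sets_D] by (simp add: space_pair_measure space_restrict_space)
  have fst_D: "fst \<in> D \<rightarrow>\<^sub>M ?B"
    using measurable_cong_sets[OF sets_D refl] measurable_fst by blast
  have sets_Dx: "sets ?Dx = sets ?B" and space_Dx: "space ?Dx = X"
    by (simp_all add: marginal_def space_restrict_space)
  interpret Dx: prob_space ?Dx unfolding marginal_def by (rule D.prob_space_distr[OF fst_D])
  have P_meas: "(\<lambda>x. Pstar x k) \<in> borel_measurable ?Dx" if "k < K" for k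
    using P that measurable_cong_sets[OF sets_Dx refl] by (auto simp: conditional_law_def)
  have P_bounds: "0 \<le> Pstar x k" "Pstar x k \<le> 1" if "x \<in> X" "k < K" for x k
  proof -
    have x: "Pstar x \<in> prob_simplex K" using P that(1) by (auto simp: conditional_law_def)
    then show "0 \<le> Pstar x k" using that by (auto simp: prob_simplex_def)
    have "Pstar x k \<le> (\<Sum>k<K. Pstar x k)"
      using x that by (intro member_le_sum) (auto simp: prob_simplex_def)
    then show "Pstar x k \<le> 1" using x by (simp add: prob_simplex_def)
  qed
  have P_int: "integrable ?Dx (\<lambda>x. Pstar x k)" if "k < K" for k
    using P_bounds that P_meas[OF that] by (intro Dx.integrable_const_bound[of _ 1]) (auto simp: space_Dx)
  have f_int: "integrable ?Dx (\<lambda>x. Pstar x k * f x k)" if "k < K" for k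
  proof (rule Dx.integrable_const_bound)
    have "\<bar>Pstar x k * f x k\<bar> \<le> 1 * b k" if "x \<in> X" for x
      unfolding abs_mult using P_bounds[OF that \<open>k < K\<close>] b[OF that \<open>k < K\<close>] by (intro mult_mono) auto
    then show "AE x in ?Dx. norm (Pstar x k * f x k) \<le> 1 * b k" by (intro AE_I2) (simp add: space_Dx)
  qed (use P_meas[OF that] f[OF that] in auto)
  have slice: "X \<times> {k} \<in> sets D" if "k < K" for k
    unfolding sets_D using that by (intro pair_measureI) (auto simp: space_restrict_space intro: sets.top[of ?B, simplified space_restrict_space, simplified])
  have slice_eq: "(\<integral>z. indicator (X \<times> {k}) z * f (fst z) k \<partial>D) = (\<integral>x. Pstar x k * f x k \<partial>?Dx)" if k: "k < K" for k
  proof -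
    let ?\<nu> = "distr (density D (indicator (X \<times> {k}))) ?B fst"
    have meas: "fst \<in> density D (indicator (X \<times> {k})) \<rightarrow>\<^sub>M ?B" using fst_D by simp
    have "?\<nu> = density ?Dx (\<lambda>x. ennreal (Pstar x k))"
    proof (rule measure_eqI)
      show "sets ?\<nu> = sets (density ?Dx (\<lambda>x. ennreal (Pstar x k)))" by (simp add: sets_Dx)
      fix A assume "A \<in> sets ?\<nu>"
      then have A: "A \<in> sets ?B" by simp
      then have AX: "A \<subseteq> X" using sets.sets_into_space[OF A] by (simp add: space_restrict_space)
      have pre: "fst -` A \<inter> space D \<in> sets D" using A fst_D by (rule measurable_sets[rotated])
      have "emeasure ?\<nu> A = (\<integral>\<^sup>+z. indicator (X \<times> {k}) z * indicator (fst -` A \<inter> space D) z \<partial>D)"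
        using A meas pre slice[OF k] by (simp add: emeasure_distr emeasure_density)
      also have "\<dots> = (\<integral>\<^sup>+z. indicator (A \<times> {k}) z \<partial>D)"
        using AX k by (intro nn_integral_cong) (auto simp: indicator_def space_D)
      also have "\<dots> = emeasure D (A \<times> {k})"
      proof (rule nn_integral_indicator)
        have "A \<times> {k} = (fst -` A \<inter> space D) \<inter> (X \<times> {k})" using AX k by (auto simp: space_D)
        then show "A \<times> {k} \<in> sets D" using pre slice[OF k] by auto
      qed
      also have "\<dots> = ennreal (\<integral>x\<in>A. Pstar x k \<partial>?Dx)"
        using P A k by (simp add: conditional_law_def D.emeasure_eq_measure)
      also have "\<dots> = (\<integral>\<^sup>+x. ennreal (indicator A x * Pstar x k) \<partial>?Dx)"
        unfolding set_lebesgue_integral_def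
        using P_int[OF k] A P_bounds k
        by (subst nn_integral_eq_integral) (auto simp: sets_Dx space_Dx intro!: integrable_mult_indicator[where 'b=real, simplified])
      also have "\<dots> = emeasure (density ?Dx (\<lambda>x. ennreal (Pstar x k))) A"
        using A P_meas[OF k] 
        by (subst emeasure_density) (auto simp: sets_Dx indicator_def intro!: nn_integral_cong)
      finally show "emeasure ?\<nu> A = emeasure (density ?Dx (\<lambda>x. ennreal (Pstar x k))) A" .
    qed
    then have "(\<integral>x. f x k \<partial>?\<nu>) = (\<integral>x. Pstar x k * f x k \<partial>?Dx)"
      using P_meas[OF k] f[OF k] P_bounds(1)[OF _ k]
      by (simp only:, subst integral_density) (auto simp: space_Dx intro!: AE_I2)
    moreover have "(\<integral>x. f x k \<partial>?\<nu>) = (\<integral>z. indicator (X \<times> {k}) z * f (fst z) k \<partial>D)"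
    proof -
      have fk: "(\<lambda>x. f x k) \<in> borel_measurable ?B"
        using f[OF k] measurable_cong_sets[OF sets_Dx refl] by blast
      have "(\<integral>x. f x k \<partial>?\<nu>) = (\<integral>z. f (fst z) k \<partial>density D (indicator (X \<times> {k})))"
        using meas fk by (rule integral_distr)
      also have "\<dots> = (\<integral>z. f (fst z) k \<partial>density D (\<lambda>z. ennreal (indicator (X \<times> {k}) z)))"
        by (simp add: ennreal_indicator)
      also have "\<dots> = (\<integral>z. indicator (X \<times> {k}) z * f (fst z) k \<partial>D)"
        using slice[OF k] measurable_compose[OF fst_D fk] by (subst integral_density) auto
      finally show ?thesis .
    qed
    ultimately show ?thesis by simp
  qed
  have "(\<integral>z. f (fst z) (snd z) \<partial>D) = (\<integral>z. (\<Sum>k<K. indicator (X \<times> {k}) z * f (fst z) k) \<partial>D)"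
  proof (intro Bochner_Integration.integral_cong refl)
    fix z assume "z \<in> space D"
    then have z: "fst z \<in> X" "snd z < K" by (auto simp: space_D)
    have "(\<Sum>k<K. indicator (X \<times> {k}) z * f (fst z) k) = (\<Sum>k<K. if k = snd z then f (fst z) k else 0)"
      using z by (intro sum.cong) (auto simp: indicator_def mem_Times_iff)
    then show "f (fst z) (snd z) = (\<Sum>k<K. indicator (X \<times> {k}) z * f (fst z) k)" using z by simp
  qed
  also have "\<dots> = (\<Sum>k<K. \<integral>z. indicator (X \<times> {k}) z * f (fst z) k \<partial>D)"
  proof (rule Bochner_Integration.integral_sum)
    fix k assume "k \<in> {..<K}"
    then have k: "k < K" by simp
    show "integrable D (\<lambda>z. indicator (X \<times> {k}) z * f (fst z) k)"
    proof (rule D.integrable_const_bound)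
      have fk: "(\<lambda>x. f x k) \<in> borel_measurable ?B"
        using f[OF k] measurable_cong_sets[OF sets_Dx refl] by blast
      show "(\<lambda>z. indicator (X \<times> {k}) z * f (fst z) k) \<in> borel_measurable D"
        using slice[OF k] measurable_compose[OF fst_D fk] by (intro borel_measurable_times) auto
      show "AE z in D. norm (indicator (X \<times> {k}) z * f (fst z) k) \<le> \<bar>b k\<bar>"
        using b k by (intro AE_I2) (fastforce simp: space_D indicator_def)
    qed
  qed
  also have "\<dots> = (\<Sum>k<K. \<integral>x. Pstar x k * f x k \<partial>?Dx)"
    by (intro sum.cong refl slice_eq) simp
  also have "\<dots> = (\<integral>x. (\<Sum>k<K. Pstar x k * f x k) \<partial>?Dx)"
    using f_int by (intro Bochner_Integration.integral_sum[symmetric]) auto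
  finally show ?thesis .
qed

section \<open>Regret of logits and comparison of decisions\<close>

context decision_problem
begin

text \<open>The first argument is a distribution, the second one a vector of logits. Subtracting the
  optimal cost is what makes the quantity bounded in terms of \<open>G\<close> and
  \<open>\<mu>\<close>.\<close>

definition excess :: "rvec \<Rightarrow> rvec \<Rightarrow> real" where
  "excess p \<eta> = mean_cost K c p (wt (softmax K \<eta>)) - mean_cost K c p (wt p)"

lemma excess_eq: "excess p \<eta> = (\<Sum>k<K. p k * (c (wt (softmax K \<eta>)) k - c (wt p) k))"
  by (simp add: excess_def mean_cost_def right_diff_distrib sum_subtractf)

lemma weighted_sum_le:
  fixes g :: rvec
  assumes p: "p \<in> prob_simplex K" and g: "\<And>k. k < K \<Longrightarrow> \<bar>g k\<bar> \<le> x"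
  shows "\<bar>\<Sum>k<K. p k * g k\<bar> \<le> x"
proof -
  have "\<bar>\<Sum>k<K. p k * g k\<bar> \<le> (\<Sum>k<K. p k * x)"
    using p g by (intro order_trans[OF sum_abs] sum_mono) (auto simp: abs_mult prob_simplex_def intro!: mult_mono)
  also have "\<dots> = x" using p by (simp add: prob_simplex_def flip: sum_distrib_right)
  finally show ?thesis .
qed

lemma cost_bounded:
  assumes "p \<in> prob_simplex K" "q \<in> prob_simplex K" "k < K"
  shows "\<bar>c (wt p) k - c (wt q) k\<bar> \<le> 2 * G\<^sup>2 / \<mu>"
proof -
  have "0 \<le> G\<^sup>2 / \<mu>" using mu_pos by simp
  from mult_left_mono[OF simplex_l1_le[OF assms(1,2)] this] cost_l1_lipschitz[OF assms] show ?thesis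
    by (simp add: mult_ac)
qed

lemma excess_bounded: "p \<in> prob_simplex K \<Longrightarrow> \<bar>excess p \<eta>\<bar> \<le> 2 * G\<^sup>2 / \<mu>"
  unfolding excess_eq by (intro weighted_sum_le cost_bounded softmax_in_simplex K)

lemma excess_lipschitz:
  assumes p: "p \<in> prob_simplex K"
  shows "\<bar>excess p \<eta> - excess p \<eta>'\<bar> \<le> 8 * G\<^sup>2 / \<mu> * (\<Sum>k<K. \<bar>\<eta> k - \<eta>' k\<bar>)"
proof -
  have "excess p \<eta> - excess p \<eta>' = (\<Sum>k<K. p k * (c (wt (softmax K \<eta>)) k - c (wt (softmax K \<eta>')) k))"
    by (simp add: excess_def mean_cost_def right_diff_distrib sum_subtractf)
  also have "\<bar>\<dots>\<bar> \<le> 8 * G\<^sup>2 / \<mu> * (\<Sum>k<K. \<bar>\<eta> k - \<eta>' k\<bar>)"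
    by (intro weighted_sum_le p cost_softmax_lipschitz member_le_sum[where f="\<lambda>k. \<bar>\<eta> k - \<eta>' k\<bar>"]) auto
  finally show ?thesis .
qed

text \<open>Smoothness makes the regret quadratic in the distance to the optimal decision, and the
  triangle inequality passes through the decision of the pseudo labels \<open>\<eta>'\<close>. The
  first distance is left unexpanded for the minimality argument.\<close>

lemma excess_le:
  "excess (softmax K \<eta>) \<theta> \<le> L * (vnorm d (vdiff (wt (softmax K \<theta>)) (wt (softmax K \<eta>'))))\<^sup>2
    + 64 * L * G\<^sup>2 / \<mu>\<^sup>2 * (vnorm K (vdiff \<eta>' \<eta>))\<^sup>2"
proof -
  let ?w = "\<lambda>\<eta>. wt (softmax K \<eta>)"
  note simplex = softmax_in_simplex[OF K]
  have "excess (softmax K \<eta>) \<theta> \<le> L / 2 * (vnorm d (vdiff (?w \<theta>) (?w \<eta>)))\<^sup>2"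
    using mean_cost_growth(2)[OF simplex wt_Rvec[OF simplex], of \<eta> \<theta>] by (simp add: excess_def)
  also have "\<dots> \<le> L / 2 * (2 * (vnorm d (vdiff (?w \<theta>) (?w \<eta>')))\<^sup>2 + 2 * (vnorm d (vdiff (?w \<eta>') (?w \<eta>)))\<^sup>2)"
    using L_pos by (intro mult_left_mono vnorm_sq_triangle) auto
  also have "\<dots> = L * (vnorm d (vdiff (?w \<theta>) (?w \<eta>')))\<^sup>2 + L * (vnorm d (vdiff (?w \<eta>') (?w \<eta>)))\<^sup>2"
    by (simp add: algebra_simps)
  also have "L * (vnorm d (vdiff (?w \<eta>') (?w \<eta>)))\<^sup>2 \<le> L * (64 * G\<^sup>2 / \<mu>\<^sup>2 * (vnorm K (vdiff \<eta>' \<eta>))\<^sup>2)"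
    using L_pos by (intro mult_left_mono wt_softmax_lipschitz) auto
  finally show ?thesis by (simp add: mult_ac)
qed

text \<open>Strong convexity turns the regret under the pseudo labels into a squared distance,
  minimality replaces \<open>\<theta>\<close> by \<open>\<theta>0\<close>, and smoothness bounds the
  regret of \<open>\<theta>0\<close>. The factors \<open>2 / \<mu>\<close>, \<open>L / 2\<close> and
  \<open>64 * G\<^sup>2 / \<mu>\<^sup>2\<close> multiply to the constant.\<close>

lemma erm_distance:
  fixes \<theta> \<theta>0 \<eta>' :: "nat \<Rightarrow> rvec"
  assumes erm: "(\<Sum>j<N. mean_cost K c (softmax K (\<eta>' j)) (wt (softmax K (\<theta> j))))
    \<le> (\<Sum>j<N. mean_cost K c (softmax K (\<eta>' j)) (wt (softmax K (\<theta>0 j))))"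
  shows "(\<Sum>j<N. (vnorm d (vdiff (wt (softmax K (\<theta> j))) (wt (softmax K (\<eta>' j)))))\<^sup>2)
    \<le> (\<Sum>j<N. 64 * L * G\<^sup>2 / \<mu> ^ 3 * (vnorm K (vdiff (\<theta>0 j) (\<eta>' j)))\<^sup>2)"
proof -
  let ?F = "\<lambda>j. mean_cost K c (softmax K (\<eta>' j))" and ?w = "\<lambda>\<eta>. wt (softmax K \<eta>)"
  note simplex = softmax_in_simplex[OF K]
  have "\<mu> / 2 * (\<Sum>j<N. (vnorm d (vdiff (?w (\<theta> j)) (?w (\<eta>' j))))\<^sup>2)
      \<le> (\<Sum>j<N. ?F j (?w (\<theta> j)) - ?F j (?w (\<eta>' j)))"
    unfolding sum_distrib_left
  proof (intro sum_mono)
    show "\<mu> / 2 * (vnorm d (vdiff (?w (\<theta> j)) (?w (\<eta>' j))))\<^sup>2 \<le> ?F j (?w (\<theta> j)) - ?F j (?w (\<eta>' j))" for j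
      using mean_cost_growth(1)[OF simplex wt_Rvec[OF simplex], of "\<eta>' j" "\<theta> j"] by simp
  qed
  also have "\<dots> \<le> (\<Sum>j<N. ?F j (?w (\<theta>0 j)) - ?F j (?w (\<eta>' j)))"
    using erm by (simp add: sum_subtractf)
  also have "\<dots> \<le> (\<Sum>j<N. L / 2 * (64 * G\<^sup>2 / \<mu>\<^sup>2 * (vnorm K (vdiff (\<theta>0 j) (\<eta>' j)))\<^sup>2))"
  proof (intro sum_mono)
    fix j
    have "?F j (?w (\<theta>0 j)) - ?F j (?w (\<eta>' j)) \<le> L / 2 * (vnorm d (vdiff (?w (\<theta>0 j)) (?w (\<eta>' j))))\<^sup>2"
      using mean_cost_growth(2)[OF simplex wt_Rvec[OF simplex], of "\<eta>' j" "\<theta>0 j"] by simp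
    also have "\<dots> \<le> L / 2 * (64 * G\<^sup>2 / \<mu>\<^sup>2 * (vnorm K (vdiff (\<theta>0 j) (\<eta>' j)))\<^sup>2)"
      using L_pos by (intro mult_left_mono wt_softmax_lipschitz) auto
    finally show "?F j (?w (\<theta>0 j)) - ?F j (?w (\<eta>' j))
        \<le> L / 2 * (64 * G\<^sup>2 / \<mu>\<^sup>2 * (vnorm K (vdiff (\<theta>0 j) (\<eta>' j)))\<^sup>2)" .
  qed
  also have "\<dots> = \<mu> / 2 * (\<Sum>j<N. 64 * L * G\<^sup>2 / \<mu> ^ 3 * (vnorm K (vdiff (\<theta>0 j) (\<eta>' j)))\<^sup>2)"
    unfolding sum_distrib_left using mu_pos
    by (intro sum.cong refl) (simp add: power2_eq_square power3_eq_cube field_simps)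
  finally show ?thesis using mu_pos by simp
qed

lemma mean_excess_le:
  fixes \<theta> \<theta>0 \<eta> \<eta>' :: "nat \<Rightarrow> rvec"
  assumes erm: "(\<Sum>j<N. mean_cost K c (softmax K (\<eta>' j)) (wt (softmax K (\<theta> j))))
    \<le> (\<Sum>j<N. mean_cost K c (softmax K (\<eta>' j)) (wt (softmax K (\<theta>0 j))))"
  shows "(\<Sum>j<N. excess (softmax K (\<eta> j)) (\<theta> j))
    \<le> (\<Sum>j<N. 64 * L\<^sup>2 * G\<^sup>2 / \<mu> ^ 3 * (vnorm K (vdiff (\<theta>0 j) (\<eta>' j)))\<^sup>2
      + 64 * L * G\<^sup>2 / \<mu>\<^sup>2 * (vnorm K (vdiff (\<eta>' j) (\<eta> j)))\<^sup>2)"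
proof -
  let ?w = "\<lambda>\<eta>. wt (softmax K \<eta>)"
  have "(\<Sum>j<N. excess (softmax K (\<eta> j)) (\<theta> j))
    \<le> (\<Sum>j<N. L * (vnorm d (vdiff (?w (\<theta> j)) (?w (\<eta>' j))))\<^sup>2
      + 64 * L * G\<^sup>2 / \<mu>\<^sup>2 * (vnorm K (vdiff (\<eta>' j) (\<eta> j)))\<^sup>2)"
    by (intro sum_mono excess_le)
  also have "\<dots> = L * (\<Sum>j<N. (vnorm d (vdiff (?w (\<theta> j)) (?w (\<eta>' j))))\<^sup>2)
      + (\<Sum>j<N. 64 * L * G\<^sup>2 / \<mu>\<^sup>2 * (vnorm K (vdiff (\<eta>' j) (\<eta> j)))\<^sup>2)"
    by (simp add: sum.distrib sum_distrib_left)
  also have "\<dots> \<le> L * (\<Sum>j<N. 64 * L * G\<^sup>2 / \<mu> ^ 3 * (vnorm K (vdiff (\<theta>0 j) (\<eta>' j)))\<^sup>2)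
      + (\<Sum>j<N. 64 * L * G\<^sup>2 / \<mu>\<^sup>2 * (vnorm K (vdiff (\<eta>' j) (\<eta> j)))\<^sup>2)"
    using L_pos by (intro add_right_mono mult_left_mono erm_distance[OF erm]) auto
  also have "\<dots> = (\<Sum>j<N. 64 * L\<^sup>2 * G\<^sup>2 / \<mu> ^ 3 * (vnorm K (vdiff (\<theta>0 j) (\<eta>' j)))\<^sup>2
      + 64 * L * G\<^sup>2 / \<mu>\<^sup>2 * (vnorm K (vdiff (\<eta>' j) (\<eta> j)))\<^sup>2)"
    by (simp add: sum.distrib sum_distrib_left power2_eq_square mult_ac)
  finally show ?thesis .
qed

end

section \<open>Dependence of the errors on the weak parameter\<close>

lemma continuous_on_entry: "continuous_on UNIV (\<lambda>A :: rmat. A i j)"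
  using continuous_on_product_then_coordinatewise[OF continuous_on_product_coordinates[of i]] .

lemma fit_error_nonneg: "0 \<le> fit_error M m K f h \<Theta>"
  by (simp add: fit_error_def)

text \<open>Expanding the square gives a quadratic polynomial in the entries of \<open>A\<close>,
  whose coefficients are moments of the features.\<close>

lemma fit_error_continuous:
  assumes s: "\<And>i. i < m \<Longrightarrow> sq_integrable M (\<lambda>x. \<phi>s x i)"
    and w: "\<And>i. i < m \<Longrightarrow> sq_integrable M (\<lambda>x. \<phi>w x i)"
  shows "continuous_on UNIV (\<lambda>A. fit_error M m K \<phi>s (\<lambda>x. tmulv m A (\<phi>w x)) \<Theta>)"
proof -
  define P where "P A k = (\<integral>x. (tmulv m \<Theta> (\<phi>s x) k)\<^sup>2 \<partial>M)
      - 2 * (\<Sum>i<m. \<Sum>j<m. \<Theta> i k * cross_moment M \<phi>s \<phi>w i j * A j k)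
      + (\<Sum>i<m. \<Sum>j<m. A i k * cross_moment M \<phi>w \<phi>w i j * A j k)" for A :: rmat and k
  have "(\<integral>x. (tmulv m \<Theta> (\<phi>s x) k - tmulv m A (\<phi>w x) k)\<^sup>2 \<partial>M) = P A k" for A k
  proof -
    have sq: "sq_integrable M (\<lambda>x. tmulv m \<Theta> (\<phi>s x) k)" "sq_integrable M (\<lambda>x. tmulv m A (\<phi>w x) k)"
      using s w by (auto intro: sq_integrable_tmulv)
    have "(\<integral>x. (tmulv m \<Theta> (\<phi>s x) k - tmulv m A (\<phi>w x) k)\<^sup>2 \<partial>M)
      = (\<integral>x. (tmulv m \<Theta> (\<phi>s x) k)\<^sup>2 - 2 * (tmulv m \<Theta> (\<phi>s x) k * tmulv m A (\<phi>w x) k)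
          + tmulv m A (\<phi>w x) k * tmulv m A (\<phi>w x) k \<partial>M)"
      by (intro Bochner_Integration.integral_cong refl) (simp add: power2_eq_square algebra_simps)
    also have "\<dots> = (\<integral>x. (tmulv m \<Theta> (\<phi>s x) k)\<^sup>2 \<partial>M)
        - 2 * (\<integral>x. tmulv m \<Theta> (\<phi>s x) k * tmulv m A (\<phi>w x) k \<partial>M)
        + (\<integral>x. tmulv m A (\<phi>w x) k * tmulv m A (\<phi>w x) k \<partial>M)"
      using sq by (simp add: sq_integrable_sq sq_integrable_mult)
    also have "(\<integral>x. tmulv m \<Theta> (\<phi>s x) k * tmulv m A (\<phi>w x) k \<partial>M)
        = (\<Sum>i<m. \<Sum>j<m. \<Theta> i k * cross_moment M \<phi>s \<phi>w i j * A j k)"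
      unfolding tmulv_def by (rule integral_bilinear[OF s w])
    also have "(\<integral>x. tmulv m A (\<phi>w x) k * tmulv m A (\<phi>w x) k \<partial>M)
        = (\<Sum>i<m. \<Sum>j<m. A i k * cross_moment M \<phi>w \<phi>w i j * A j k)"
      unfolding tmulv_def by (rule integral_bilinear[OF w w])
    finally show ?thesis by (simp add: P_def)
  qed
  then have "(\<lambda>A. fit_error M m K \<phi>s (\<lambda>x. tmulv m A (\<phi>w x)) \<Theta>) = (\<lambda>A. \<Sum>k<K. P A k)"
    using s w by (simp add: fit_error_eq sq_integrable_tmulv)
  then show ?thesis
    unfolding P_def by (simp only:) (intro continuous_intros continuous_on_entry)
qed

lemma zero_in_fro_ball: "0 \<le> B \<Longrightarrow> (\<lambda>_ _. 0) \<in> fro_ball m K B"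
  by (simp add: fro_ball_def Rmat_def fnorm_def)

lemma fit_error_bdd_below: "bdd_below (fit_error M m K f h ` A)"
  by (rule bdd_belowI[of _ 0]) (auto simp: fit_error_nonneg)

lemma rho_sw_nonneg: "0 \<le> B \<Longrightarrow> 0 \<le> rho_sw M m K B \<phi>s \<phi>w A"
  unfolding rho_sw_def using zero_in_fro_ball by (intro cINF_greatest) (auto simp: fit_error_nonneg)

text \<open>The infimum ranges over uncountably many continuous functions, but each of its strict
  sublevel sets is a union of open sets and hence open.\<close>

lemma rho_sw_measurable:
  assumes "0 \<le> B" and s: "\<And>i. i < m \<Longrightarrow> sq_integrable M (\<lambda>x. \<phi>s x i)"
    and w: "\<And>i. i < m \<Longrightarrow> sq_integrable M (\<lambda>x. \<phi>w x i)"
  shows "rho_sw M m K B \<phi>s \<phi>w \<in> borel_measurable borel"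
  unfolding borel_measurable_iff_less
proof
  fix a
  let ?f = "\<lambda>A. fit_error M m K \<phi>s (\<lambda>x. tmulv m A (\<phi>w x))"
  have "{A. rho_sw M m K B \<phi>s \<phi>w A < a} = (\<Union>\<Theta>\<in>fro_ball m K B. {A. ?f A \<Theta> < a})"
    unfolding rho_sw_def using zero_in_fro_ball[OF assms(1), of m K]
    by (subst cINF_less_iff) (auto simp: fit_error_bdd_below)
  moreover have "open {A. ?f A \<Theta> < a}" for \<Theta>
    by (intro open_Collect_less fit_error_continuous s w continuous_on_const)
  ultimately have "open {A. rho_sw M m K B \<phi>s \<phi>w A < a}" by auto
  from borel_open[OF this] show "{A \<in> space borel. rho_sw M m K B \<phi>s \<phi>w A < a} \<in> sets borel"
    by simp
qed

text \<open>The competitor zero gives the bound. Together with the almost sure bound on the weak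
  estimator it yields integrability over the labeled sample.\<close>

lemma rho_sw_le:
  assumes B: "0 \<le> B" and s: "\<And>i. i < m \<Longrightarrow> sq_integrable M (\<lambda>x. \<phi>s x i)"
    and w: "\<And>i. i < m \<Longrightarrow> sq_integrable M (\<lambda>x. \<phi>w x i)"
  shows "rho_sw M m K B \<phi>s \<phi>w A \<le> (fnorm m K A)\<^sup>2 * (\<integral>x. (\<Sum>i<m. (\<phi>w x i)\<^sup>2) \<partial>M)"
proof -
  have "rho_sw M m K B \<phi>s \<phi>w A \<le> fit_error M m K \<phi>s (\<lambda>x. tmulv m A (\<phi>w x)) (\<lambda>_ _. 0)"
    unfolding rho_sw_def by (intro cINF_lower fit_error_bdd_below zero_in_fro_ball B)
  also have "\<dots> = (\<Sum>k<K. \<integral>x. (tmulv m A (\<phi>w x) k)\<^sup>2 \<partial>M)"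
    using s w by (simp add: fit_error_eq sq_integrable_tmulv) (simp add: tmulv_def)
  also have "\<dots> \<le> (\<Sum>k<K. \<integral>x. (\<Sum>i<m. (A i k)\<^sup>2) * (\<Sum>i<m. (\<phi>w x i)\<^sup>2) \<partial>M)"
  proof (intro sum_mono integral_mono)
    show "integrable M (\<lambda>x. (tmulv m A (\<phi>w x) k)\<^sup>2)" for k
      by (intro sq_integrable_sq sq_integrable_tmulv w)
    show "integrable M (\<lambda>x. (\<Sum>i<m. (A i k)\<^sup>2) * (\<Sum>i<m. (\<phi>w x i)\<^sup>2))" for k
      using w by (intro integrable_mult_right Bochner_Integration.integrable_sum sq_integrable_sq) auto
    show "(tmulv m A (\<phi>w x) k)\<^sup>2 \<le> (\<Sum>i<m. (A i k)\<^sup>2) * (\<Sum>i<m. (\<phi>w x i)\<^sup>2)" for x k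
      unfolding tmulv_def by (rule Cauchy_Schwarz_ineq_sum)
  qed
  also have "\<dots> = (\<Sum>k<K. \<Sum>i<m. (A i k)\<^sup>2) * (\<integral>x. (\<Sum>i<m. (\<phi>w x i)\<^sup>2) \<partial>M)"
    by (simp only: integral_mult_right_zero sum_distrib_right[symmetric])
  also have "(\<Sum>k<K. \<Sum>i<m. (A i k)\<^sup>2) = (fnorm m K A)\<^sup>2"
    unfolding fnorm_def by (subst sum.swap) (simp add: sum_nonneg)
  finally show ?thesis .
qed

lemma fnorm_mdiff_measurable: "(\<lambda>A. fnorm m K (mdiff A W)) \<in> borel_measurable borel"
  unfolding fnorm_def mdiff_def
  by (intro borel_measurable_continuous_onI continuous_intros continuous_on_entry)

lemma fnorm_mdiff_le: "(fnorm m K (mdiff A W))\<^sup>2 \<le> 2 * (fnorm m K A)\<^sup>2 + 2 * (fnorm m K W)\<^sup>2"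
proof -
  have "(a - b)\<^sup>2 \<le> 2 * a\<^sup>2 + 2 * b\<^sup>2" for a b :: real
    using zero_le_power2[of "a + b"] unfolding power2_diff power2_sum by linarith
  then have "(\<Sum>i<m. \<Sum>j<K. (mdiff A W i j)\<^sup>2) \<le> (\<Sum>i<m. \<Sum>j<K. 2 * (A i j)\<^sup>2 + 2 * (W i j)\<^sup>2)"
    unfolding mdiff_def by (intro sum_mono)
  then show ?thesis
    by (simp add: fnorm_def sum_nonneg sum.distrib flip: sum_distrib_left)
qed

section \<open>Expectation over the unlabeled sample, for a fixed weak parameter
  \<open>A\<close>\<close>

locale w2s = decision_problem d K c gc Hc wt \<mu> L G
  for d K :: nat and c gc Hc wt and \<mu> L G :: real +
  fixes Dx :: "rvec measure" and m ds dw N :: nat and \<phi>s \<phi>w \<eta> :: "rvec \<Rightarrow> rvec"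
    and Vs Vw :: rmat and lams lamw :: rvec and B :: real
  assumes prob_Dx: "prob_space Dx"
    and \<phi>s: "\<And>i. i < m \<Longrightarrow> sq_integrable Dx (\<lambda>x. \<phi>s x i)"
    and \<phi>w: "\<And>i. i < m \<Longrightarrow> sq_integrable Dx (\<lambda>x. \<phi>w x i)"
    and \<eta>: "\<And>k. k < K \<Longrightarrow> sq_integrable Dx (\<lambda>x. \<eta> x k)"
    and \<eta>_measurable: "\<eta> \<in> borel_measurable Dx"
    and Ss: "reduced_spectral m ds Vs lams (cross_moment Dx \<phi>s \<phi>s)"
    and Sw: "reduced_spectral m dw Vw lamw (cross_moment Dx \<phi>w \<phi>w)"
    and N: "1 \<le> N" and B: "0 < B"
begin

sublocale prob_space Dx by (rule prob_Dx)

definition h :: "rmat \<Rightarrow> rvec \<Rightarrow> real" where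
  "h \<Theta> x = excess (softmax K (\<eta> x)) (tmulv m \<Theta> (\<phi>s x))"

lemma tmulv_measurable: "(\<lambda>x. tmulv m \<Theta> (\<phi>s x)) \<in> borel_measurable Dx"
proof (rule measurable_coordinatewise_then_product)
  fix k show "(\<lambda>x. tmulv m \<Theta> (\<phi>s x) k) \<in> borel_measurable Dx"
    using sq_integrable_tmulv[OF \<phi>s, where A=\<Theta> and k=k] by (simp add: sq_integrable_def)
qed

lemma cost_measurable:
  assumes "f \<in> borel_measurable Dx" "k < K"
  shows "(\<lambda>x. c (wt (softmax K (f x))) k) \<in> borel_measurable Dx"
  by (rule measurable_compose[OF assms(1) borel_measurable_continuous_onI[OF cost_softmax_continuous[OF assms(2)]]])

lemma softmax_measurable: "k < K \<Longrightarrow> (\<lambda>x. softmax K (\<eta> x) k) \<in> borel_measurable Dx"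
  unfolding softmax_def using measurable_compose[OF \<eta>_measurable measurable_product_coordinates] by simp

lemma h_measurable: "h \<Theta> \<in> borel_measurable Dx"
  unfolding h_def excess_eq
  by (intro borel_measurable_sum borel_measurable_times borel_measurable_diff cost_measurable
      softmax_measurable tmulv_measurable \<eta>_measurable) auto

lemma h_bounded: "\<bar>h \<Theta> x\<bar> \<le> 2 * G\<^sup>2 / \<mu>"
  unfolding h_def by (intro excess_bounded softmax_in_simplex K)

text \<open>\<open>W\<close> attains the weak approximation error; on the strong side the bound
  holds for every centered \<open>S\<close>, and the infimum is taken.\<close>

lemma weak_error_le:
  assumes W: "W \<in> centered_mats m K" and min: "is_arg_min (fit_error Dx m K \<phi>w \<eta>) (\<lambda>\<Theta>. \<Theta> \<in> centered_mats m K) W"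
  shows "fit_error Dx m K \<phi>w \<eta> A \<le> 15 * (fit_error Dx m K \<phi>s (\<lambda>x. tmulv m A (\<phi>w x)) \<Theta>
    + approx_error Dx m K \<phi>w \<eta> + approx_error Dx m K \<phi>s \<eta>
    + Max (lamw ` {..<dw}) * (fnorm m K (mdiff A W))\<^sup>2 * corr_dim m Dx \<phi>s \<phi>w ds Vs lams dw Vw lamw)"
proof -
  let ?D = "Max (lamw ` {..<dw}) * (fnorm m K (mdiff A W))\<^sup>2 * corr_dim m Dx \<phi>s \<phi>w ds Vs lams dw Vw lamw"
  have "fit_error Dx m K \<phi>w \<eta> W \<le> approx_error Dx m K \<phi>w \<eta>"
    unfolding approx_error_def using W min
    by (intro cINF_greatest) (auto simp: is_arg_min_def not_less)
  then have "fit_error Dx m K \<phi>w \<eta> A \<le> 15 * (fit_error Dx m K \<phi>s (\<lambda>x. tmulv m A (\<phi>w x)) \<Theta>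
      + approx_error Dx m K \<phi>w \<eta> + ?D) + 15 * fit_error Dx m K \<phi>s \<eta> S" for S
    using weak_fit_error_le[where K=K and \<eta>=\<eta> and A=A and \<Theta>=\<Theta> and W=W and S=S, OF \<phi>s \<phi>w \<eta> Ss Sw] by simp
  then have "fit_error Dx m K \<phi>w \<eta> A \<le> 15 * (fit_error Dx m K \<phi>s (\<lambda>x. tmulv m A (\<phi>w x)) \<Theta>
      + approx_error Dx m K \<phi>w \<eta> + ?D) + 15 * approx_error Dx m K \<phi>s \<eta>"
    unfolding approx_error_def[of _ _ _ \<phi>s] using W by (intro le_cINF_affine) auto
  then show ?thesis by simp
qed

text \<open>\<open>uniform_deviation\<close> with the population regret as \<open>r\<close> and a
  sample mean of \<open>q\<close> as remainder. Since \<open>\<Theta>\<close> and \<open>A\<close>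
  do not depend on \<open>xs\<close>, this sample mean integrates to the two population errors. The
  factor \<open>16\<close> is twice the Lipschitz constant \<open>8\<close>.\<close>

lemma mean_excess_bound:
  fixes \<Theta>hat :: "(nat \<Rightarrow> rvec) \<Rightarrow> rmat"
  assumes arg_min: "\<And>xs. xs \<in> space (PiM {..<N} (\<lambda>_. Dx)) \<Longrightarrow>
      is_arg_min (w2s_objective m K c wt \<phi>s \<phi>w N xs A) (\<lambda>\<Theta>. \<Theta> \<in> fro_ball m K B) (\<Theta>hat xs)"
    and int: "integrable (PiM {..<N} (\<lambda>_. Dx)) (\<lambda>xs. \<integral>x. h (\<Theta>hat xs) x \<partial>Dx)"
    and \<Theta>: "\<Theta> \<in> fro_ball m K B"
  shows "(\<integral>xs. (\<integral>x. h (\<Theta>hat xs) x \<partial>Dx) \<partial>PiM {..<N} (\<lambda>_. Dx))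
    \<le> 64 * L\<^sup>2 * G\<^sup>2 / \<mu> ^ 3 * fit_error Dx m K \<phi>s (\<lambda>x. tmulv m A (\<phi>w x)) \<Theta>
      + 64 * L * G\<^sup>2 / \<mu>\<^sup>2 * fit_error Dx m K \<phi>w \<eta> A
      + 16 * G\<^sup>2 / \<mu> * real K * B * sqrt (mtrace m (cross_moment Dx \<phi>s \<phi>s)) / sqrt (real N)"
proof -
  let ?P = "PiM {..<N} (\<lambda>_. Dx)"
  let ?\<alpha> = "64 * L\<^sup>2 * G\<^sup>2 / \<mu> ^ 3" and ?\<beta> = "64 * L * G\<^sup>2 / \<mu>\<^sup>2"
  define q where "q x = ?\<alpha> * (vnorm K (vdiff (tmulv m \<Theta> (\<phi>s x)) (tmulv m A (\<phi>w x))))\<^sup>2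
      + ?\<beta> * (vnorm K (vdiff (tmulv m A (\<phi>w x)) (\<eta> x)))\<^sup>2" for x
  have sq: "integrable Dx (\<lambda>x. (vnorm K (vdiff (f x) (g x)))\<^sup>2)"
    if "\<And>k. k < K \<Longrightarrow> sq_integrable Dx (\<lambda>x. f x k)" "\<And>k. k < K \<Longrightarrow> sq_integrable Dx (\<lambda>x. g x k)" for f g
    unfolding vnorm_sq vdiff_def using that
    by (intro Bochner_Integration.integrable_sum sq_integrable_sq sq_integrable_diff) auto
  have int1: "integrable Dx (\<lambda>x. (vnorm K (vdiff (tmulv m \<Theta> (\<phi>s x)) (tmulv m A (\<phi>w x))))\<^sup>2)"
    by (intro sq sq_integrable_tmulv \<phi>s \<phi>w)
  have int2: "integrable Dx (\<lambda>x. (vnorm K (vdiff (tmulv m A (\<phi>w x)) (\<eta> x)))\<^sup>2)"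
    by (intro sq sq_integrable_tmulv \<phi>w \<eta>)
  have int_q: "integrable Dx q" unfolding q_def using int1 int2 by simp
  have q_eq: "(\<integral>x. q x \<partial>Dx) = ?\<alpha> * fit_error Dx m K \<phi>s (\<lambda>x. tmulv m A (\<phi>w x)) \<Theta> + ?\<beta> * fit_error Dx m K \<phi>w \<eta> A"
    unfolding q_def fit_error_def using int1 int2 by simp
  have comp: "integrable ?P (\<lambda>xs. q (xs j))" "(\<integral>xs. q (xs j) \<partial>?P) = (\<integral>x. q x \<partial>Dx)" if "j < N" for j
    using integral_PiM_component[OF prob_Dx _ int_q, of j "{..<N}"] that by auto
  have tr: "mtrace m (cross_moment Dx \<phi>s \<phi>s) = (\<integral>x. (\<Sum>i<m. (\<phi>s x i)\<^sup>2) \<partial>Dx)"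
    unfolding mtrace_def cross_moment_def
    by (subst Bochner_Integration.integral_sum) (auto simp: power2_eq_square intro: sq_integrable_mult \<phi>s)
  have "(\<integral>xs. (\<integral>x. h (\<Theta>hat xs) x \<partial>Dx) \<partial>?P) \<le> (\<integral>xs. (\<Sum>j<N. q (xs j)) / real N \<partial>?P)
    + 2 * (8 * G\<^sup>2 / \<mu>) * real K * B * sqrt (\<integral>x. (\<Sum>i<m. (\<phi>s x i)\<^sup>2) \<partial>Dx) / sqrt (real N)"
  proof (rule uniform_deviation[where h=h and b="2 * G\<^sup>2 / \<mu>" and \<Theta>hat=\<Theta>hat])
    show "\<bar>h \<Theta> x - h \<Theta>' x\<bar> \<le> 8 * G\<^sup>2 / \<mu> * (\<Sum>k<K. \<bar>tmulv m \<Theta> (\<phi>s x) k - tmulv m \<Theta>' (\<phi>s x) k\<bar>)" for \<Theta> \<Theta>' x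
      unfolding h_def by (intro excess_lipschitz softmax_in_simplex K)
    show "integrable ?P (\<lambda>xs. (\<Sum>j<N. q (xs j)) / real N)"
      using comp(1) by (intro integrable_divide_zero Bochner_Integration.integrable_sum) auto
    show "0 \<le> 8 * G\<^sup>2 / \<mu>" using mu_pos by simp
    fix xs assume xs: "xs \<in> space ?P"
    note am = arg_min[OF xs]
    then show "\<Theta>hat xs \<in> fro_ball m K B" by (simp add: is_arg_min_def)
    have "w2s_objective m K c wt \<phi>s \<phi>w N xs A (\<Theta>hat xs) \<le> w2s_objective m K c wt \<phi>s \<phi>w N xs A \<Theta>"
      using am \<Theta> by (auto simp: is_arg_min_def not_less)
    then have "(\<Sum>j<N. h (\<Theta>hat xs) (xs j)) \<le> (\<Sum>j<N. q (xs j))"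
      unfolding h_def q_def using N
      by (intro mean_excess_le) (simp add: w2s_objective_def policy_def divide_le_cancel)
    then have "(\<Sum>j<N. h (\<Theta>hat xs) (xs j)) / real N \<le> (\<Sum>j<N. q (xs j)) / real N"
      by (rule divide_right_mono) simp
    then show "(\<integral>x. h (\<Theta>hat xs) x \<partial>Dx) \<le> (\<integral>x. h (\<Theta>hat xs) x \<partial>Dx)
        - (\<Sum>j<N. h (\<Theta>hat xs) (xs j)) / real N + (\<Sum>j<N. q (xs j)) / real N"
      by simp
  qed (use N B K h_bounded h_measurable int \<phi>s in \<open>auto intro: sq_integrable_integrable sq_integrable_sq\<close>)
  also have "(\<integral>xs. (\<Sum>j<N. q (xs j)) / real N \<partial>?P) = (\<integral>x. q x \<partial>Dx)"
  proof -
    have "(\<integral>xs. (\<Sum>j<N. q (xs j)) \<partial>?P) = (\<Sum>j<N. \<integral>xs. q (xs j) \<partial>?P)"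
      using comp(1) by (intro Bochner_Integration.integral_sum) auto
    then show ?thesis using comp(2) N by simp
  qed
  finally show ?thesis unfolding q_eq tr by (simp add: mult_ac)
qed

text \<open>The preceding bound holds for every competitor with the same left side, so its infimum
  may be taken. Inserting \<open>weak_error_le\<close> produces
  \<open>64 * 15 = 960\<close>.\<close>

lemma sample_bound:
  fixes \<Theta>hat :: "(nat \<Rightarrow> rvec) \<Rightarrow> rmat"
  assumes arg_min: "\<And>xs. xs \<in> space (PiM {..<N} (\<lambda>_. Dx)) \<Longrightarrow>
      is_arg_min (w2s_objective m K c wt \<phi>s \<phi>w N xs A) (\<lambda>\<Theta>. \<Theta> \<in> fro_ball m K B) (\<Theta>hat xs)"
    and int: "integrable (PiM {..<N} (\<lambda>_. Dx)) (\<lambda>xs. \<integral>x. h (\<Theta>hat xs) x \<partial>Dx)"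
    and W: "is_arg_min (fit_error Dx m K \<phi>w \<eta>) (\<lambda>\<Theta>. \<Theta> \<in> centered_mats m K) W"
  shows "(\<integral>xs. (\<integral>x. h (\<Theta>hat xs) x \<partial>Dx) \<partial>PiM {..<N} (\<lambda>_. Dx))
    \<le> 960 * (L\<^sup>2 * G\<^sup>2 / \<mu> ^ 3 + L * G\<^sup>2 / \<mu>\<^sup>2) * rho_sw Dx m K B \<phi>s \<phi>w A
      + 960 * (L * G\<^sup>2 / \<mu>\<^sup>2) * (approx_error Dx m K \<phi>w \<eta> + approx_error Dx m K \<phi>s \<eta>
        + Max (lamw ` {..<dw}) * (fnorm m K (mdiff A W))\<^sup>2 * corr_dim m Dx \<phi>s \<phi>w ds Vs lams dw Vw lamw)
      + 16 * (L * G\<^sup>2 / \<mu>\<^sup>2) * real K * B * sqrt (mtrace m (cross_moment Dx \<phi>s \<phi>s)) / sqrt (real N)"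
proof -
  let ?I = "\<integral>xs. (\<integral>x. h (\<Theta>hat xs) x \<partial>Dx) \<partial>PiM {..<N} (\<lambda>_. Dx)"
  let ?f = "fit_error Dx m K \<phi>s (\<lambda>x. tmulv m A (\<phi>w x))"
  let ?R = "approx_error Dx m K \<phi>w \<eta> + approx_error Dx m K \<phi>s \<eta>
      + Max (lamw ` {..<dw}) * (fnorm m K (mdiff A W))\<^sup>2 * corr_dim m Dx \<phi>s \<phi>w ds Vs lams dw Vw lamw"
  define a where "a = L\<^sup>2 * G\<^sup>2 / \<mu> ^ 3"
  define b where "b = L * G\<^sup>2 / \<mu>\<^sup>2"
  define t where "t = real K * B * sqrt (mtrace m (cross_moment Dx \<phi>s \<phi>s)) / sqrt (real N)"
  have ab: "0 \<le> a" "0 \<le> b" using mu_pos L_pos by (auto simp: a_def b_def)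
  have W': "W \<in> centered_mats m K" using W by (simp add: is_arg_min_def)
  have "0 \<le> mtrace m (cross_moment Dx \<phi>s \<phi>s)"
    unfolding mtrace_def cross_moment_def by (intro sum_nonneg Bochner_Integration.integral_nonneg) auto
  then have t: "0 \<le> t" using B by (simp add: t_def)
  \<comment> \<open>The deviation term carries \<open>G\<^sup>2 / \<mu>\<close>;
    \<open>mu_le_L\<close> brings it to the common prefactor \<open>b\<close>.\<close>
  have "G\<^sup>2 / \<mu> = \<mu> * (G\<^sup>2 / \<mu>\<^sup>2)" using mu_pos by (simp add: power2_eq_square)
  also have "\<dots> \<le> L * (G\<^sup>2 / \<mu>\<^sup>2)" by (intro mult_right_mono mu_le_L) auto
  finally have "16 * (G\<^sup>2 / \<mu>) * t \<le> 16 * b * t" using t by (intro mult_right_mono) (auto simp: b_def)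
  then have t_le: "16 * G\<^sup>2 / \<mu> * real K * B * sqrt (mtrace m (cross_moment Dx \<phi>s \<phi>s)) / sqrt (real N) \<le> 16 * b * t"
    by (simp add: t_def mult_ac)
  have "?I \<le> (960 * b * ?R + 16 * b * t) + 960 * (a + b) * ?f \<Theta>" if \<Theta>: "\<Theta> \<in> fro_ball m K B" for \<Theta>
  proof -
    have "?I \<le> 64 * a * ?f \<Theta> + 64 * b * fit_error Dx m K \<phi>w \<eta> A + 16 * b * t"
      using mean_excess_bound[OF arg_min int \<Theta>] t_le by (simp add: a_def b_def mult_ac)
    also have "64 * b * fit_error Dx m K \<phi>w \<eta> A \<le> 64 * b * (15 * (?f \<Theta> + ?R))"
      using weak_error_le[OF W' W, of A \<Theta>] ab by (intro mult_left_mono) (auto simp: add_ac)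
    finally have "?I \<le> 64 * a * ?f \<Theta> + 960 * b * ?f \<Theta> + 960 * b * ?R + 16 * b * t"
      by (simp add: distrib_left mult_ac)
    \<comment> \<open>Raising \<open>64\<close> to \<open>960\<close> gives both multiples of the
      fit error the joint factor \<open>a + b\<close>.\<close>
    moreover have "64 * a * ?f \<Theta> \<le> 960 * a * ?f \<Theta>"
      using ab fit_error_nonneg by (intro mult_right_mono) auto
    ultimately show ?thesis by (simp add: distrib_left distrib_right)
  qed
  then have "?I \<le> (960 * b * ?R + 16 * b * t) + 960 * (a + b) * rho_sw Dx m K B \<phi>s \<phi>w A"
    unfolding rho_sw_def using zero_in_fro_ball[of B] B ab by (intro le_cINF_affine) auto
  then show ?thesis by (simp add: a_def b_def t_def add_ac mult_ac)
qed

end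

context w2s
begin

text \<open>Conditioning on \<open>x\<close> replaces the scenario by the weights of the true
  softmax, so the difference of the two risks becomes a single integral of the regret under the
  marginal.\<close>

lemma excess_risk_eq:
  assumes D: "joint_law dx X K D" and Dx: "Dx = marginal X D" and P: "conditional_law X K D Pstar"
    and Pstar: "\<And>x. x \<in> X \<Longrightarrow> Pstar x = softmax K (\<eta> x)"
  shows "risk D c (policy m K wt \<phi>s \<Theta>) - risk D c (\<lambda>x. wt (Pstar x)) = (\<integral>x. h \<Theta> x \<partial>Dx)"
proof -
  note simplex = softmax_in_simplex[OF K]
  \<comment> \<open>\<open>integral_conditional\<close> asks for bounded integrands: the cost of any
    decision differs by at most \<open>2 * G\<^sup>2 / \<mu>\<close> from that of the decision for
    the uniform distribution.\<close>
  define b where "b k = \<bar>c (wt (softmax K (\<lambda>_. 0))) k\<bar> + 2 * G\<^sup>2 / \<mu>" for k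
  have space_Dx: "space Dx = X" by (simp add: Dx marginal_def space_restrict_space)
  have b: "\<bar>c (wt p) k\<bar> \<le> b k" if "p \<in> prob_simplex K" "k < K" for p k
    using cost_bounded[OF that(1) simplex[of "\<lambda>_. 0"] that(2)] by (simp add: b_def)
  have risk_eq: "risk D c (\<lambda>x. wt (softmax K (f x))) = (\<integral>x. mean_cost K c (softmax K (\<eta> x)) (wt (softmax K (f x))) \<partial>Dx)"
    if "f \<in> borel_measurable Dx" for f
  proof -
    have "risk D c (\<lambda>x. wt (softmax K (f x)))
        = (\<integral>x. (\<Sum>k<K. Pstar x k * c (wt (softmax K (f x))) k) \<partial>marginal X D)"
      unfolding risk_def using cost_measurable[OF that] b[OF simplex]
      by (intro integral_conditional[OF D P, where b=b]) (auto simp: Dx)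
    also have "\<dots> = (\<integral>x. mean_cost K c (softmax K (\<eta> x)) (wt (softmax K (f x))) \<partial>Dx)"
      unfolding Dx[symmetric] mean_cost_def
      by (intro Bochner_Integration.integral_cong refl) (simp add: space_Dx Pstar)
    finally show ?thesis .
  qed
  have "risk D c (\<lambda>x. wt (Pstar x)) = risk D c (\<lambda>x. wt (softmax K (\<eta> x)))"
    unfolding risk_def
  proof (intro Bochner_Integration.integral_cong refl)
    fix z assume "z \<in> space D"
    then have "fst z \<in> X"
      using D sets_eq_imp_space_eq[of D "restrict_space borel X \<Otimes>\<^sub>M count_space {..<K}"]
      by (auto simp: joint_law_def space_pair_measure space_restrict_space)
    then show "c (wt (Pstar (fst z))) (snd z) = c (wt (softmax K (\<eta> (fst z)))) (snd z)"
      by (simp add: Pstar)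
  qed
  moreover have int: "integrable Dx (\<lambda>x. mean_cost K c (softmax K (\<eta> x)) (wt (softmax K (f x))))"
    if "f \<in> borel_measurable Dx" for f
    unfolding mean_cost_def
  proof (intro Bochner_Integration.integrable_sum integrable_const_bound)
    fix k assume "k \<in> {..<K}"
    then have k: "k < K" by simp
    show "(\<lambda>x. softmax K (\<eta> x) k * c (wt (softmax K (f x))) k) \<in> borel_measurable Dx"
      by (intro borel_measurable_times softmax_measurable cost_measurable that k)
    have "\<bar>softmax K \<theta> k\<bar> \<le> 1" for \<theta>
    proof -
      have "softmax K \<theta> k \<le> (\<Sum>k<K. softmax K \<theta> k)"
        using simplex[of \<theta>] k by (intro member_le_sum) (auto simp: prob_simplex_def)
      then show ?thesis using simplex[of \<theta>] k by (auto simp: prob_simplex_def)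
    qed
    then show "AE x in Dx. norm (softmax K (\<eta> x) k * c (wt (softmax K (f x))) k) \<le> 1 * b k"
      unfolding real_norm_def abs_mult using b[OF simplex k] by (intro AE_I2 mult_mono) auto
  qed
  ultimately show ?thesis
    using risk_eq[OF tmulv_measurable] risk_eq[OF \<eta>_measurable]
      int[OF tmulv_measurable] int[OF \<eta>_measurable]
    by (simp add: policy_def h_def excess_def)
qed

end

section \<open>Integration over the labeled sample and the final bound\<close>

lemma borel_measurable_component:
  fixes f :: "'a \<Rightarrow> rvec"
  assumes "f \<in> M \<rightarrow>\<^sub>M restrict_space borel S"
  shows "(\<lambda>x. f x i) \<in> borel_measurable M"
proof -
  have "f \<in> borel_measurable M" using assms by (simp add: measurable_restrict_space2_iff)
  then show ?thesis by (rule measurable_compose[OF _ measurable_product_coordinates])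
qed

theorem theorem1:
  shows "\<exists>C0>0. \<exists>C>0.
    \<forall>(d::nat) (K::nat) (dx::nat) (m::nat) (ds::nat) (dw::nat) (n::nat) (N::nat)
      (X :: rvec set) (D :: (rvec \<times> nat) measure) (Dx :: rvec measure) (Pstar :: rvec \<Rightarrow> rvec)
      (c :: rvec \<Rightarrow> nat \<Rightarrow> real) (gc :: rvec \<Rightarrow> nat \<Rightarrow> rvec) (Hc :: rvec \<Rightarrow> nat \<Rightarrow> rmat)
      (wt :: rvec \<Rightarrow> rvec) (\<phi>s :: rvec \<Rightarrow> rvec) (\<phi>w :: rvec \<Rightarrow> rvec) (\<eta>star :: rvec \<Rightarrow> rvec)
      (Vs :: rmat) (lams :: rvec) (Vw :: rmat) (lamw :: rvec) (\<Theta>wstar :: rmat)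
      (\<Theta>w :: (nat \<Rightarrow> rvec \<times> nat) \<Rightarrow> rmat)
      (\<Theta>ls :: (nat \<Rightarrow> rvec \<times> nat) \<times> (nat \<Rightarrow> rvec) \<Rightarrow> rmat)
      (\<Theta>w2s :: (nat \<Rightarrow> rvec \<times> nat) \<times> (nat \<Rightarrow> rvec) \<Rightarrow> rmat)
      (\<mu>::real) (L::real) (G::real) (B::real) (Bw::real) (\<kappa>::real) (dsw::real).

      \<comment> \<open>decision problem, data, features\<close>
      1 \<le> d \<longrightarrow> 1 \<le> K \<longrightarrow> 1 \<le> n \<longrightarrow> 1 \<le> N \<longrightarrow> 0 < B \<longrightarrow>
      joint_law dx X K D \<longrightarrow>
      Dx = marginal X D \<longrightarrow>
      conditional_law X K D Pstar \<longrightarrow>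
      decision_rule d K c wt \<longrightarrow>
      \<phi>s \<in> restrict_space borel X \<rightarrow>\<^sub>M restrict_space borel (Rvec m) \<longrightarrow>
      \<phi>w \<in> restrict_space borel X \<rightarrow>\<^sub>M restrict_space borel (Rvec m) \<longrightarrow>
      reduced_spectral m ds Vs lams (cross_moment Dx \<phi>s \<phi>s) \<longrightarrow>
      reduced_spectral m dw Vw lamw (cross_moment Dx \<phi>w \<phi>w) \<longrightarrow>
      dsw = corr_dim m Dx \<phi>s \<phi>w ds Vs lams dw Vw lamw \<longrightarrow>
      is_arg_min (fit_error Dx m K \<phi>w \<eta>star) (\<lambda>\<Theta>. \<Theta> \<in> centered_mats m K) \<Theta>wstar \<longrightarrow>

      \<comment> \<open>estimators\<close>
      \<Theta>w \<in> labeled_data n D \<rightarrow>\<^sub>M restrict_space borel (Rmat m K) \<longrightarrow>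
      (AE bt in labeled_data n D. fnorm m K (\<Theta>w bt) \<le> Bw) \<longrightarrow>
      \<Theta>w2s \<in> all_data n N X D \<rightarrow>\<^sub>M restrict_space borel (Rmat m K) \<longrightarrow>
      (\<forall>(bt, xs) \<in> space (all_data n N X D).
         is_arg_min (w2s_objective m K c wt \<phi>s \<phi>w N xs (\<Theta>w bt))
           (\<lambda>\<Theta>. \<Theta> \<in> fro_ball m K B) (\<Theta>w2s (bt, xs))) \<longrightarrow>
      (\<forall>(bt, xs) \<in> space (all_data n N X D).
         is_arg_min (ls_objective m K \<phi>s \<phi>w N xs (\<Theta>w bt))
           (\<lambda>\<Theta>. \<Theta> \<in> Rmat m K) (\<Theta>ls (bt, xs))) \<longrightarrow>

      \<comment> \<open>realizability\<close>
      \<eta>star \<in> restrict_space borel X \<rightarrow>\<^sub>M restrict_space borel (Rvec K) \<longrightarrow>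
      (\<forall>x\<in>X. (\<forall>k<K. Pstar x k = softmax K (\<eta>star x) k) \<and> (\<Sum>k<K. \<eta>star x k) = 0) \<longrightarrow>
      integrable Dx (\<lambda>x. vnorm K (\<eta>star x) ^ 4) \<longrightarrow>
      \<comment> \<open>cost\<close>
      cost_assumption d K c gc Hc wt \<mu> L G \<longrightarrow>
      \<comment> \<open>norm bound for the least-squares estimator\<close>
      (AE \<omega> in all_data n N X D. fnorm m K (\<Theta>ls \<omega>) \<le> B) \<longrightarrow>
      \<comment> \<open>subgaussian features\<close>
      0 < \<kappa> \<longrightarrow> subgaussian Dx (2 * m) (\<lambda>x. stack m (\<phi>s x) (\<phi>w x)) \<kappa> \<longrightarrow>

      C0 * real ds \<le> real N \<longrightarrow>
      (\<integral>\<omega>. (risk D c (policy m K wt \<phi>s (\<Theta>w2s \<omega>)) - risk D c (\<lambda>x. wt (Pstar x)))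
          \<partial>all_data n N X D)
      \<le> C *
        ((L\<^sup>2 * real K * G\<^sup>2 / \<mu> ^ 3 + L * real K * G\<^sup>2 / \<mu>\<^sup>2) *
           ((\<integral>bt. rho_sw Dx m K B \<phi>s \<phi>w (\<Theta>w bt) \<partial>labeled_data n D)
            + Bw\<^sup>2 / sqrt (real N) * sqrt (\<integral>x. vnorm m (\<phi>w x) ^ 4 \<partial>Dx)
            + B\<^sup>2 / sqrt (real N) * sqrt (\<integral>x. vnorm m (\<phi>s x) ^ 4 \<partial>Dx)
            + B * Bw / sqrt (real N)
                * sqrt (\<integral>x. (vnorm m (\<phi>s x))\<^sup>2 * (vnorm m (\<phi>w x))\<^sup>2 \<partial>Dx))
         + L * real K * G\<^sup>2 / \<mu>\<^sup>2 *
           (1 / sqrt (real N) * sqrt (\<integral>x. vnorm K (\<eta>star x) ^ 4 \<partial>Dx)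
            + B * sqrt (mtrace m (cross_moment Dx \<phi>s \<phi>s)) / sqrt (real N)
            + B / sqrt (real N) * root 4 (\<integral>x. vnorm K (\<eta>star x) ^ 4 \<partial>Dx)
                * root 4 (\<integral>x. vnorm m (\<phi>s x) ^ 4 \<partial>Dx)
            + Max (lamw ` {..<dw})
                * (\<integral>bt. (fnorm m K (mdiff (\<Theta>w bt) \<Theta>wstar))\<^sup>2 \<partial>labeled_data n D)
                * (dsw + 1 / real N * real ds * (real dw - dsw))
            + approx_error Dx m K \<phi>w \<eta>star + approx_error Dx m K \<phi>s \<eta>star)
         + L * c_unif K c wt / \<mu> * (1 / sqrt (real N)))"
\<comment> \<open>The threshold \<open>2\<close> gives \<open>ds / N \<le> 1 / 2\<close>, which
  makes \<open>dsw\<close> at most twice the factor in the theorem (up to the weight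
  \<open>lmax\<close>); hence \<open>1920 = 2 * 960\<close>.\<close>
proof (rule exI[of _ "2::real"], rule conjI, simp, rule exI[of _ "1920::real"], rule conjI, simp,
    intro allI impI)
  fix d K dx m ds dw n N :: nat
    and X :: "rvec set" and D :: "(rvec \<times> nat) measure" and Dx :: "rvec measure" and Pstar :: "rvec \<Rightarrow> rvec"
    and c :: "rvec \<Rightarrow> nat \<Rightarrow> real" and gc :: "rvec \<Rightarrow> nat \<Rightarrow> rvec" and Hc :: "rvec \<Rightarrow> nat \<Rightarrow> rmat"
    and wt \<phi>s \<phi>w \<eta>star :: "rvec \<Rightarrow> rvec" and Vs :: rmat and lams :: rvec and Vw :: rmat and lamw :: rvec
    and \<Theta>wstar :: rmat and \<Theta>w :: "(nat \<Rightarrow> rvec \<times> nat) \<Rightarrow> rmat"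
    and \<Theta>ls \<Theta>w2s :: "(nat \<Rightarrow> rvec \<times> nat) \<times> (nat \<Rightarrow> rvec) \<Rightarrow> rmat"
    and \<mu> L G B Bw \<kappa> dsw :: real
  assume dims: "1 \<le> d" "1 \<le> K" "1 \<le> n" "1 \<le> N" "0 < B"
    and D: "joint_law dx X K D" and Dx: "Dx = marginal X D" and cond: "conditional_law X K D Pstar"
    and rule: "decision_rule d K c wt"
    and \<phi>s: "\<phi>s \<in> restrict_space borel X \<rightarrow>\<^sub>M restrict_space borel (Rvec m)"
    and \<phi>w: "\<phi>w \<in> restrict_space borel X \<rightarrow>\<^sub>M restrict_space borel (Rvec m)"
    and Ss: "reduced_spectral m ds Vs lams (cross_moment Dx \<phi>s \<phi>s)"
    and Sw: "reduced_spectral m dw Vw lamw (cross_moment Dx \<phi>w \<phi>w)"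
    and dsw: "dsw = corr_dim m Dx \<phi>s \<phi>w ds Vs lams dw Vw lamw"
    and \<Theta>wstar: "is_arg_min (fit_error Dx m K \<phi>w \<eta>star) (\<lambda>\<Theta>. \<Theta> \<in> centered_mats m K) \<Theta>wstar"
    and \<Theta>w: "\<Theta>w \<in> labeled_data n D \<rightarrow>\<^sub>M restrict_space borel (Rmat m K)"
    and Bw: "AE bt in labeled_data n D. fnorm m K (\<Theta>w bt) \<le> Bw"
    and w2s: "\<forall>(bt, xs) \<in> space (all_data n N X D).
         is_arg_min (w2s_objective m K c wt \<phi>s \<phi>w N xs (\<Theta>w bt))
           (\<lambda>\<Theta>. \<Theta> \<in> fro_ball m K B) (\<Theta>w2s (bt, xs))"
    and \<eta>: "\<eta>star \<in> restrict_space borel X \<rightarrow>\<^sub>M restrict_space borel (Rvec K)"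
    and Pstar: "\<forall>x\<in>X. (\<forall>k<K. Pstar x k = softmax K (\<eta>star x) k) \<and> (\<Sum>k<K. \<eta>star x k) = 0"
    and \<eta>4: "integrable Dx (\<lambda>x. vnorm K (\<eta>star x) ^ 4)"
    and cost: "cost_assumption d K c gc Hc wt \<mu> L G"
    and \<kappa>: "subgaussian Dx (2 * m) (\<lambda>x. stack m (\<phi>s x) (\<phi>w x)) \<kappa>"
    and C0: "2 * real ds \<le> real N"
  interpret D: prob_space D using D by (simp add: joint_law_def)
  have sets_D: "sets D = sets (restrict_space borel X \<Otimes>\<^sub>M count_space {..<K})"
    using D by (simp add: joint_law_def)
  have sets_Dx: "sets Dx = sets (restrict_space borel X)" by (simp add: Dx marginal_def)
  have fst_D: "fst \<in> D \<rightarrow>\<^sub>M restrict_space borel X"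
    using measurable_cong_sets[OF sets_D refl] measurable_fst by blast
  have prob_Dx: "prob_space Dx" unfolding Dx marginal_def by (rule D.prob_space_distr[OF fst_D])
  have Dx_meas: "f \<in> Dx \<rightarrow>\<^sub>M S" if "f \<in> restrict_space borel X \<rightarrow>\<^sub>M S" for f :: "rvec \<Rightarrow> rvec" and S
    using that measurable_cong_sets[OF sets_Dx refl] by blast
  have stack: "stack m u v i = u i" "stack m u v (m + i) = v i" if "i < m" for u v i
    using that by (auto simp: stack_def)
  have sq_s: "sq_integrable Dx (\<lambda>x. \<phi>s x i)" if "i < m" for i
    using subgaussian_sq_integrable[OF \<kappa>, of i] that borel_measurable_component[OF Dx_meas[OF \<phi>s]]
    by (simp add: stack)
  have sq_w: "sq_integrable Dx (\<lambda>x. \<phi>w x i)" if "i < m" for i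
    using subgaussian_sq_integrable[OF \<kappa>, of "m + i"] that borel_measurable_component[OF Dx_meas[OF \<phi>w]]
    by (simp add: stack)
  have sq_\<eta>: "sq_integrable Dx (\<lambda>x. \<eta>star x k)" if "k < K" for k
    using sq_integrable_of_vnorm4[OF prob_Dx that borel_measurable_component[OF Dx_meas[OF \<eta>]] \<eta>4] .
  have \<eta>_meas: "\<eta>star \<in> borel_measurable Dx"
    using Dx_meas[OF \<eta>] by (simp add: measurable_restrict_space2_iff)
  interpret w2s d K c gc Hc wt \<mu> L G Dx m ds dw N \<phi>s \<phi>w \<eta>star Vs Vw lams lamw B
    by (intro w2s.intro w2s_axioms.intro decision_problem.intro)
      (fact dims rule cost sq_s sq_w sq_\<eta> \<eta>_meas Ss Sw prob_Dx)+
  have Pstar_eq: "Pstar x = softmax K (\<eta>star x)" if "x \<in> X" for x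
  proof
    fix k
    have "Pstar x \<in> Rvec K" using cond that by (auto simp: conditional_law_def prob_simplex_def)
    then show "Pstar x k = softmax K (\<eta>star x) k"
      using Pstar that by (cases "k < K") (auto simp: Rvec_def softmax_def)
  qed
  have risk_eq: "risk D c (policy m K wt \<phi>s \<Theta>) - risk D c (\<lambda>x. wt (Pstar x)) = (\<integral>x. h \<Theta> x \<partial>Dx)" for \<Theta>
    by (rule excess_risk_eq[OF D Dx cond Pstar_eq])

  let ?Lab = "labeled_data n D" and ?Unl = "PiM {..<N} (\<lambda>_. Dx)"
  interpret Lab: prob_space ?Lab
    unfolding labeled_data_def by (intro prob_space_PiM D.prob_space_axioms)
  interpret Unl: prob_space ?Unl by (intro prob_space_PiM prob_Dx)
  interpret All: pair_prob_space ?Lab ?Unl ..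
  have all_eq: "all_data n N X D = ?Lab \<Otimes>\<^sub>M ?Unl" by (simp add: all_data_def Dx)

  define a where "a = L\<^sup>2 * G\<^sup>2 / \<mu> ^ 3"
  define b where "b = L * G\<^sup>2 / \<mu>\<^sup>2"
  define \<rho> where "\<rho> bt = rho_sw Dx m K B \<phi>s \<phi>w (\<Theta>w bt)" for bt
  define e where "e bt = (fnorm m K (mdiff (\<Theta>w bt) \<Theta>wstar))\<^sup>2" for bt
  define r where "r \<omega> = (\<integral>x. h (\<Theta>w2s \<omega>) x \<partial>Dx)" for \<omega>
  define lmax where "lmax = Max (lamw ` {..<dw})"
  define \<rho>s where "\<rho>s = approx_error Dx m K \<phi>s \<eta>star"
  define \<rho>w where "\<rho>w = approx_error Dx m K \<phi>w \<eta>star"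
  define tr where "tr = sqrt (mtrace m (cross_moment Dx \<phi>s \<phi>s))"
  define t where "t = B * tr / sqrt (real N)"
  define E\<rho> where "E\<rho> = (\<integral>bt. \<rho> bt \<partial>?Lab)"
  define Ee where "Ee = (\<integral>bt. e bt \<partial>?Lab)"
  define g where "g bt = 960 * (a + b) * \<rho> bt + 960 * b * (\<rho>w + \<rho>s + lmax * e bt * dsw) + 16 * b * real K * t" for bt

  have \<Theta>w_meas: "\<Theta>w \<in> borel_measurable ?Lab"
    using \<Theta>w by (simp add: measurable_restrict_space2_iff)
  have sq_bound: "AE bt in ?Lab. (fnorm m K (\<Theta>w bt))\<^sup>2 \<le> Bw\<^sup>2"
    using Bw by eventually_elim (rule power_mono; simp)
  have int_\<rho>: "integrable ?Lab \<rho>"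
  proof (rule Lab.integrable_const_bound)
    show "\<rho> \<in> borel_measurable ?Lab"
      unfolding \<rho>_def using dims(5) by (intro measurable_compose[OF \<Theta>w_meas rho_sw_measurable] sq_s sq_w) auto
    let ?T = "\<integral>x. (\<Sum>i<m. (\<phi>w x i)\<^sup>2) \<partial>Dx"
    have "0 \<le> ?T" by (intro Bochner_Integration.integral_nonneg sum_nonneg) auto
    show "AE bt in ?Lab. norm (\<rho> bt) \<le> Bw\<^sup>2 * ?T"
      using sq_bound
    proof eventually_elim
      fix bt assume "(fnorm m K (\<Theta>w bt))\<^sup>2 \<le> Bw\<^sup>2"
      then have "(fnorm m K (\<Theta>w bt))\<^sup>2 * ?T \<le> Bw\<^sup>2 * ?T" using \<open>0 \<le> ?T\<close> by (rule mult_right_mono)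
      moreover have "\<rho> bt \<le> (fnorm m K (\<Theta>w bt))\<^sup>2 * ?T"
        unfolding \<rho>_def using dims(5) by (intro rho_sw_le sq_s sq_w) auto
      moreover have "0 \<le> \<rho> bt" unfolding \<rho>_def using dims(5) by (intro rho_sw_nonneg) auto
      ultimately show "norm (\<rho> bt) \<le> Bw\<^sup>2 * ?T" by simp
    qed
  qed
  have int_e: "integrable ?Lab e"
  proof (rule Lab.integrable_const_bound)
    show "e \<in> borel_measurable ?Lab"
      unfolding e_def by (intro borel_measurable_power measurable_compose[OF \<Theta>w_meas fnorm_mdiff_measurable])
    show "AE bt in ?Lab. norm (e bt) \<le> 2 * Bw\<^sup>2 + 2 * (fnorm m K \<Theta>wstar)\<^sup>2"
      using sq_bound
    proof eventually_elim
      fix bt assume "(fnorm m K (\<Theta>w bt))\<^sup>2 \<le> Bw\<^sup>2"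
      then show "norm (e bt) \<le> 2 * Bw\<^sup>2 + 2 * (fnorm m K \<Theta>wstar)\<^sup>2"
        using fnorm_mdiff_le[of m K "\<Theta>w bt" \<Theta>wstar] by (simp add: e_def)
    qed
  qed
  have int_g: "integrable ?Lab g" unfolding g_def using int_\<rho> int_e by simp
  have Eg: "(\<integral>bt. g bt \<partial>?Lab) = 960 * (a + b) * E\<rho> + 960 * b * (\<rho>w + \<rho>s + lmax * Ee * dsw) + 16 * b * real K * t"
    unfolding g_def E\<rho>_def Ee_def using int_\<rho> int_e by (simp add: Lab.prob_space)

  have ab: "0 \<le> a" "0 \<le> b" using mu_pos L_pos by (auto simp: a_def b_def)
  have "0 \<le> mtrace m (cross_moment Dx \<phi>s \<phi>s)"
    unfolding mtrace_def cross_moment_def by (intro sum_nonneg Bochner_Integration.integral_nonneg) auto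
  then have t: "0 \<le> t" using dims(5) by (simp add: t_def tr_def)
  have E\<rho>: "0 \<le> E\<rho>"
    unfolding E\<rho>_def \<rho>_def using dims(5) by (intro Bochner_Integration.integral_nonneg rho_sw_nonneg) auto
  have Ee: "0 \<le> Ee" unfolding Ee_def e_def by (intro Bochner_Integration.integral_nonneg) auto
  have "\<Theta>wstar \<in> centered_mats m K" using \<Theta>wstar by (simp add: is_arg_min_def)
  then have \<rho>sw: "0 \<le> \<rho>s" "0 \<le> \<rho>w"
    unfolding \<rho>s_def \<rho>w_def approx_error_def by (intro cINF_greatest; auto simp: fit_error_nonneg)+
  have dsw_nonneg: "0 \<le> dsw" by (simp add: dsw corr_dim_def)
  have lmax_dsw: "0 \<le> lmax * dsw"
  \<comment> \<open>As the maximum of the empty set is unspecified, \<open>lmax\<close> has a known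
    sign only for positive \<open>dw\<close>. It is therefore always used in a product with
    \<open>dsw\<close> or \<open>dw\<close>.\<close>
  proof (cases "dw = 0")
    case True
    have "dsw = 0" unfolding dsw corr_dim_eq[OF Ss Sw] using True by simp
    then show ?thesis by simp
  next
    case False
    then have "lamw 0 \<le> lmax" "0 < lamw 0"
      using reduced_spectralD(1)[OF Sw] by (auto simp: lmax_def intro: Max_ge)
    then show ?thesis using dsw_nonneg by simp
  qed

  have Ee_dsw: "0 \<le> lmax * Ee * dsw"
    using mult_nonneg_nonneg[OF lmax_dsw Ee] by (simp add: mult_ac)
  have lmax_dw: "0 \<le> lmax * real dw"
  proof (cases "dw = 0")
    case False
    then have "lamw 0 \<le> lmax" "0 < lamw 0"
      using reduced_spectralD(1)[OF Sw] by (auto simp: lmax_def intro: Max_ge)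
    then show ?thesis by simp
  qed simp

  \<comment> \<open>Fubini reduces the claim to almost every labeled sample; for such a sample the
    inner integrand is integrable and \<open>sample_bound\<close> applies with the weak estimate as
    the constant matrix.\<close>
  have LHS: "(\<integral>\<omega>. r \<omega> \<partial>all_data n N X D) \<le> (\<integral>bt. g bt \<partial>?Lab)"
  proof (cases "integrable (?Lab \<Otimes>\<^sub>M ?Unl) r")
    case True
    have "(\<integral>\<omega>. r \<omega> \<partial>(?Lab \<Otimes>\<^sub>M ?Unl)) = (\<integral>bt. (\<integral>xs. r (bt, xs) \<partial>?Unl) \<partial>?Lab)"
      by (rule All.integral_fst'[OF True, symmetric])
    also have "\<dots> \<le> (\<integral>bt. g bt \<partial>?Lab)"
    proof (rule integral_mono_AE)
      show "integrable ?Lab (\<lambda>bt. \<integral>xs. r (bt, xs) \<partial>?Unl)" by (rule All.integrable_fst'[OF True])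
      show "AE bt in ?Lab. (\<integral>xs. r (bt, xs) \<partial>?Unl) \<le> g bt"
        using All.AE_integrable_fst'[OF True] AE_space
      proof eventually_elim
        fix bt assume int: "integrable ?Unl (\<lambda>xs. r (bt, xs))" and bt: "bt \<in> space ?Lab"
        have "is_arg_min (w2s_objective m K c wt \<phi>s \<phi>w N xs (\<Theta>w bt)) (\<lambda>\<Theta>. \<Theta> \<in> fro_ball m K B) (\<Theta>w2s (bt, xs))"
          if "xs \<in> space ?Unl" for xs
          using w2s bt that by (auto simp: all_eq space_pair_measure)
        from sample_bound[OF this int[unfolded r_def] \<Theta>wstar]
        show "(\<integral>xs. r (bt, xs) \<partial>?Unl) \<le> g bt"
          by (simp add: r_def g_def a_def b_def t_def tr_def \<rho>_def e_def \<rho>s_def \<rho>w_def lmax_def dsw mult_ac)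
      qed
    qed (rule int_g)
    finally show ?thesis by (simp add: all_eq)
  next
    \<comment> \<open>The Bochner integral is \<open>0\<close> in this case, so no measurability of the excess risk is needed.\<close>
    case False
    then have "(\<integral>\<omega>. r \<omega> \<partial>all_data n N X D) = 0" by (simp add: all_eq not_integrable_integral_eq)
    also have "0 \<le> (\<integral>bt. g bt \<partial>?Lab)"
      unfolding Eg using ab t E\<rho> Ee_dsw \<rho>sw by simp
    finally show ?thesis .
  qed

  define x1 where "x1 = Bw\<^sup>2 / sqrt (real N) * sqrt (\<integral>x. vnorm m (\<phi>w x) ^ 4 \<partial>Dx)"
  define x2 where "x2 = B\<^sup>2 / sqrt (real N) * sqrt (\<integral>x. vnorm m (\<phi>s x) ^ 4 \<partial>Dx)"
  define x3 where "x3 = B * Bw / sqrt (real N) * sqrt (\<integral>x. (vnorm m (\<phi>s x))\<^sup>2 * (vnorm m (\<phi>w x))\<^sup>2 \<partial>Dx)"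
  define x4 where "x4 = 1 / sqrt (real N) * sqrt (\<integral>x. vnorm K (\<eta>star x) ^ 4 \<partial>Dx)"
  define x5 where "x5 = B / sqrt (real N) * root 4 (\<integral>x. vnorm K (\<eta>star x) ^ 4 \<partial>Dx)
      * root 4 (\<integral>x. vnorm m (\<phi>s x) ^ 4 \<partial>Dx)"
  define x6 where "x6 = L * c_unif K c wt / \<mu> * (1 / sqrt (real N))"
  define \<Delta> where "\<Delta> = dsw + 1 / real N * real ds * (real dw - dsw)"
  have "AE bt in ?Lab. 0 \<le> Bw"
    using Bw by eventually_elim (rule order_trans[OF fnorm_nonneg])
  \<comment> \<open>The almost sure statement does not mention \<open>bt\<close>, so on a
    probability space it simply holds.\<close>
  then have "0 \<le> Bw" by simp
  then have x123: "0 \<le> x1" "0 \<le> x2" "0 \<le> x3"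
    unfolding x1_def x2_def x3_def using dims(5) by (auto intro!: mult_nonneg_nonneg Bochner_Integration.integral_nonneg)
  have x45: "0 \<le> x4" "0 \<le> x5"
    unfolding x4_def x5_def using dims(5)
    by (auto intro!: mult_nonneg_nonneg Bochner_Integration.integral_nonneg real_root_ge_zero)
  have "\<bar>c (wt (softmax K (\<lambda>_. 0))) 0\<bar> \<le> c_unif K c wt"
    unfolding c_unif_def using dims(2) by (intro Max_ge) auto
  then have "0 \<le> c_unif K c wt" by linarith
  then have x6: "0 \<le> x6" unfolding x6_def using mu_pos L_pos by auto
  \<comment> \<open>With \<open>q = ds / N\<close> the factor \<open>\<Delta>\<close> is the convex
    combination \<open>(1 - q) * dsw + q * dw\<close>, and \<open>q \<le> 1 / 2\<close>. Every term
    keeps the factor \<open>lmax\<close>, whose sign alone may be unknown.\<close>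
  have \<Delta>: "lmax * dsw \<le> 2 * (lmax * \<Delta>)"
  proof -
    have "1 / real N * real ds \<le> 1 / 2" using C0 dims(4) by (simp add: field_simps)
    from mult_right_mono[OF this lmax_dsw]
    have "1 / real N * real ds * (lmax * dsw) \<le> 1 / 2 * (lmax * dsw)" .
    moreover have "0 \<le> 1 / real N * real ds * (lmax * real dw)" using lmax_dw by simp
    moreover have "2 * (lmax * \<Delta>) = 2 * (lmax * dsw) + 2 * (1 / real N * real ds * (lmax * real dw))
        - 2 * (1 / real N * real ds * (lmax * dsw))"
    proof -
      have "2 * (l * (x + q * (y - x))) = 2 * (l * x) + 2 * (q * (l * y)) - 2 * (q * (l * x))"
        for l x y q :: real by (simp add: algebra_simps)
      then show ?thesis unfolding \<Delta>_def .
    qed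
    ultimately show ?thesis by linarith
  qed
  have "960 * (a + b) * E\<rho> \<le> 1920 * (real K * (a + b) * (E\<rho> + x1 + x2 + x3))"
  proof -
    have "(a + b) * E\<rho> \<le> real K * (a + b) * (E\<rho> + x1 + x2 + x3)"
      using ab E\<rho> x123 dims(2) mult_right_mono[of 1 "real K" "a + b"] by (intro mult_mono) auto
    moreover have "0 \<le> (a + b) * E\<rho>" using ab E\<rho> by simp
    ultimately show ?thesis by linarith
  qed
  moreover have "960 * b * (\<rho>w + \<rho>s + lmax * Ee * dsw) + 16 * b * real K * t
      \<le> 1920 * (real K * b * (x4 + t + x5 + lmax * Ee * \<Delta> + \<rho>w + \<rho>s))"
  proof -
    have "lmax * Ee * dsw \<le> 2 * (lmax * Ee * \<Delta>)"
      using mult_left_mono[OF \<Delta> Ee] by (simp add: mult_ac)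
    then have le: "0 \<le> \<rho>w + \<rho>s + lmax * Ee * dsw"
        "\<rho>w + \<rho>s + lmax * Ee * dsw \<le> 2 * (x4 + x5 + lmax * Ee * \<Delta> + \<rho>w + \<rho>s)"
      using Ee_dsw \<rho>sw x45 unfolding distrib_left by linarith+
    have "b * (\<rho>w + \<rho>s + lmax * Ee * dsw) \<le> (real K * b) * (2 * (x4 + x5 + lmax * Ee * \<Delta> + \<rho>w + \<rho>s))"
      using le ab dims(2) mult_right_mono[of 1 "real K" b] by (intro mult_mono) auto
    moreover have "0 \<le> real K * b * t" using ab t by simp
    ultimately show ?thesis by (simp add: algebra_simps)
  qed
  ultimately have "(\<integral>bt. g bt \<partial>?Lab) \<le> 1920 * (real K * (a + b) * (E\<rho> + x1 + x2 + x3)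
      + real K * b * (x4 + t + x5 + lmax * Ee * \<Delta> + \<rho>w + \<rho>s) + x6)"
    unfolding Eg using x6 by (simp add: distrib_left)
  moreover have "real K * (a + b) = L\<^sup>2 * real K * G\<^sup>2 / \<mu> ^ 3 + L * real K * G\<^sup>2 / \<mu>\<^sup>2"
    "real K * b = L * real K * G\<^sup>2 / \<mu>\<^sup>2"
    by (simp_all add: a_def b_def algebra_simps)
  ultimately have "(\<integral>\<omega>. r \<omega> \<partial>all_data n N X D) \<le> 1920 * ((L\<^sup>2 * real K * G\<^sup>2 / \<mu> ^ 3 + L * real K * G\<^sup>2 / \<mu>\<^sup>2) * (E\<rho> + x1 + x2 + x3)
      + L * real K * G\<^sup>2 / \<mu>\<^sup>2 * (x4 + t + x5 + lmax * Ee * \<Delta> + \<rho>w + \<rho>s) + x6)"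
    using LHS by simp
  then show "(\<integral>\<omega>. (risk D c (policy m K wt \<phi>s (\<Theta>w2s \<omega>)) - risk D c (\<lambda>x. wt (Pstar x)))
          \<partial>all_data n N X D)
      \<le> 1920 *
        ((L\<^sup>2 * real K * G\<^sup>2 / \<mu> ^ 3 + L * real K * G\<^sup>2 / \<mu>\<^sup>2) *
           ((\<integral>bt. rho_sw Dx m K B \<phi>s \<phi>w (\<Theta>w bt) \<partial>labeled_data n D)
            + Bw\<^sup>2 / sqrt (real N) * sqrt (\<integral>x. vnorm m (\<phi>w x) ^ 4 \<partial>Dx)
            + B\<^sup>2 / sqrt (real N) * sqrt (\<integral>x. vnorm m (\<phi>s x) ^ 4 \<partial>Dx)
            + B * Bw / sqrt (real N)
                * sqrt (\<integral>x. (vnorm m (\<phi>s x))\<^sup>2 * (vnorm m (\<phi>w x))\<^sup>2 \<partial>Dx))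
         + L * real K * G\<^sup>2 / \<mu>\<^sup>2 *
           (1 / sqrt (real N) * sqrt (\<integral>x. vnorm K (\<eta>star x) ^ 4 \<partial>Dx)
            + B * sqrt (mtrace m (cross_moment Dx \<phi>s \<phi>s)) / sqrt (real N)
            + B / sqrt (real N) * root 4 (\<integral>x. vnorm K (\<eta>star x) ^ 4 \<partial>Dx)
                * root 4 (\<integral>x. vnorm m (\<phi>s x) ^ 4 \<partial>Dx)
            + Max (lamw ` {..<dw})
                * (\<integral>bt. (fnorm m K (mdiff (\<Theta>w bt) \<Theta>wstar))\<^sup>2 \<partial>labeled_data n D)
                * (dsw + 1 / real N * real ds * (real dw - dsw))
            + approx_error Dx m K \<phi>w \<eta>star + approx_error Dx m K \<phi>s \<eta>star)
         + L * c_unif K c wt / \<mu> * (1 / sqrt (real N)))"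
    unfolding r_def risk_eq E\<rho>_def \<rho>_def x1_def x2_def x3_def x4_def x5_def x6_def t_def tr_def lmax_def Ee_def e_def
      \<Delta>_def \<rho>w_def \<rho>s_def .
qed

end
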